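(* Let $L\in\mathcal{L}$ be such that $L$ and $L^*$ have order continuous norms. Let $\alpha_1,\dots,\alpha_m$ be positive numbers with $\sum_{j=1}^m\alpha_j\ge1$, let $n\in\mathbb{N}$, let $r\in\{\rho_{ess},\hat\rho_{ess}\}$, and let $\{\Psi_{ij}\}_{i=1,\dots,k;\ j=1,\dots,m}$ be bounded sets of nonnegative matrices that define operators on $L$. Then $$r\left(\left(\Psi_{11}^{(\alpha_1)}\circ\cdots\circ\Psi_{1m}^{(\alpha_m)}\right)+\cdots+\left(\Psi_{k1}^{(\alpha_1)}\circ\cdots\circ\Psi_{km}^{(\alpha_m)}\right)\right)\le r\left((\Psi_{11}+\cdots+\Psi_{k1})^{(\alpha_1)}\circ\cdots\circ(\Psi_{1m}+\cdots+\Psi_{km})^{(\alpha_m)}\right)$$ $$\le r\left(((\Psi_{11}+\cdots+\Psi_{k1})^n)^{(\alpha_1)}\circ\cdots\circ((\Psi_{1m}+\cdots+\Psi_{km})^n)^{(\alpha_m)}\right)^{1/n}\le r(\Psi_{11}+\cdots+\Psi_{k1})^{\alpha_1}\cdots r(\Psi_{1m}+\cdots+\Psi_{km})^{\alpha_m}.$$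
   Context: Let $R=\mathbb{N}$ or $R=\{1,\dots,N\}$. A Banach sequence space is a Banach space $L$ of complex sequences indexed by $R$ such that if $x$ is a complex sequence, $y\in L$ and $|x|\le|y|$ entrywise, then $x\in L$ and $\|x\|_L\le\|y\|_L$. $\mathcal{L}$ is the class of Banach sequence spaces containing every standard unit vector $e_n$ with $\|e_n\|_L=1$. A Banach lattice has order continuous norm if every decreasing net $0\le f_\alpha\downarrow0$ satisfies $\|f_\alpha\|\to0$; $L^*$ is the Banach dual of $L$. A nonnegative matrix $A=[a_{ij}]$ defines an operator on $L$ if $(Ax)_i=\sum_j a_{ij}x_j$ converges absolutely and $Ax\in L$ for all $x\in L$. Hadamard power $A^{(t)}=[a_{ij}^t]$, Hadamard product $A\circ B=[a_{ij}b_{ij}]$. For sets: $\Psi+\Sigma=\{A+B:A\in\Psi,B\in\Sigma\}$, $\Psi^n=\{A_1\cdots A_n: A_i\in\Psi\}$, and $\Psi_1^{(\alpha_1)}\circ\cdots\circ\Psi_m^{(\alpha_m)}=\{A_1^{(\alpha_1)}\circ\cdots\circ A_m^{(\alpha_m)}: A_j\in\Psi_j\}$. $\gamma(T)$ is the Hausdorff measure of noncompactness, $\rho_{ess}(T)$ the essential spectral radius. For a bounded set $\Sigma$ of operators: $\rho_{ess}(\Sigma)=\sup_m[\sup_{A\in\Sigma^m}\rho_{ess}(A)]^{1/m}$ (generalized essential spectral radius) and $\hat\rho_{ess}(\Sigma)=\lim_{m\to\infty}[\sup_{A\in\Sigma^m}\gamma(A)]^{1/m}$ (joint essential spectral radius).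 *)

theory Defs
  imports "HOL-Analysis.Analysis" "HOL-Library.Function_Algebras"
begin

type_synonym seq = "nat \<Rightarrow> complex"
type_synonym mat = "nat \<Rightarrow> nat \<Rightarrow> real"
type_synonym seqop = "seq \<Rightarrow> seq"

definition seq_scale :: "complex \<Rightarrow> seq \<Rightarrow> seq" where
  "seq_scale c x = (\<lambda>i. c * x i)"

definition unit_vec :: "nat \<Rightarrow> seq" where
  "unit_vec n = (\<lambda>i. if i = n then 1 else 0)"

definition banach_seq_space :: "nat set \<Rightarrow> seq set \<Rightarrow> (seq \<Rightarrow> real) \<Rightarrow> bool" where
  "banach_seq_space R L nrm \<longleftrightarrow>
     (R = UNIV \<or> (\<exists>N\<ge>1. R = {1..N})) \<and>
     (\<forall>x\<in>L. \<forall>i. i \<notin> R \<longrightarrow> x i = 0) \<and>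
     0 \<in> L \<and> (\<forall>x\<in>L. \<forall>y\<in>L. x + y \<in> L) \<and> (\<forall>c. \<forall>x\<in>L. seq_scale c x \<in> L) \<and>
     (\<forall>x\<in>L. nrm x \<ge> 0) \<and> (\<forall>x\<in>L. nrm x = 0 \<longleftrightarrow> x = 0) \<and>
     (\<forall>c. \<forall>x\<in>L. nrm (seq_scale c x) = cmod c * nrm x) \<and>
     (\<forall>x\<in>L. \<forall>y\<in>L. nrm (x + y) \<le> nrm x + nrm y) \<and>
     (\<forall>X. (\<forall>n. X n \<in> L) \<and> (\<forall>e>0. \<exists>M. \<forall>p\<ge>M. \<forall>q\<ge>M. nrm (X p - X q) < e)
          \<longrightarrow> (\<exists>x\<in>L. (\<lambda>n. nrm (X n - x)) \<longlonglongrightarrow> 0)) \<and>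
     (\<forall>x y. y \<in> L \<and> (\<forall>i. cmod (x i) \<le> cmod (y i)) \<longrightarrow> x \<in> L \<and> nrm x \<le> nrm y)"

definition class_L :: "nat set \<Rightarrow> seq set \<Rightarrow> (seq \<Rightarrow> real) \<Rightarrow> bool" where
  "class_L R L nrm \<longleftrightarrow> banach_seq_space R L nrm \<and>
     (\<forall>n\<in>R. unit_vec n \<in> L \<and> nrm (unit_vec n) = 1)"

text \<open>V is the real (self-adjoint) part of the complex Banach lattice, le its order, nrm its norm.
  A decreasing net 0 \<le> f_\<alpha> \<down> 0 is represented by its range D: a nonempty downward directed
  set of positive elements whose infimum (greatest lower bound in V) is 0; convergence of the
  net's norms to 0 is expressed as net convergence along D ordered by le.\<close>

definition order_cont :: "'v::zero set \<Rightarrow> ('v \<Rightarrow> 'v \<Rightarrow> bool) \<Rightarrow> ('v \<Rightarrow> real) \<Rightarrow> bool" where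
  "order_cont V le nrm \<longleftrightarrow>
     (\<forall>D. D \<noteq> {} \<and> D \<subseteq> V \<and> (\<forall>f\<in>D. le 0 f) \<and>
          (\<forall>a\<in>D. \<forall>b\<in>D. \<exists>c\<in>D. le c a \<and> le c b) \<and>
          (\<forall>g\<in>V. (\<forall>f\<in>D. le g f) \<longrightarrow> le g 0)
        \<longrightarrow> (\<forall>e>0. \<exists>f0\<in>D. \<forall>f\<in>D. le f f0 \<longrightarrow> nrm f < e))"

definition real_seq :: "seq \<Rightarrow> bool" where
  "real_seq x \<longleftrightarrow> (\<forall>i. Im (x i) = 0)"

definition pos_seq :: "seq \<Rightarrow> bool" where
  "pos_seq x \<longleftrightarrow> (\<forall>i. Im (x i) = 0 \<and> Re (x i) \<ge> 0)"

definition seq_le :: "seq \<Rightarrow> seq \<Rightarrow> bool" where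
  "seq_le x y \<longleftrightarrow> (\<forall>i. Re (x i) \<le> Re (y i))"

definition oc_norm :: "seq set \<Rightarrow> (seq \<Rightarrow> real) \<Rightarrow> bool" where
  "oc_norm L nrm \<longleftrightarrow> order_cont {x\<in>L. real_seq x} seq_le nrm"

definition dual_space :: "seq set \<Rightarrow> (seq \<Rightarrow> real) \<Rightarrow> (seq \<Rightarrow> complex) set" where
  "dual_space L nrm = {\<phi>. (\<forall>x\<in>L. \<forall>y\<in>L. \<phi> (x + y) = \<phi> x + \<phi> y) \<and>
       (\<forall>c. \<forall>x\<in>L. \<phi> (seq_scale c x) = c * \<phi> x) \<and>
       (\<exists>C. \<forall>x\<in>L. cmod (\<phi> x) \<le> C * nrm x) \<and> (\<forall>x. x \<notin> L \<longrightarrow> \<phi> x = 0)}"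

definition dual_norm :: "seq set \<Rightarrow> (seq \<Rightarrow> real) \<Rightarrow> (seq \<Rightarrow> complex) \<Rightarrow> real" where
  "dual_norm L nrm \<phi> = (SUP x\<in>{x\<in>L. nrm x \<le> 1}. cmod (\<phi> x))"

definition dual_le :: "seq set \<Rightarrow> (seq \<Rightarrow> complex) \<Rightarrow> (seq \<Rightarrow> complex) \<Rightarrow> bool" where
  "dual_le L \<phi> \<psi> \<longleftrightarrow> (\<forall>x\<in>L. pos_seq x \<longrightarrow> Re (\<phi> x) \<le> Re (\<psi> x))"

definition dual_oc_norm :: "seq set \<Rightarrow> (seq \<Rightarrow> real) \<Rightarrow> bool" where
  "dual_oc_norm L nrm \<longleftrightarrow>
     order_cont {\<phi>\<in>dual_space L nrm. \<forall>x\<in>L. real_seq x \<longrightarrow> Im (\<phi> x) = 0}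
                (dual_le L) (dual_norm L nrm)"

definition mat_op :: "nat set \<Rightarrow> mat \<Rightarrow> seqop" where
  "mat_op R A x = (\<lambda>i. if i \<in> R then (\<Sum>\<^sub>\<infinity>j\<in>R. complex_of_real (A i j) * x j) else 0)"

definition nonneg_mat :: "mat \<Rightarrow> bool" where
  "nonneg_mat A \<longleftrightarrow> (\<forall>i j. A i j \<ge> 0)"

definition defines_op :: "nat set \<Rightarrow> seq set \<Rightarrow> mat \<Rightarrow> bool" where
  "defines_op R L A \<longleftrightarrow> (\<forall>x\<in>L. (\<forall>i\<in>R. (\<lambda>j. norm (complex_of_real (A i j) * x j)) summable_on R)
                                \<and> mat_op R A x \<in> L)"

definition bounded_ops :: "seq set \<Rightarrow> (seq \<Rightarrow> real) \<Rightarrow> seqop set \<Rightarrow> bool" where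
  "bounded_ops L nrm S \<longleftrightarrow> (\<exists>C. \<forall>T\<in>S. \<forall>x\<in>L. nrm (T x) \<le> C * nrm x)"

definition mat_mult :: "nat set \<Rightarrow> mat \<Rightarrow> mat \<Rightarrow> mat" where
  "mat_mult R A B = (\<lambda>i j. \<Sum>\<^sub>\<infinity>l\<in>R. A i l * B l j)"

definition id_mat :: mat where
  "id_mat = (\<lambda>i j. if i = j then 1 else 0)"

fun mat_set_pow :: "nat set \<Rightarrow> mat set \<Rightarrow> nat \<Rightarrow> mat set" where
  "mat_set_pow R S 0 = {id_mat}"
| "mat_set_pow R S (Suc n) = {mat_mult R A B | A B. A \<in> S \<and> B \<in> mat_set_pow R S n}"

definition set_sum :: "(nat \<Rightarrow> mat set) \<Rightarrow> nat \<Rightarrow> mat set" where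
  "set_sum S k = {(\<lambda>a b. \<Sum>i\<in>{1..k}. F i a b) | F. \<forall>i\<in>{1..k}. F i \<in> S i}"

definition hadamard_set :: "(nat \<Rightarrow> mat set) \<Rightarrow> (nat \<Rightarrow> real) \<Rightarrow> nat \<Rightarrow> mat set" where
  "hadamard_set S \<alpha> m = {(\<lambda>a b. \<Prod>j\<in>{1..m}. (F j a b) powr (\<alpha> j)) | F. \<forall>j\<in>{1..m}. F j \<in> S j}"

definition bounded_linear_op :: "seq set \<Rightarrow> (seq \<Rightarrow> real) \<Rightarrow> seqop \<Rightarrow> bool" where
  "bounded_linear_op L nrm T \<longleftrightarrow> (\<forall>x\<in>L. T x \<in> L) \<and>
     (\<forall>x\<in>L. \<forall>y\<in>L. T (x + y) = T x + T y) \<and> (\<forall>c. \<forall>x\<in>L. T (seq_scale c x) = seq_scale c (T x)) \<and>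
     (\<exists>C. \<forall>x\<in>L. nrm (T x) \<le> C * nrm x)"

definition unit_ball :: "seq set \<Rightarrow> (seq \<Rightarrow> real) \<Rightarrow> seq set" where
  "unit_ball L nrm = {x\<in>L. nrm x \<le> 1}"

definition hmnc_set :: "seq set \<Rightarrow> (seq \<Rightarrow> real) \<Rightarrow> seq set \<Rightarrow> real" where
  "hmnc_set L nrm S = Inf {e. e > 0 \<and> (\<exists>F. finite F \<and> F \<subseteq> L \<and> S \<subseteq> (\<Union>c\<in>F. {x\<in>L. nrm (x - c) \<le> e}))}"

definition hmnc :: "seq set \<Rightarrow> (seq \<Rightarrow> real) \<Rightarrow> seqop \<Rightarrow> real" where
  "hmnc L nrm T = hmnc_set L nrm (T ` unit_ball L nrm)"

definition compact_operator :: "seq set \<Rightarrow> (seq \<Rightarrow> real) \<Rightarrow> seqop \<Rightarrow> bool" where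
  "compact_operator L nrm T \<longleftrightarrow> bounded_linear_op L nrm T \<and>
     (\<forall>X::nat \<Rightarrow> seq. (\<forall>n. X n \<in> unit_ball L nrm) \<longrightarrow>
        (\<exists>(\<phi>::nat \<Rightarrow> nat) y. strict_mono \<phi> \<and> y \<in> L \<and> (\<lambda>n. nrm (T (X (\<phi> n)) - y)) \<longlonglongrightarrow> 0))"

text \<open>Essential spectrum: spectrum in the Calkin algebra.\<close>
definition ess_spectrum :: "seq set \<Rightarrow> (seq \<Rightarrow> real) \<Rightarrow> seqop \<Rightarrow> complex set" where
  "ess_spectrum L nrm T = {z. \<not> (\<exists>S. bounded_linear_op L nrm S \<and>
       compact_operator L nrm (\<lambda>x. S (seq_scale z x - T x) - x) \<and>
       compact_operator L nrm (\<lambda>x. seq_scale z (S x) - T (S x) - x))}"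

definition ess_rad :: "seq set \<Rightarrow> (seq \<Rightarrow> real) \<Rightarrow> seqop \<Rightarrow> real" where
  "ess_rad L nrm T = Sup ({cmod z | z. z \<in> ess_spectrum L nrm T} \<union> {0})"

fun op_set_pow :: "seqop set \<Rightarrow> nat \<Rightarrow> seqop set" where
  "op_set_pow S 0 = {id}"
| "op_set_pow S (Suc n) = {T \<circ> U | T U. T \<in> S \<and> U \<in> op_set_pow S n}"

text \<open>Generalized and joint essential spectral radius of a bounded set of operators
  (suprema of sets of nonnegative reals are taken with the convention sup {} = 0).\<close>
definition gen_ess_rad :: "seq set \<Rightarrow> (seq \<Rightarrow> real) \<Rightarrow> seqop set \<Rightarrow> real" where
  "gen_ess_rad L nrm S = Sup ({(Sup ({ess_rad L nrm T | T. T \<in> op_set_pow S m} \<union> {0})) powr (1 / real m)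
                               | m. m \<ge> 1} \<union> {0})"

definition joint_ess_rad :: "seq set \<Rightarrow> (seq \<Rightarrow> real) \<Rightarrow> seqop set \<Rightarrow> real" where
  "joint_ess_rad L nrm S = lim (\<lambda>m. (Sup ({hmnc L nrm T | T. T \<in> op_set_pow S (Suc m)} \<union> {0}))
                                    powr (1 / real (Suc m)))"

end

theory Submission
  imports Defs "HOL-Complex_Analysis.Great_Picard"
begin

text \<open>
  Order continuity of \<open>L\<close> means that the tails of every element tend to 0 in norm. Hence the
  Hausdorff measure of noncompactness of an operator \<open>T\<close> is the limit of the norms of \<open>Q\<^sub>N T\<close>,
  where \<open>Q\<^sub>N\<close> cuts off the first \<open>N\<close> coordinates. It is a submultiplicative seminorm that vanishes
  exactly on the compact operators, and it is monotone on nonnegative matrices.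

  By the weighted AM-GM inequality, \<open>\<Prod> a\<^sub>j powr \<alpha>\<^sub>j \<le> (\<Prod> t\<^sub>j powr \<alpha>\<^sub>j) (\<Sum> w\<^sub>j a\<^sub>j / t\<^sub>j)\<close>
  for \<open>0 \<le> a\<^sub>j \<le> t\<^sub>j\<close> and the weights \<open>w\<^sub>j = \<alpha>\<^sub>j / \<Sum> \<alpha>\<^sub>i\<close>. Applied to matrix entries this bounds the
  seminorm of a Hadamard product by the product of the powers of the seminorms; applied under a
  sum it is Hoelder's inequality, so products and sums of Hadamard products are dominated entrywise
  by Hadamard products of products and sums.

  The definition of \<open>\<rho>\<^sub>e\<^sub>s\<^sub>s\<close> by the essential spectrum is reduced to these facts by the
  spectral radius formula in the Calkin algebra. For a positive operator its harder half has an
  elementary proof, which shows that the limit \<open>\<nu>\<close> itself lies in the essential spectrum.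
\<close>

section \<open>Weighted means and submultiplicative sequences\<close>

text \<open>Testing a matrix on a unit vector bounds every entry in the rows from N on by the norm
  of its N-th tail. After division by such a bound the entries are at most 1, and the exponents may
  be lowered until they sum to 1. The resulting bound is linear in the matrices, with fixed
  coefficients, so it survives application to vectors and cutting off.

  A matrix acts only through its entries in R x R, and an operator matters only on L. Hence
  comparisons are made entrywise on R x R or between operators on L, and products are reassociated
  through composition of operators, never as matrices.

  The generalized radius uses the tools of the joint one: by the spectral radius formula the
  essential spectral radius of one matrix is the joint radius of a singleton. Its supremum is
  handled without roots, as the least c such that every product of p factors has radius at most
  c^p.\<close>

lemma weighted_am_gm_le_one:
  fixes b \<alpha> :: "'a \<Rightarrow> real"
  assumes fin: "finite J" "J \<noteq> {}" and \<alpha>: "\<And>j. j \<in> J \<Longrightarrow> \<alpha> j > 0" "(\<Sum>j\<in>J. \<alpha> j) \<ge> 1"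
    and b: "\<And>j. j \<in> J \<Longrightarrow> 0 \<le> b j" "\<And>j. j \<in> J \<Longrightarrow> b j \<le> 1"
  shows "(\<Prod>j\<in>J. b j powr \<alpha> j) \<le> (\<Sum>j\<in>J. \<alpha> j / sum \<alpha> J * b j)"
proof (cases "\<exists>j\<in>J. b j = 0")
  case True
  then have "(\<Prod>j\<in>J. b j powr \<alpha> j) = 0" using fin by auto
  moreover have "0 \<le> (\<Sum>j\<in>J. \<alpha> j / sum \<alpha> J * b j)"
    using \<alpha> b by (intro sum_nonneg mult_nonneg_nonneg divide_nonneg_nonneg) (auto simp: less_imp_le)
  ultimately show ?thesis by linarith
next
  case False
  let ?s = "sum \<alpha> J"
  have pos: "b j > 0" if "j \<in> J" for j using False b(1)[OF that] that by force
  \<comment> \<open>Each base lies in (0,1] and \<open>?s \<ge> 1\<close>, so passing to the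
    smaller, normalised exponents can only enlarge the factors.\<close>
  have "(\<Prod>j\<in>J. b j powr \<alpha> j) \<le> (\<Prod>j\<in>J. b j powr (\<alpha> j / ?s))"
  proof (intro prod_mono conjI)
    fix j assume j: "j \<in> J"
    have "\<alpha> j / ?s \<le> \<alpha> j" using \<alpha>(1)[OF j] \<alpha>(2) by (simp add: divide_le_eq mult_le_cancel_left1)
    then show "b j powr \<alpha> j \<le> b j powr (\<alpha> j / ?s)" using pos[OF j] b(2)[OF j] by (simp add: powr_mono')
  qed simp
  \<comment> \<open>Jensen's inequality for the convex function exp at the points
    \<open>ln (b j)\<close>; this is why zero bases were treated apart.\<close>
  also have "\<dots> = exp (\<Sum>j\<in>J. (\<alpha> j / ?s) *\<^sub>R ln (b j))"
    unfolding exp_sum[OF fin(1)] using pos by (intro prod.cong) (force simp: powr_def)+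
  also have "\<dots> \<le> (\<Sum>j\<in>J. \<alpha> j / ?s * exp (ln (b j)))"
    using convex_on_sum[OF fin exp_convex, of "\<lambda>j. \<alpha> j / ?s" "\<lambda>j. ln (b j)"] \<alpha>
    by (auto simp flip: sum_divide_distrib simp: less_imp_le)
  also have "\<dots> = (\<Sum>j\<in>J. \<alpha> j / ?s * b j)" using pos by (intro sum.cong) auto
  finally show ?thesis .
qed

text \<open>Rescaling to \<open>a j / t j\<close> reduces this to bases at most 1. The coefficients
  on the right do not depend on \<open>a\<close>, so with \<open>t\<close> fixed the bound can be
  summed over an index or applied to a vector.\<close>

lemma weighted_am_gm:
  fixes a t \<alpha> :: "'a \<Rightarrow> real"
  assumes fin: "finite J" "J \<noteq> {}" and \<alpha>: "\<And>j. j \<in> J \<Longrightarrow> \<alpha> j > 0" "(\<Sum>j\<in>J. \<alpha> j) \<ge> 1"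
    and a: "\<And>j. j \<in> J \<Longrightarrow> 0 \<le> a j" "\<And>j. j \<in> J \<Longrightarrow> a j \<le> t j" and t: "\<And>j. j \<in> J \<Longrightarrow> t j > 0"
  shows "(\<Prod>j\<in>J. a j powr \<alpha> j) \<le> (\<Sum>j\<in>J. (\<Prod>j\<in>J. t j powr \<alpha> j) * (\<alpha> j / sum \<alpha> J) / t j * a j)"
proof -
  have "(\<Prod>j\<in>J. a j powr \<alpha> j) = (\<Prod>j\<in>J. t j powr \<alpha> j) * (\<Prod>j\<in>J. (a j / t j) powr \<alpha> j)"
    unfolding prod.distrib[symmetric]
  proof (intro prod.cong refl)
    fix j assume j: "j \<in> J"
    then show "a j powr \<alpha> j = t j powr \<alpha> j * (a j / t j) powr \<alpha> j"
      using a(1)[OF j] t[OF j] by (simp flip: powr_mult)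
  qed
  also have "\<dots> \<le> (\<Prod>j\<in>J. t j powr \<alpha> j) * (\<Sum>j\<in>J. \<alpha> j / sum \<alpha> J * (a j / t j))"
    by (intro mult_left_mono weighted_am_gm_le_one fin \<alpha> prod_nonneg) (auto simp: a t less_imp_le)
  also have "\<dots> = (\<Sum>j\<in>J. (\<Prod>j\<in>J. t j powr \<alpha> j) * (\<alpha> j / sum \<alpha> J) / t j * a j)"
    by (simp add: sum_distrib_left mult_ac)
  finally show ?thesis .
qed

text \<open>The linear bound is attained at \<open>a = t\<close>. Whenever the \<open>t j\<close>
  also bound the sums or norms built from the \<open>a j\<close>, the coefficients therefore
  recombine to the product of powers.\<close>

lemma weighted_am_gm_coeffs:
  fixes t \<alpha> :: "'a \<Rightarrow> real"
  assumes \<alpha>: "(\<Sum>j\<in>J. \<alpha> j) \<ge> 1" and t: "\<And>j. j \<in> J \<Longrightarrow> t j > 0"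
  shows "(\<Sum>j\<in>J. (\<Prod>j\<in>J. t j powr \<alpha> j) * (\<alpha> j / sum \<alpha> J) / t j * t j) = (\<Prod>j\<in>J. t j powr \<alpha> j)"
proof -
  have "(\<Sum>j\<in>J. (\<Prod>j\<in>J. t j powr \<alpha> j) * (\<alpha> j / sum \<alpha> J) / t j * t j)
      = (\<Sum>j\<in>J. (\<Prod>j\<in>J. t j powr \<alpha> j) * (\<alpha> j / sum \<alpha> J))"
    using t by (intro sum.cong) (auto simp: less_imp_neq[symmetric])
  also have "\<dots> = (\<Prod>j\<in>J. t j powr \<alpha> j)"
    using \<alpha> by (simp flip: sum_distrib_left sum_divide_distrib)
  finally show ?thesis .
qed

section \<open>Hoelder's inequality for sums\<close>

lemma has_sum_sum:
  fixes f :: "'a \<Rightarrow> 'b \<Rightarrow> 'c :: topological_comm_monoid_add"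
  assumes "finite J" "\<And>j. j \<in> J \<Longrightarrow> (f j has_sum s j) S"
  shows "((\<lambda>l. \<Sum>j\<in>J. f j l) has_sum (\<Sum>j\<in>J. s j)) S"
  using assms by (induction J rule: finite_induct) (auto intro!: has_sum_add)

text \<open>With \<open>t j\<close> the total sum, every term is at most \<open>t j\<close>, so
  \<open>weighted_am_gm\<close> bounds the summand linearly. Summation replaces \<open>c j l\<close>
  by \<open>t j\<close>, and \<open>weighted_am_gm_coeffs\<close> evaluates the result.\<close>

lemma Holder_infsum:
  fixes c :: "'a \<Rightarrow> 'b \<Rightarrow> real"
  assumes fin: "finite J" "J \<noteq> {}" and \<alpha>: "\<And>j. j \<in> J \<Longrightarrow> \<alpha> j > 0" "(\<Sum>j\<in>J. \<alpha> j) \<ge> 1"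
    and c: "\<And>j l. j \<in> J \<Longrightarrow> l \<in> S \<Longrightarrow> 0 \<le> c j l" and sm: "\<And>j. j \<in> J \<Longrightarrow> c j summable_on S"
  shows "(\<Sum>\<^sub>\<infinity>l\<in>S. \<Prod>j\<in>J. c j l powr \<alpha> j) \<le> (\<Prod>j\<in>J. (\<Sum>\<^sub>\<infinity>l\<in>S. c j l) powr \<alpha> j)"
proof -
  define t where "t j = infsum (c j) S" for j
  have t0: "t j \<ge> 0" if "j \<in> J" for j unfolding t_def by (intro infsum_nonneg c that)
  have le: "c j l \<le> t j" if "j \<in> J" "l \<in> S" for j l
    using finite_sum_le_infsum[OF sm[OF that(1)], of "{l}"] c that by (auto simp: t_def)
  show ?thesis
  proof (cases "\<exists>j\<in>J. t j = 0")
    \<comment> \<open>A vanishing total forces all its terms to be 0, and with them every product;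
      this avoids dividing by \<open>t j\<close>.\<close>
    case True
    then obtain j where j: "j \<in> J" "t j = 0" by auto
    have "(\<Prod>j\<in>J. c j l powr \<alpha> j) = 0" if "l \<in> S" for l
      using le[OF j(1) that] c[OF j(1) that] j fin by (intro prod_zero bexI[of _ j]) auto
    then have "(\<Sum>\<^sub>\<infinity>l\<in>S. \<Prod>j\<in>J. c j l powr \<alpha> j) = 0" by (intro infsum_0) auto
    then show ?thesis by (simp add: prod_nonneg)
  next
    case False
    then have tp: "t j > 0" if "j \<in> J" for j using t0[OF that] that by force
    define P where "P = (\<Prod>j\<in>J. t j powr \<alpha> j)"
    define d where "d j = P * (\<alpha> j / sum \<alpha> J) / t j" for j
    have "((\<lambda>l. \<Sum>j\<in>J. d j * c j l) has_sum (\<Sum>j\<in>J. d j * t j)) S"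
      by (intro has_sum_sum has_sum_cmult_right fin) (use sm in \<open>auto simp: t_def\<close>)
    moreover have "(\<Sum>j\<in>J. d j * t j) = P"
      unfolding d_def P_def by (rule weighted_am_gm_coeffs[OF \<alpha>(2) tp])
    ultimately have hs: "((\<lambda>l. \<Sum>j\<in>J. d j * c j l) has_sum P) S" by simp
    have bd: "(\<Prod>j\<in>J. c j l powr \<alpha> j) \<le> (\<Sum>j\<in>J. d j * c j l)" if "l \<in> S" for l
      unfolding d_def P_def using weighted_am_gm[OF fin \<alpha>, of "\<lambda>j. c j l" t] c le tp that by blast
    have "(\<lambda>l. \<Prod>j\<in>J. c j l powr \<alpha> j) summable_on S"
      by (rule summable_on_comparison_test[OF has_sum_imp_summable[OF hs]]) (auto intro: bd prod_nonneg)
    then have "(\<Sum>\<^sub>\<infinity>l\<in>S. \<Prod>j\<in>J. c j l powr \<alpha> j) \<le> (\<Sum>\<^sub>\<infinity>l\<in>S. \<Sum>j\<in>J. d j * c j l)"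
      by (intro infsum_mono has_sum_imp_summable[OF hs] bd)
    also have "\<dots> = P" using hs by (rule infsumI)
    finally show ?thesis by (simp add: P_def t_def)
  qed
qed

lemma Holder_sum:
  fixes c :: "'a \<Rightarrow> 'b \<Rightarrow> real"
  assumes "finite J" "J \<noteq> {}" "\<And>j. j \<in> J \<Longrightarrow> \<alpha> j > 0" "(\<Sum>j\<in>J. \<alpha> j) \<ge> 1"
    and "\<And>j l. j \<in> J \<Longrightarrow> l \<in> S \<Longrightarrow> 0 \<le> c j l" "finite S"
  shows "(\<Sum>l\<in>S. \<Prod>j\<in>J. c j l powr \<alpha> j) \<le> (\<Prod>j\<in>J. (\<Sum>l\<in>S. c j l) powr \<alpha> j)"
  using Holder_infsum[of J \<alpha> S c] assms by simp

section \<open>Fekete's lemma for submultiplicative sequences\<close>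

text \<open>As an infimum this lies below each root by definition; \<open>root_lim_tendsto\<close>
  shows that it is the limit. Index 0 is left out because \<open>1 / real 0 = 0\<close> makes its
  root uninformative.\<close>

definition root_lim :: "(nat \<Rightarrow> real) \<Rightarrow> real" where
  "root_lim u = Inf {u n powr (1 / real n) | n. n \<ge> 1}"

locale submult_seq =
  fixes u :: "nat \<Rightarrow> real"
  assumes nonneg: "u n \<ge> 0" and submult: "u (p + q) \<le> u p * u q"
begin

text \<open>The factor \<open>u 0\<close> accounts for \<open>q = 0\<close>, as the locale does not
  normalise \<open>u 0\<close> to 1.\<close>

lemma pow_bound: "u (q * p) \<le> u p ^ q * u 0"
proof (induction q)
  case (Suc q)
  have "u (Suc q * p) \<le> u p * u (q * p)" using submult[of p "q * p"] by simp
  also have "\<dots> \<le> u p * (u p ^ q * u 0)" by (intro mult_left_mono Suc nonneg)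
  finally show ?case by simp
qed simp

lemma root_lim_nonneg: "root_lim u \<ge> 0"
  unfolding root_lim_def by (rule cInf_greatest) auto

lemma root_lim_le: "n \<ge> 1 \<Longrightarrow> root_lim u \<le> u n powr (1 / real n)"
  unfolding root_lim_def by (rule cInf_lower) (auto intro!: bdd_belowI[of _ 0])

lemma root_lim_pow_le:
  assumes "n \<ge> 1" shows "root_lim u ^ n \<le> u n"
proof -
  have "root_lim u ^ n \<le> (u n powr (1 / real n)) ^ n"
    by (intro power_mono root_lim_le root_lim_nonneg assms)
  also have "\<dots> = u n" using assms nonneg[of n] by (cases "u n = 0") (simp_all add: powr_power)
  finally show ?thesis .
qed

text \<open>Pick \<open>p\<close> whose root lies below \<open>c\<close> and divide \<open>n\<close>
  by \<open>p\<close>: the full blocks contribute powers of \<open>c\<close>, and the constant has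
  to absorb only the finitely many remainders.\<close>

lemma eventually_le_pow:
  assumes c: "c > root_lim u"
  shows "\<exists>M>0. \<forall>n. u n \<le> M * c ^ n"
proof -
  have c0: "c > 0" using c root_lim_nonneg by linarith
  obtain p where p: "p \<ge> 1" "u p powr (1 / real p) < c"
  proof -
    have "{u n powr (1 / real n) | n. n \<ge> 1} \<noteq> {}" by auto
    from cInf_lessD[OF this] c that show thesis unfolding root_lim_def by auto
  qed
  have "u p = (u p powr (1 / real p)) ^ p"
    using p(1) nonneg[of p] by (cases "u p = 0") (simp_all add: powr_power)
  also have "\<dots> \<le> c ^ p" using p(2) by (intro power_mono) auto
  finally have up: "u p \<le> c ^ p" .
  \<comment> \<open>The sum over all remainders dominates each single one; the 1 keeps
    \<open>M\<close> positive when \<open>u\<close> vanishes.\<close>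
  define M where "M = 1 + (\<Sum>r<p. u 0 * u r / c ^ r)"
  have M: "u 0 * u r / c ^ r \<le> M" if "r < p" for r
  proof -
    have "u 0 * u r / c ^ r \<le> (\<Sum>r<p. u 0 * u r / c ^ r)"
      using that c0 by (intro member_le_sum) (auto simp: nonneg)
    then show ?thesis unfolding M_def by linarith
  qed
  have "u n \<le> M * c ^ n" for n
  proof -
    define q r where "q = n div p" and "r = n mod p"
    have n: "n = q * p + r" and r: "r < p" using p(1) by (auto simp: q_def r_def)
    have "u n \<le> u (q * p) * u r" unfolding n by (rule submult)
    also have "\<dots> \<le> (u p ^ q * u 0) * u r" by (intro mult_right_mono pow_bound nonneg)
    also have "\<dots> \<le> ((c ^ p) ^ q * u 0) * u r"
      by (intro mult_right_mono power_mono up nonneg)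
    also have "\<dots> = (u 0 * u r / c ^ r) * c ^ n"
      using c0 by (simp add: n power_add power_mult [symmetric] mult.commute)
    also have "\<dots> \<le> M * c ^ n" using c0 by (intro mult_right_mono M r) auto
    finally show ?thesis .
  qed
  moreover have "M > 0" unfolding M_def using c0 nonneg
    by (intro add_pos_nonneg sum_nonneg) auto
  ultimately show ?thesis by blast
qed

text \<open>The lower estimate is the infimum itself. The upper one follows from
  \<open>eventually_le_pow\<close>, since \<open>M powr (1 / real n)\<close> tends to 1.\<close>

lemma root_lim_tendsto: "(\<lambda>n. u n powr (1 / real n)) \<longlonglongrightarrow> root_lim u"
proof (rule order_tendstoI)
  fix a assume "a < root_lim u"
  then show "\<forall>\<^sub>F n in sequentially. a < u n powr (1 / real n)"
    using root_lim_le by (intro eventually_sequentiallyI[of 1]) (meson less_le_trans)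
next
  fix a assume a: "root_lim u < a"
  define c where "c = (root_lim u + a) / 2"
  have c: "root_lim u < c" "c < a" using a by (auto simp: c_def)
  have c0: "c > 0" using c root_lim_nonneg by linarith
  obtain M where M: "M > 0" "\<And>n. u n \<le> M * c ^ n" using eventually_le_pow[OF c(1)] by blast
  have "(\<lambda>n. M powr (1 / real n) * c) \<longlonglongrightarrow> M powr 0 * c"
    using M(1) by (intro tendsto_intros lim_1_over_n) auto
  then have "(\<lambda>n. M powr (1 / real n) * c) \<longlonglongrightarrow> c" using M(1) by simp
  then have "\<forall>\<^sub>F n in sequentially. M powr (1 / real n) * c < a" using c(2) by (rule order_tendstoD(2))
  then show "\<forall>\<^sub>F n in sequentially. u n powr (1 / real n) < a"
    using eventually_ge_at_top[of 1]
  proof eventually_elim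
    case (elim n)
    have "u n powr (1 / real n) \<le> (M * c ^ n) powr (1 / real n)"
      by (intro powr_mono2 M nonneg) auto
    also have "\<dots> = M powr (1 / real n) * c"
      using M(1) c0 elim(2) by (simp add: powr_mult powr_powr flip: powr_realpow)
    finally show ?case using elim(1) by linarith
  qed
qed

lemma root_lim_tendsto_mult:
  assumes "q \<ge> 1"
  shows "(\<lambda>n. u (q * n) powr (1 / real (q * n))) \<longlonglongrightarrow> root_lim u"
  using LIMSEQ_subseq_LIMSEQ[OF root_lim_tendsto, of "\<lambda>n. q * n"] assms
  by (simp add: strict_mono_def o_def)

end

section \<open>Order continuous Banach sequence spaces\<close>

definition tail :: "nat \<Rightarrow> seq \<Rightarrow> seq" where
  "tail N x = (\<lambda>i. if i < N then 0 else x i)"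

definition head :: "nat \<Rightarrow> seq \<Rightarrow> seq" where
  "head N x = (\<lambda>i. if i < N then x i else 0)"

text \<open>The modulus stays complex-valued so that moduli and operators share the pointwise order
  of complex sequences. In that order \<open>x \<le> y\<close> compares real parts and demands equal
  imaginary parts, so \<open>0 \<le> x\<close> means that all entries are nonnegative reals.\<close>

definition abs_seq :: "seq \<Rightarrow> seq" where
  "abs_seq x = (\<lambda>i. complex_of_real (cmod (x i)))"

lemma tail_0 [simp]: "tail 0 x = x"
  by (simp add: tail_def)

lemma tail_add: "tail N (x + y) = tail N x + tail N y"
  by (auto simp: tail_def)

lemma tail_diff: "tail N (x - y) = tail N x - tail N y"
  by (auto simp: tail_def)

lemma tail_scale: "tail N (seq_scale c x) = seq_scale c (tail N x)"
  by (auto simp: tail_def seq_scale_def)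

lemma head_plus_tail: "head N x + tail N x = x"
  by (auto simp: head_def tail_def)

lemma seq_scale_apply [simp]: "seq_scale c x i = c * x i"
  by (simp add: seq_scale_def)

lemma seq_scale_one [simp]: "seq_scale 1 x = x"
  by (simp add: seq_scale_def)

lemma seq_scale_zero [simp]: "seq_scale 0 x = 0" "seq_scale c 0 = 0"
  by (auto simp: seq_scale_def)

lemma seq_scale_scale [simp]: "seq_scale c (seq_scale d x) = seq_scale (c * d) x"
  by (auto simp: seq_scale_def)

lemma sum_seq_apply: "(\<Sum>a\<in>S. f a) i = (\<Sum>a\<in>S. f a i)" for f :: "'a \<Rightarrow> seq"
  by (induction S rule: infinite_finite_induct) auto

text \<open>Total boundedness of a closed disc; it supplies the coordinate values of the finite net
  in \<open>hmnc_eq_ess_norm\<close>.\<close>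

lemma finite_net_cball:
  fixes C :: real assumes "e > 0"
  shows "\<exists>K::complex set. finite K \<and> (\<forall>z. cmod z \<le> C \<longrightarrow> (\<exists>k\<in>K. cmod (z - k) < e))"
proof -
  have "cball (0::complex) C \<subseteq> (\<Union>k\<in>cball 0 C. ball k e)" using assms by force
  then obtain K where K: "finite K" "cball 0 C \<subseteq> (\<Union>k\<in>K. ball (k::complex) e)"
    using compactE_image[OF compact_cball, of "cball 0 C" "\<lambda>k. ball k e"] by (metis open_ball)
  have "\<exists>k\<in>K. cmod (z - k) < e" if "cmod z \<le> C" for z
  proof -
    have "z \<in> cball 0 C" using that by simp
    with K obtain k where "k \<in> K" "z \<in> ball k e" by blast
    then show ?thesis by (intro bexI[of _ k]) (auto simp: dist_norm norm_minus_commute)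
  qed
  with K show ?thesis by blast
qed

section \<open>Norm, coordinates and tails in a solid sequence space\<close>

locale oc_seq_space =
  fixes R :: "nat set" and L :: "seq set" and nrm :: "seq \<Rightarrow> real"
  assumes class_L: "class_L R L nrm" and oc_norm: "oc_norm L nrm"
begin

lemma banach: "banach_seq_space R L nrm"
  using class_L by (simp add: class_L_def)

lemma L_outside: "x \<in> L \<Longrightarrow> i \<notin> R \<Longrightarrow> x i = 0"
  and L_zero: "0 \<in> L"
  and L_add: "x \<in> L \<Longrightarrow> y \<in> L \<Longrightarrow> x + y \<in> L"
  and L_scale: "x \<in> L \<Longrightarrow> seq_scale c x \<in> L"
  and nrm_nonneg: "x \<in> L \<Longrightarrow> nrm x \<ge> 0"
  and nrm_eq_0: "x \<in> L \<Longrightarrow> nrm x = 0 \<longleftrightarrow> x = 0"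
  and nrm_scale: "x \<in> L \<Longrightarrow> nrm (seq_scale c x) = cmod c * nrm x"
  and nrm_add: "x \<in> L \<Longrightarrow> y \<in> L \<Longrightarrow> nrm (x + y) \<le> nrm x + nrm y"
  using banach unfolding banach_seq_space_def by simp_all

lemma L_complete:
  "\<forall>n. X n \<in> L \<Longrightarrow> \<forall>e>0. \<exists>M. \<forall>p\<ge>M. \<forall>q\<ge>M. nrm (X p - X q) < e \<Longrightarrow>
    \<exists>x\<in>L. (\<lambda>n. nrm (X n - x)) \<longlonglongrightarrow> 0"
proof -
  have "\<forall>X. (\<forall>n. X n \<in> L) \<and> (\<forall>e>0. \<exists>M. \<forall>p\<ge>M. \<forall>q\<ge>M. nrm (X p - X q) < e)
          \<longrightarrow> (\<exists>x\<in>L. (\<lambda>n. nrm (X n - x)) \<longlonglongrightarrow> 0)"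
    using banach unfolding banach_seq_space_def by (elim conjE) assumption
  then show "\<forall>n. X n \<in> L \<Longrightarrow> \<forall>e>0. \<exists>M. \<forall>p\<ge>M. \<forall>q\<ge>M. nrm (X p - X q) < e \<Longrightarrow>
    \<exists>x\<in>L. (\<lambda>n. nrm (X n - x)) \<longlonglongrightarrow> 0" by (drule_tac spec[of _ X]) simp
qed

lemma L_solid:
  assumes "y \<in> L" "\<And>i. cmod (x i) \<le> cmod (y i)"
  shows "x \<in> L" "nrm x \<le> nrm y"
proof -
  have "\<forall>x y. y \<in> L \<and> (\<forall>i. cmod (x i) \<le> cmod (y i)) \<longrightarrow> x \<in> L \<and> nrm x \<le> nrm y"
    using banach unfolding banach_seq_space_def by simp
  with assms show "x \<in> L" "nrm x \<le> nrm y" by blast+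
qed

lemma unit_vec_L: "i \<in> R \<Longrightarrow> unit_vec i \<in> L" and nrm_unit_vec: "i \<in> R \<Longrightarrow> nrm (unit_vec i) = 1"
  using class_L by (auto simp: class_L_def)

lemma L_diff: "x \<in> L \<Longrightarrow> y \<in> L \<Longrightarrow> x - y \<in> L"
  using L_add[of x "seq_scale (-1) y"] L_scale[of y "-1"]
  by (simp add: seq_scale_def fun_diff_def plus_fun_def)

lemma nrm_zero [simp]: "nrm 0 = 0"
  using nrm_eq_0[OF L_zero] by simp

lemma nrm_minus_commute: "x \<in> L \<Longrightarrow> y \<in> L \<Longrightarrow> nrm (x - y) = nrm (y - x)"
  by (intro antisym; rule L_solid(2)) (auto simp: L_diff norm_minus_commute)

lemma nrm_diff: "x \<in> L \<Longrightarrow> y \<in> L \<Longrightarrow> nrm (x - y) \<le> nrm x + nrm y"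
  using nrm_add[of x "seq_scale (-1) y"] L_scale[of y "-1"] nrm_scale[of y "-1"]
  by (simp add: seq_scale_def fun_diff_def plus_fun_def)

lemma L_sum: "(\<And>a. a \<in> S \<Longrightarrow> f a \<in> L) \<Longrightarrow> (\<Sum>a\<in>S. f a) \<in> L"
  by (induction S rule: infinite_finite_induct) (auto intro: L_zero L_add)

lemma nrm_sum: "(\<And>a. a \<in> S \<Longrightarrow> f a \<in> L) \<Longrightarrow> nrm (\<Sum>a\<in>S. f a) \<le> (\<Sum>a\<in>S. nrm (f a))"
proof (induction S rule: infinite_finite_induct)
  case (insert a S)
  have "nrm (f a + (\<Sum>a\<in>S. f a)) \<le> nrm (f a) + nrm (\<Sum>a\<in>S. f a)"
    using insert by (intro nrm_add L_sum) auto
  moreover have "nrm (\<Sum>a\<in>S. f a) \<le> (\<Sum>a\<in>S. nrm (f a))" using insert by blast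
  ultimately show ?case unfolding sum.insert[OF insert.hyps] by linarith
qed auto

lemma abs_seq_L: "x \<in> L \<Longrightarrow> abs_seq x \<in> L" and nrm_abs_seq: "x \<in> L \<Longrightarrow> nrm (abs_seq x) = nrm x"
proof -
  assume x: "x \<in> L"
  show *: "abs_seq x \<in> L" by (rule L_solid(1)[OF x]) (simp add: abs_seq_def)
  show "nrm (abs_seq x) = nrm x"
    by (intro antisym L_solid(2) x *) (simp_all add: abs_seq_def)
qed

lemma abs_seq_nonneg: "0 \<le> abs_seq x"
  by (simp add: le_fun_def abs_seq_def less_eq_complex_def)

lemma tail_L: "x \<in> L \<Longrightarrow> tail N x \<in> L" and nrm_tail_le: "x \<in> L \<Longrightarrow> nrm (tail N x) \<le> nrm x"
  using L_solid[of x "tail N x"] by (auto simp: tail_def)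

lemma nrm_tail_mono: "x \<in> L \<Longrightarrow> M \<le> N \<Longrightarrow> nrm (tail N x) \<le> nrm (tail M x)"
  by (rule L_solid(2)[OF tail_L]) (auto simp: tail_def)

lemma head_L: "x \<in> L \<Longrightarrow> head N x \<in> L"
  using L_solid[of x "head N x"] by (auto simp: head_def)

text \<open>Solidity compares \<open>x\<close> with its single coordinate \<open>x i\<close> times a
  unit vector of norm 1. Consequently norm convergence implies coordinatewise convergence.\<close>

lemma coord_le_nrm: assumes "x \<in> L" shows "cmod (x i) \<le> nrm x"
proof (cases "i \<in> R")
  case True
  have "nrm (seq_scale (x i) (unit_vec i)) \<le> nrm x"
    by (rule L_solid(2)[OF assms]) (simp add: unit_vec_def)
  then show ?thesis using True by (simp add: nrm_scale unit_vec_L nrm_unit_vec)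
qed (use L_outside[OF assms] nrm_nonneg[OF assms] in auto)

text \<open>Triangle inequality for the finite expansion in unit vectors; an index outside
  \<open>R\<close> adds nothing to the head. It makes control of finitely many coordinates a control
  in norm.\<close>

lemma nrm_head_le_sum: assumes "x \<in> L" shows "nrm (head N x) \<le> (\<Sum>i<N. cmod (x i))"
proof (induction N)
  case 0
  have "head 0 x = 0" by (auto simp: head_def)
  show ?case by (simp only: \<open>head 0 x = 0\<close> nrm_zero lessThan_0 sum.empty)
next
  case (Suc N)
  show ?case
  proof (cases "N \<in> R")
    case True
    have "head (Suc N) x i = (head N x + seq_scale (x N) (unit_vec N)) i" for i
      by (cases "i = N") (auto simp: head_def unit_vec_def)
    then have eq: "head (Suc N) x = head N x + seq_scale (x N) (unit_vec N)" by blast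
    have "nrm (head (Suc N) x) \<le> nrm (head N x) + nrm (seq_scale (x N) (unit_vec N))"
      unfolding eq by (intro nrm_add head_L assms L_scale unit_vec_L True)
    then show ?thesis using Suc by (simp add: nrm_scale unit_vec_L nrm_unit_vec True)
  next
    case False
    have "head (Suc N) x i = head N x i" for i
      using L_outside[OF assms False] by (cases "i = N") (auto simp: head_def)
    then have "head (Suc N) x = head N x" by blast
    then show ?thesis using Suc by (simp add: add_increasing2)
  qed
qed

lemma nrm_limit_coord:
  assumes "\<And>n. X n \<in> L" "x \<in> L" "(\<lambda>n. nrm (X n - x)) \<longlonglongrightarrow> 0"
  shows "(\<lambda>n. X n i) \<longlonglongrightarrow> x i"
proof -
  have "(\<lambda>n. cmod (X n i - x i)) \<longlonglongrightarrow> 0"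
    by (rule tendsto_sandwich[OF _ _ tendsto_const assms(3)])
      (use coord_le_nrm[OF L_diff[OF assms(1,2)]] in \<open>auto intro!: always_eventually\<close>)
  then show ?thesis by (simp add: LIM_zero_cancel tendsto_norm_zero_iff)
qed

text \<open>The moduli of the tails form a downward directed set with infimum 0. Order continuity
  yields one tail of norm below \<open>e\<close>, and all later tails lie below it in the
  order.\<close>

lemma tail_tendsto:
  assumes x: "x \<in> L" and e: "e > 0"
  shows "\<exists>N. \<forall>n\<ge>N. nrm (tail n x) < e"
proof -
  let ?D = "range (\<lambda>n. abs_seq (tail n x))"
  let ?V = "{x \<in> L. real_seq x}"
  have 1: "?D \<subseteq> ?V" by (auto simp: abs_seq_L tail_L x real_seq_def) (simp add: abs_seq_def)
  have 2: "\<forall>f\<in>?D. seq_le 0 f" by (auto simp: seq_le_def abs_seq_def)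
  have 3: "\<forall>a\<in>?D. \<forall>b\<in>?D. \<exists>c\<in>?D. seq_le c a \<and> seq_le c b"
  proof (clarify)
    fix p q
    show "\<exists>c\<in>?D. seq_le c (abs_seq (tail p x)) \<and> seq_le c (abs_seq (tail q x))"
      by (rule bexI[of _ "abs_seq (tail (max p q) x)"]) (auto simp: seq_le_def abs_seq_def tail_def)
  qed
  have 4: "\<forall>g\<in>?V. (\<forall>f\<in>?D. seq_le g f) \<longrightarrow> seq_le g 0"
  proof (clarify)
    fix g assume "\<forall>f\<in>?D. seq_le g f"
    \<comment> \<open>The tail starting at \<open>Suc i\<close> vanishes at coordinate
      \<open>i\<close>, so a lower bound of all tails is nonpositive there.\<close>
    then have "Re (g i) \<le> Re (abs_seq (tail (Suc i) x) i)" for i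
      unfolding seq_le_def by blast
    then show "seq_le g 0" by (simp add: seq_le_def abs_seq_def tail_def)
  qed
  have "\<forall>e>0. \<exists>f0\<in>?D. \<forall>f\<in>?D. seq_le f f0 \<longrightarrow> nrm f < e"
    by (rule mp[OF spec[OF oc_norm[unfolded oc_norm_def order_cont_def], of ?D]])
      (intro conjI 1 2 3 4; simp)
  with e obtain f0 where f0: "f0 \<in> ?D" "\<forall>f\<in>?D. seq_le f f0 \<longrightarrow> nrm f < e" by blast
  from f0(1) obtain N where N: "f0 = abs_seq (tail N x)" by auto
  have "nrm (tail n x) < e" if "n \<ge> N" for n
  proof -
    have "seq_le (abs_seq (tail n x)) f0" using that by (auto simp: N seq_le_def abs_seq_def tail_def)
    then have "nrm (abs_seq (tail n x)) < e" using f0(2) by blast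
    then show ?thesis by (simp add: nrm_abs_seq tail_L x)
  qed
  then show ?thesis by blast
qed

section \<open>Bounded linear operators on \<open>L\<close>\<close>

abbreviation blo :: "seqop \<Rightarrow> bool" where "blo \<equiv> bounded_linear_op L nrm"

lemma blo_L: "blo T \<Longrightarrow> x \<in> L \<Longrightarrow> T x \<in> L"
  and blo_add: "blo T \<Longrightarrow> x \<in> L \<Longrightarrow> y \<in> L \<Longrightarrow> T (x + y) = T x + T y"
  and blo_scale: "blo T \<Longrightarrow> x \<in> L \<Longrightarrow> T (seq_scale c x) = seq_scale c (T x)"
  by (auto simp: bounded_linear_op_def)

lemma blo_zero: "blo T \<Longrightarrow> T 0 = 0"
  using blo_scale[of T 0 0] L_zero by simp

lemma blo_diff: "blo T \<Longrightarrow> x \<in> L \<Longrightarrow> y \<in> L \<Longrightarrow> T (x - y) = T x - T y"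
  using blo_add[of T "x - y" y] by (simp add: L_diff)

lemma blo_sum:
  assumes "blo T" "\<And>a. a \<in> S \<Longrightarrow> f a \<in> L"
  shows "T (\<Sum>a\<in>S. f a) = (\<Sum>a\<in>S. T (f a))"
  using assms(2)
proof (induction S rule: infinite_finite_induct)
  case (insert a S)
  have "T (f a + (\<Sum>a\<in>S. f a)) = T (f a) + T (\<Sum>a\<in>S. f a)"
    using insert.prems by (intro blo_add L_sum assms(1)) auto
  with insert show ?case by (simp only: sum.insert insert_iff simp_thms)
qed (simp_all only: sum.infinite sum.empty blo_zero[OF assms(1)] simp_thms)

lemma blo_bound: assumes "blo T" obtains C where "C > 0" "\<And>x. x \<in> L \<Longrightarrow> nrm (T x) \<le> C * nrm x"
proof -
  obtain C where C: "\<forall>x\<in>L. nrm (T x) \<le> C * nrm x" using assms by (auto simp: bounded_linear_op_def)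
  have "nrm (T x) \<le> (\<bar>C\<bar> + 1) * nrm x" if "x \<in> L" for x
  proof -
    have "C * nrm x \<le> (\<bar>C\<bar> + 1) * nrm x" using that by (intro mult_right_mono nrm_nonneg) auto
    then show ?thesis using C that by fastforce
  qed
  then show thesis by (intro that[of "\<bar>C\<bar> + 1"]) auto
qed

lemma bloI:
  assumes "\<And>x. x \<in> L \<Longrightarrow> T x \<in> L" "\<And>x y. x \<in> L \<Longrightarrow> y \<in> L \<Longrightarrow> T (x + y) = T x + T y"
    "\<And>c x. x \<in> L \<Longrightarrow> T (seq_scale c x) = seq_scale c (T x)" "\<And>x. x \<in> L \<Longrightarrow> nrm (T x) \<le> C * nrm x"
  shows "blo T"
  using assms unfolding bounded_linear_op_def by blast

text \<open>Operators are functions on all sequences, but being bounded and linear constrains only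
  their values on \<open>L\<close>.\<close>

lemma blo_cong: "blo T \<Longrightarrow> (\<And>x. x \<in> L \<Longrightarrow> T' x = T x) \<Longrightarrow> blo T'"
  unfolding bounded_linear_op_def by (simp add: L_add L_scale)

lemma blo_id: "blo (\<lambda>x. x)"
  by (rule bloI[of _ 1]) auto

lemma blo_comp: assumes "blo T" "blo U" shows "blo (\<lambda>x. T (U x))"
proof -
  obtain C where C: "C > 0" "\<And>x. x \<in> L \<Longrightarrow> nrm (T x) \<le> C * nrm x" using blo_bound[OF assms(1)] by blast
  obtain D where D: "D > 0" "\<And>x. x \<in> L \<Longrightarrow> nrm (U x) \<le> D * nrm x" using blo_bound[OF assms(2)] by blast
  show ?thesis
  proof (rule bloI[of _ "C * D"])
    fix x assume x: "x \<in> L"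
    have "nrm (T (U x)) \<le> C * nrm (U x)" using x assms C by (simp add: blo_L)
    also have "\<dots> \<le> C * (D * nrm x)" using x C D by (intro mult_left_mono) auto
    finally show "nrm (T (U x)) \<le> C * D * nrm x" by (simp add: mult.assoc)
    show "T (U (x + y)) = T (U x) + T (U y)" if "y \<in> L" for y
      unfolding blo_add[OF assms(2) x that]
      by (rule blo_add[OF assms(1) blo_L[OF assms(2) x] blo_L[OF assms(2) that]])
    show "T (U (seq_scale c x)) = seq_scale c (T (U x))" for c
      unfolding blo_scale[OF assms(2) x] by (rule blo_scale[OF assms(1) blo_L[OF assms(2) x]])
    show "T (U x) \<in> L" by (rule blo_L[OF assms(1) blo_L[OF assms(2) x]])
  qed
qed

lemma blo_funpow: "blo T \<Longrightarrow> blo (T ^^ n)"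
proof (induction n)
  case 0
  show ?case using blo_id by (rule blo_cong) simp
next
  case (Suc n)
  show ?case by (rule blo_cong[OF blo_comp[OF Suc.prems Suc.IH[OF Suc.prems]]]) simp
qed

lemma blo_scale_op: assumes "blo T" shows "blo (\<lambda>x. seq_scale c (T x))"
proof -
  obtain C where C: "C > 0" "\<And>x. x \<in> L \<Longrightarrow> nrm (T x) \<le> C * nrm x" using blo_bound[OF assms(1)] by blast
  show ?thesis
  proof (rule bloI[of _ "cmod c * C"])
    fix x assume x: "x \<in> L"
    show "nrm (seq_scale c (T x)) \<le> cmod c * C * nrm x"
      using x C(2)[OF x] by (simp add: nrm_scale blo_L assms mult.assoc mult_left_mono)
    show "seq_scale c (T (seq_scale d x)) = seq_scale d (seq_scale c (T x))" for d
      unfolding blo_scale[OF assms x] by (rule ext) simp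
    show "seq_scale c (T (x + y)) = seq_scale c (T x) + seq_scale c (T y)" if "y \<in> L" for y
      unfolding blo_add[OF assms x that] by (rule ext) (simp add: algebra_simps)
    show "seq_scale c (T x) \<in> L" by (rule L_scale[OF blo_L[OF assms x]])
  qed
qed

lemma blo_add_op: assumes "blo T" "blo U" shows "blo (\<lambda>x. T x + U x)"
proof -
  obtain C where C: "C > 0" "\<And>x. x \<in> L \<Longrightarrow> nrm (T x) \<le> C * nrm x" using blo_bound[OF assms(1)] by blast
  obtain D where D: "D > 0" "\<And>x. x \<in> L \<Longrightarrow> nrm (U x) \<le> D * nrm x" using blo_bound[OF assms(2)] by blast
  show ?thesis
  proof (rule bloI[of _ "C + D"])
    fix x assume x: "x \<in> L"
    show "nrm (T x + U x) \<le> (C + D) * nrm x"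
      using nrm_add[of "T x" "U x"] x assms C(2)[OF x] D(2)[OF x] by (simp add: blo_L algebra_simps)
    show "T (seq_scale c x) + U (seq_scale c x) = seq_scale c (T x + U x)" for c
      unfolding blo_scale[OF assms(1) x] blo_scale[OF assms(2) x] by (rule ext) (simp add: algebra_simps)
    show "T (x + y) + U (x + y) = (T x + U x) + (T y + U y)" if "y \<in> L" for y
      unfolding blo_add[OF assms(1) x that] blo_add[OF assms(2) x that] by (simp only: add_ac)
    show "T x + U x \<in> L" by (rule L_add[OF blo_L[OF assms(1) x] blo_L[OF assms(2) x]])
  qed
qed

lemma blo_diff_op: assumes "blo T" "blo U" shows "blo (\<lambda>x. T x - U x)"
  by (rule blo_cong[OF blo_add_op[OF assms(1) blo_scale_op[OF assms(2), of "-1"]]]) (rule ext, simp)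

lemma blo_zero_op: "blo (\<lambda>x. 0)"
proof (rule bloI[of _ 0])
  show "0 = seq_scale c 0" for c by (rule seq_scale_zero(2)[symmetric])
qed (simp_all only: L_zero nrm_zero add_0 mult_zero_left order_refl)

lemma blo_sum_op: "(\<And>a. a \<in> S \<Longrightarrow> blo (f a)) \<Longrightarrow> blo (\<lambda>x. \<Sum>a\<in>S. f a x)"
proof (induction S rule: infinite_finite_induct)
  case (insert a S)
  show ?case by (rule blo_cong[OF blo_add_op[of "f a" "\<lambda>x. \<Sum>a\<in>S. f a x"]])
      (simp_all only: sum.insert[OF insert.hyps] insert.IH insert.prems insertI1 insertI2)
qed (simp_all only: sum.infinite sum.empty blo_zero_op simp_thms)

lemma blo_tail: "blo (tail N)"
  by (rule bloI[of _ 1]) (auto simp: tail_L tail_add tail_scale nrm_tail_le)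

lemma tail_bound_from_ball:
  assumes T: "blo T" and c: "\<And>x. x \<in> L \<Longrightarrow> nrm x \<le> 1 \<Longrightarrow> nrm (tail N (T x)) \<le> c" and x: "x \<in> L"
  shows "nrm (tail N (T x)) \<le> c * nrm x"
proof (cases "nrm x = 0")
  case True
  then have "x = 0" using x nrm_eq_0 by blast
  then show ?thesis using blo_zero[OF blo_comp[OF blo_tail T]] by simp
next
  case False
  then have p: "nrm x > 0" using nrm_nonneg[OF x] by simp
  define y where "y = seq_scale (complex_of_real (1 / nrm x)) x"
  have y: "y \<in> L" "nrm y = 1" using x p by (simp_all add: y_def L_scale nrm_scale del: of_real_divide)
  have "x = seq_scale (complex_of_real (nrm x)) y" using p by (simp add: y_def)
  then have "tail N (T x) = seq_scale (complex_of_real (nrm x)) (tail N (T y))"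
    using blo_scale[OF blo_comp[OF blo_tail T] y(1)] by metis
  then have "nrm (tail N (T x)) = nrm x * nrm (tail N (T y))"
    using p y T by (simp add: nrm_scale tail_L blo_L)
  also have "\<dots> \<le> nrm x * c" using c[OF y(1)] y p by (intro mult_left_mono) auto
  finally show ?thesis by (simp add: mult.commute)
qed

end

section \<open>The essential norm\<close>

context oc_seq_space
begin

text \<open>Because tails shrink as the cutoff grows, this infimum is the limit of the operator
  norms of the tails of \<open>T\<close>. Quantifying over admissible constants spares a separate
  operator norm.\<close>

definition ess_norm :: "seqop \<Rightarrow> real" where
  "ess_norm T = Inf {c. c \<ge> 0 \<and> (\<exists>N. \<forall>x\<in>L. nrm (tail N (T x)) \<le> c * nrm x)}"

lemma ess_norm_le:
  assumes "c \<ge> 0" "\<And>x. x \<in> L \<Longrightarrow> nrm (tail N (T x)) \<le> c * nrm x"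
  shows "ess_norm T \<le> c"
  unfolding ess_norm_def using assms by (intro cInf_lower) (auto intro!: bdd_belowI[of _ 0])

lemma ess_norm_le_bound:
  assumes "c \<ge> 0" "\<And>x. x \<in> L \<Longrightarrow> nrm (T x) \<le> c * nrm x"
  shows "ess_norm T \<le> c"
  by (rule ess_norm_le[of c 0]) (simp_all add: assms)

lemma ess_norm_set_nonempty:
  assumes "blo T" shows "{c. c \<ge> 0 \<and> (\<exists>N. \<forall>x\<in>L. nrm (tail N (T x)) \<le> c * nrm x)} \<noteq> {}"
proof -
  obtain C where C: "C > 0" "\<And>x. x \<in> L \<Longrightarrow> nrm (T x) \<le> C * nrm x" using blo_bound[OF assms] by blast
  then have "nrm (tail 0 (T x)) \<le> C * nrm x" if "x \<in> L" for x using that by simp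
  then show ?thesis using C(1) less_imp_le[OF C(1)] by blast
qed

lemma ess_norm_nonneg: "blo T \<Longrightarrow> ess_norm T \<ge> 0"
  unfolding ess_norm_def by (rule cInf_greatest[OF ess_norm_set_nonempty]) auto

text \<open>A bound at one cutoff persists at all later ones, so finitely many operators can share a
  cutoff.\<close>

lemma ess_norm_lessD:
  assumes T: "blo T" and c: "ess_norm T < c"
  shows "\<exists>N. \<forall>n\<ge>N. \<forall>x\<in>L. nrm (tail n (T x)) \<le> c * nrm x"
proof -
  obtain d N where d: "d < c" "\<forall>x\<in>L. nrm (tail N (T x)) \<le> d * nrm x"
    using cInf_lessD[OF ess_norm_set_nonempty[OF T]] c unfolding ess_norm_def by blast
  have "nrm (tail n (T x)) \<le> c * nrm x" if "n \<ge> N" "x \<in> L" for n x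
  proof -
    have "nrm (tail n (T x)) \<le> nrm (tail N (T x))" by (rule nrm_tail_mono[OF blo_L[OF T that(2)] that(1)])
    also have "\<dots> \<le> d * nrm x" using d that by blast
    also have "\<dots> \<le> c * nrm x" using d that by (intro mult_right_mono nrm_nonneg) auto
    finally show ?thesis .
  qed
  then show ?thesis by blast
qed

lemma ess_norm_cong: "(\<And>x. x \<in> L \<Longrightarrow> T x = U x) \<Longrightarrow> ess_norm T = ess_norm U"
  unfolding ess_norm_def by simp

lemma ess_norm_add:
  assumes T: "blo T" and U: "blo U"
  shows "ess_norm (\<lambda>x. T x + U x) \<le> ess_norm T + ess_norm U"
proof (rule field_le_epsilon)
  fix e :: real assume e: "e > 0"
  define c d where "c = ess_norm T + e / 2" and "d = ess_norm U + e / 2"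
  have cd: "ess_norm T < c" "ess_norm U < d" using e by (auto simp: c_def d_def)
  obtain N where N: "\<forall>n\<ge>N. \<forall>x\<in>L. nrm (tail n (T x)) \<le> c * nrm x"
    using ess_norm_lessD[OF T cd(1)] by blast
  obtain M where M: "\<forall>n\<ge>M. \<forall>x\<in>L. nrm (tail n (U x)) \<le> d * nrm x"
    using ess_norm_lessD[OF U cd(2)] by blast
  have "ess_norm (\<lambda>x. T x + U x) \<le> c + d"
  proof (rule ess_norm_le[of _ "max N M"])
    show "0 \<le> c + d" using cd ess_norm_nonneg[OF T] ess_norm_nonneg[OF U] by linarith
    fix x assume x: "x \<in> L"
    have "nrm (tail (max N M) (T x + U x)) \<le> nrm (tail (max N M) (T x)) + nrm (tail (max N M) (U x))"
      unfolding tail_add by (rule nrm_add[OF tail_L[OF blo_L[OF T x]] tail_L[OF blo_L[OF U x]]])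
    moreover have "nrm (tail (max N M) (T x)) \<le> c * nrm x" using N x by simp
    moreover have "nrm (tail (max N M) (U x)) \<le> d * nrm x" using M x by simp
    ultimately show "nrm (tail (max N M) (T x + U x)) \<le> (c + d) * nrm x" by (simp only: distrib_right)
  qed
  then show "ess_norm (\<lambda>x. T x + U x) \<le> ess_norm T + ess_norm U + e" by (simp add: c_def d_def)
qed

lemma ess_norm_scale_le:
  assumes T: "blo T" shows "ess_norm (\<lambda>x. seq_scale c (T x)) \<le> cmod c * ess_norm T"
proof (rule field_le_epsilon)
  fix e :: real assume e: "e > 0"
  \<comment> \<open>The \<open>+ 1\<close> keeps the denominator positive for
    \<open>c = 0\<close>.\<close>
  define d where "d = ess_norm T + e / (cmod c + 1)"
  have "cmod c + 1 > 0" by (simp add: add_nonneg_pos)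
  then have "ess_norm T < d" using divide_pos_pos[OF e] by (simp only: d_def less_add_same_cancel1)
  then obtain N where N: "\<forall>n\<ge>N. \<forall>x\<in>L. nrm (tail n (T x)) \<le> d * nrm x"
    using ess_norm_lessD[OF T] by blast
  have "ess_norm (\<lambda>x. seq_scale c (T x)) \<le> cmod c * d"
  proof (rule ess_norm_le[of _ N])
    show "0 \<le> cmod c * d" using ess_norm_nonneg[OF T] \<open>ess_norm T < d\<close> by simp
    fix x assume x: "x \<in> L"
    have "nrm (tail N (seq_scale c (T x))) = cmod c * nrm (tail N (T x))"
      unfolding tail_scale by (rule nrm_scale[OF tail_L[OF blo_L[OF T x]]])
    then show "nrm (tail N (seq_scale c (T x))) \<le> cmod c * d * nrm x"
      using N x by (simp add: mult.assoc mult_left_mono)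
  qed
  also have "\<dots> \<le> cmod c * ess_norm T + e"
  proof -
    have "cmod c * (e / (cmod c + 1)) \<le> e"
      using e \<open>cmod c + 1 > 0\<close> by (simp only: divide_le_eq times_divide_eq_right if_True) (simp add: algebra_simps)
    then show ?thesis by (simp add: d_def distrib_left)
  qed
  finally show "ess_norm (\<lambda>x. seq_scale c (T x)) \<le> cmod c * ess_norm T + e" .
qed

lemma ess_norm_diff:
  assumes T: "blo T" and U: "blo U"
  shows "ess_norm (\<lambda>x. T x - U x) \<le> ess_norm T + ess_norm U"
proof -
  have "ess_norm (\<lambda>x. T x - U x) = ess_norm (\<lambda>x. T x + seq_scale (-1) (U x))"
    by (rule ess_norm_cong) (rule ext, simp)
  also have "\<dots> \<le> ess_norm T + ess_norm (\<lambda>x. seq_scale (-1) (U x))"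
    by (rule ess_norm_add[OF T blo_scale_op[OF U]])
  also have "\<dots> \<le> ess_norm T + ess_norm U" using ess_norm_scale_le[OF U, of "-1"] by simp
  finally show ?thesis .
qed

text \<open>\<open>T\<close> after \<open>head M\<close> has finite rank: its range is spanned by
  the images of the unit vectors below \<open>M\<close>, and each of these finitely many vectors has
  small tails.\<close>

lemma tail_comp_head_tendsto:
  assumes T: "blo T" and e: "e > 0"
  shows "\<exists>N. \<forall>y\<in>L. nrm (tail N (T (head M y))) \<le> e * nrm y"
proof -
  \<comment> \<open>At most \<open>M\<close> coordinates contribute, each with factor at most
    \<open>nrm y\<close>, so \<open>e / (M + 1)\<close> per unit vector is small enough.\<close>
  have "\<exists>N. \<forall>i\<in>{..<M} \<inter> R. nrm (tail N (T (unit_vec i))) < e / (real M + 1)"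
  proof -
    have "\<exists>N. \<forall>n\<ge>N. nrm (tail n (T (unit_vec i))) < e / (real M + 1)" if "i \<in> R" for i
      using tail_tendsto[OF blo_L[OF T unit_vec_L[OF that]], of "e / (real M + 1)"] e by simp
    then obtain N where N: "\<And>i n. i \<in> R \<Longrightarrow> n \<ge> N i \<Longrightarrow> nrm (tail n (T (unit_vec i))) < e / (real M + 1)"
      by metis
    \<comment> \<open>The sum of finitely many cutoffs is a common cutoff.\<close>
    have "nrm (tail (\<Sum>i<M. N i) (T (unit_vec i))) < e / (real M + 1)" if "i \<in> {..<M} \<inter> R" for i
      using that by (intro N member_le_sum) auto
    then show ?thesis by blast
  qed
  then obtain N where N: "\<And>i. i < M \<Longrightarrow> i \<in> R \<Longrightarrow> nrm (tail N (T (unit_vec i))) < e / (real M + 1)" by blast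
  have "nrm (tail N (T (head M y))) \<le> e * nrm y" if y: "y \<in> L" for y
  proof -
    let ?S = "{..<M} \<inter> R"
    have h: "head M y = (\<Sum>i\<in>?S. seq_scale (y i) (unit_vec i))"
    proof
      fix j
      have "(\<Sum>i\<in>?S. seq_scale (y i) (unit_vec i)) j = (\<Sum>i\<in>?S. if i = j then y i else 0)"
        unfolding sum_seq_apply by (intro sum.cong) (auto simp: unit_vec_def)
      also have "\<dots> = (if j \<in> ?S then y j else 0)" by (subst sum.delta) auto
      also have "\<dots> = head M y j" using L_outside[OF y, of j] by (auto simp: head_def)
      finally show "head M y j = (\<Sum>i\<in>?S. seq_scale (y i) (unit_vec i)) j" by simp
    qed
    have V: "blo (\<lambda>x. tail N (T x))" by (rule blo_comp[OF blo_tail T])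
    have m: "seq_scale (y i) (unit_vec i) \<in> L" if "i \<in> ?S" for i
      using that by (intro L_scale unit_vec_L) auto
    have "tail N (T (head M y)) = (\<Sum>i\<in>?S. tail N (T (seq_scale (y i) (unit_vec i))))"
      unfolding h by (rule blo_sum[OF V m])
    also have "\<dots> = (\<Sum>i\<in>?S. seq_scale (y i) (tail N (T (unit_vec i))))"
      by (intro sum.cong refl blo_scale[OF V] unit_vec_L) auto
    finally have eq: "tail N (T (head M y)) = (\<Sum>i\<in>?S. seq_scale (y i) (tail N (T (unit_vec i))))" .
    have tL: "tail N (T (unit_vec i)) \<in> L" if "i \<in> ?S" for i
      using that by (intro tail_L blo_L[OF T] unit_vec_L) auto
    have "nrm (tail N (T (head M y))) \<le> (\<Sum>i\<in>?S. nrm (seq_scale (y i) (tail N (T (unit_vec i)))))"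
      unfolding eq by (rule nrm_sum) (rule L_scale[OF tL])
    also have "\<dots> \<le> (\<Sum>i\<in>?S. nrm y * (e / (real M + 1)))"
    proof (rule sum_mono)
      fix i assume i: "i \<in> ?S"
      have "nrm (seq_scale (y i) (tail N (T (unit_vec i)))) = cmod (y i) * nrm (tail N (T (unit_vec i)))"
        by (rule nrm_scale[OF tL[OF i]])
      also have "\<dots> \<le> nrm y * (e / (real M + 1))"
        using N[of i] i by (intro mult_mono coord_le_nrm y nrm_nonneg tL) auto
      finally show "nrm (seq_scale (y i) (tail N (T (unit_vec i)))) \<le> nrm y * (e / (real M + 1))" .
    qed
    also have "\<dots> = real (card ?S) * (nrm y * (e / (real M + 1)))" by simp
    also have "\<dots> \<le> (real M + 1) * (nrm y * (e / (real M + 1)))"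
    proof (rule mult_right_mono)
      have "card ?S \<le> card {..<M}" by (intro card_mono) auto
      then show "real (card ?S) \<le> real M + 1" by simp
    qed (use e nrm_nonneg[OF y] in simp)
    also have "\<dots> = e * nrm y" by (simp add: add_nonneg_eq_0_iff)
    finally show ?thesis .
  qed
  then show ?thesis by blast
qed

text \<open>Split \<open>U x\<close> into head and tail. The tail is at most
  \<open>d * nrm x\<close>, and a late tail of \<open>T\<close> multiplies it by at most
  \<open>c\<close>; the head passes through a finite rank operator, whose late tails are
  negligible.\<close>

lemma ess_norm_comp:
  assumes T: "blo T" and U: "blo U"
  shows "ess_norm (\<lambda>x. T (U x)) \<le> ess_norm T * ess_norm U"
proof -
  have *: "ess_norm (\<lambda>x. T (U x)) \<le> c * d" if cd: "ess_norm T < c" "ess_norm U < d" for c d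
  proof (rule field_le_epsilon)
    fix e :: real assume e: "e > 0"
    have c0: "c \<ge> 0" "d \<ge> 0" using cd ess_norm_nonneg[OF T] ess_norm_nonneg[OF U] by linarith+
    obtain N where N: "\<forall>n\<ge>N. \<forall>x\<in>L. nrm (tail n (T x)) \<le> c * nrm x"
      using ess_norm_lessD[OF T cd(1)] by blast
    obtain M where M: "\<forall>n\<ge>M. \<forall>x\<in>L. nrm (tail n (U x)) \<le> d * nrm x"
      using ess_norm_lessD[OF U cd(2)] by blast
    obtain C where C: "C > 0" "\<And>x. x \<in> L \<Longrightarrow> nrm (U x) \<le> C * nrm x" using blo_bound[OF U] by blast
    \<comment> \<open>Dividing by the norm bound \<open>C\<close> of \<open>U\<close> leaves an
      error of \<open>e * nrm x\<close> after \<open>U\<close> is applied.\<close>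
    obtain K where K: "\<forall>y\<in>L. nrm (tail K (T (head M y))) \<le> e / C * nrm y"
      using tail_comp_head_tendsto[OF T, of "e / C" M] e C(1) by auto
    let ?k = "max N K"
    show "ess_norm (\<lambda>x. T (U x)) \<le> c * d + e"
    proof (rule ess_norm_le[of _ ?k])
      show "0 \<le> c * d + e" using c0 e by simp
      fix x assume x: "x \<in> L"
      have u: "U x \<in> L" "head M (U x) \<in> L" "tail M (U x) \<in> L"
        using blo_L[OF U x] by (simp_all add: head_L tail_L)
      have "T (U x) = T (head M (U x)) + T (tail M (U x))"
        using blo_add[OF T u(2,3)] by (simp add: head_plus_tail)
      then have "tail ?k (T (U x)) = tail ?k (T (head M (U x))) + tail ?k (T (tail M (U x)))"
        by (simp add: tail_add)
      then have "nrm (tail ?k (T (U x))) \<le> nrm (tail ?k (T (head M (U x)))) + nrm (tail ?k (T (tail M (U x))))"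
        using nrm_add[OF tail_L[OF blo_L[OF T u(2)]] tail_L[OF blo_L[OF T u(3)]]] by metis
      moreover have "nrm (tail ?k (T (head M (U x)))) \<le> e * nrm x"
      proof -
        have "nrm (tail ?k (T (head M (U x)))) \<le> nrm (tail K (T (head M (U x))))"
          by (rule nrm_tail_mono[OF blo_L[OF T u(2)]]) simp
        also have "\<dots> \<le> e / C * nrm (U x)" using K u by blast
        also have "\<dots> \<le> e / C * (C * nrm x)" using C e x by (intro mult_left_mono) auto
        finally show ?thesis using C by simp
      qed
      moreover have "nrm (tail ?k (T (tail M (U x)))) \<le> c * d * nrm x"
      proof -
        have "nrm (tail ?k (T (tail M (U x)))) \<le> c * nrm (tail M (U x))" using N u by simp
        also have "\<dots> \<le> c * (d * nrm x)" using M x c0 by (intro mult_left_mono) auto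
        finally show ?thesis by simp
      qed
      ultimately show "nrm (tail ?k (T (U x))) \<le> (c * d + e) * nrm x"
        by (simp only: distrib_right)
    qed
  qed
  show ?thesis
  proof (rule tendsto_lowerbound)
    show "((\<lambda>e. (ess_norm T + e) * (ess_norm U + e)) \<longlongrightarrow> ess_norm T * ess_norm U) (at_right 0)"
      by (auto intro!: tendsto_eq_intros)
    show "\<forall>\<^sub>F e in at_right 0. ess_norm (\<lambda>x. T (U x)) \<le> (ess_norm T + e) * (ess_norm U + e)"
      unfolding eventually_at_right_field by (intro exI[of _ 1]) (auto intro!: *)
  qed simp
qed

text \<open>A tail bound yields a finite net, because the remaining coordinates are finitely many
  and range in a disc. Conversely a finite net yields a tail bound, because its centres have small
  tails.\<close>

lemma hmnc_eq_ess_norm: assumes T: "blo T" shows "hmnc L nrm T = ess_norm T"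
proof -
  let ?B = "unit_ball L nrm"
  let ?E = "{e. e > 0 \<and> (\<exists>F. finite F \<and> F \<subseteq> L \<and> T ` ?B \<subseteq> (\<Union>c\<in>F. {x\<in>L. nrm (x - c) \<le> e}))}"
  obtain C where C: "C > 0" "\<And>x. x \<in> L \<Longrightarrow> nrm (T x) \<le> C * nrm x" using blo_bound[OF T] by blast
  have TB: "y \<in> L" "nrm y \<le> C" if yB: "y \<in> T ` ?B" for y
  proof -
    obtain x where x: "x \<in> L" "nrm x \<le> 1" "y = T x" using yB unfolding unit_ball_def by blast
    then show "y \<in> L" using blo_L[OF T] by blast
    have "C * nrm x \<le> C * 1" using x C by (intro mult_left_mono) auto
    then show "nrm y \<le> C" using C(2)[OF x(1)] x(3) by simp
  qed
  have up: "c + e \<in> ?E" if c: "ess_norm T < c" and e: "e > 0" for c e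
  proof -
    have c0: "c > 0" using c ess_norm_nonneg[OF T] by linarith
    obtain N where N: "\<And>x. x \<in> L \<Longrightarrow> nrm (tail N (T x)) \<le> c * nrm x"
      using ess_norm_lessD[OF T c] by blast
    \<comment> \<open>The errors of the first \<open>N\<close> coordinates add up to at most
      \<open>N * d \<le> e\<close>.\<close>
    define d where "d = e / (real N + 1)"
    have d: "d > 0" using e by (simp add: d_def)
    obtain K :: "complex set" where K: "finite K" "\<And>z. cmod z \<le> C \<Longrightarrow> \<exists>k\<in>K. cmod (z - k) < d"
      using finite_net_cball[OF d, of C] by blast
    \<comment> \<open>All sequences supported on the indices of \<open>R\<close> below
      \<open>N\<close> with values in \<open>K\<close>; indexing them by an extensional function
      space makes finiteness immediate.\<close>
    define F where "F = (\<lambda>f i. if i < N \<and> i \<in> R then f i else 0) ` ({..<N} \<rightarrow>\<^sub>E K)"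
    have "finite F" using K by (auto simp: F_def intro: finite_PiE)
    moreover have FL: "F \<subseteq> L"
    proof
      fix g assume "g \<in> F"
      then obtain f where g: "g = (\<lambda>i. if i < N \<and> i \<in> R then f i else 0)" by (auto simp: F_def)
      have "g = (\<Sum>i\<in>{..<N} \<inter> R. seq_scale (f i) (unit_vec i))"
      proof
        fix j
        have "(\<Sum>i\<in>{..<N} \<inter> R. seq_scale (f i) (unit_vec i)) j = (\<Sum>i\<in>{..<N} \<inter> R. if i = j then f i else 0)"
          unfolding sum_seq_apply by (intro sum.cong) (auto simp: unit_vec_def)
        also have "\<dots> = (if j \<in> {..<N} \<inter> R then f j else 0)" by (subst sum.delta) auto
        finally show "g j = (\<Sum>i\<in>{..<N} \<inter> R. seq_scale (f i) (unit_vec i)) j" by (simp add: g)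
      qed
      moreover have "(\<Sum>i\<in>{..<N} \<inter> R. seq_scale (f i) (unit_vec i)) \<in> L"
        by (intro L_sum L_scale unit_vec_L) auto
      ultimately show "g \<in> L" by metis
    qed
    moreover have "T ` ?B \<subseteq> (\<Union>g\<in>F. {x\<in>L. nrm (x - g) \<le> c + e})"
    proof
      fix y assume y: "y \<in> T ` ?B"
      have yL: "y \<in> L" by (rule TB[OF y])
      have "\<exists>k\<in>K. cmod (y i - k) < d" for i
        using K(2)[of "y i"] coord_le_nrm[OF yL, of i] TB(2)[OF y] by linarith
      then obtain f where f: "\<And>i. f i \<in> K" "\<And>i. cmod (y i - f i) < d" by metis
      define g where "g = (\<lambda>i. if i < N \<and> i \<in> R then f i else 0)"
      have "g = (\<lambda>i. if i < N \<and> i \<in> R then (restrict f {..<N}) i else 0)" by (auto simp: g_def)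
      moreover have "restrict f {..<N} \<in> {..<N} \<rightarrow>\<^sub>E K" using f by auto
      ultimately have gF: "g \<in> F" unfolding F_def by blast
      have gL: "g \<in> L" using FL gF by blast
      have "y - g = head N (y - g) + tail N y"
        by (rule ext) (auto simp: head_def tail_def g_def)
      then have "nrm (y - g) \<le> nrm (head N (y - g)) + nrm (tail N y)"
        using nrm_add[OF head_L[OF L_diff[OF yL gL]] tail_L[OF yL]] by metis
      moreover have "nrm (head N (y - g)) \<le> e"
      proof -
        have "nrm (head N (y - g)) \<le> (\<Sum>i<N. cmod ((y - g) i))" by (rule nrm_head_le_sum[OF L_diff[OF yL gL]])
        also have "\<dots> \<le> (\<Sum>i<N. d)"
          using f(2) L_outside[OF yL] d by (intro sum_mono) (auto simp: g_def less_imp_le)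
        also have "\<dots> = real N * d" by simp
        also have "\<dots> \<le> (real N + 1) * d" using d by (intro mult_right_mono) auto
        also have "\<dots> = e" by (simp add: d_def add_nonneg_eq_0_iff)
        finally show ?thesis .
      qed
      moreover have "nrm (tail N y) \<le> c"
      proof -
        obtain x where x: "x \<in> L" "nrm x \<le> 1" "y = T x" using y unfolding unit_ball_def by blast
        have "c * nrm x \<le> c * 1" using x c0 by (intro mult_left_mono) auto
        then show ?thesis using N[OF x(1)] x(3) by simp
      qed
      ultimately have "nrm (y - g) \<le> c + e" by linarith
      then show "y \<in> (\<Union>g\<in>F. {x\<in>L. nrm (x - g) \<le> c + e})" using gF yL by blast
    qed
    ultimately show ?thesis using c0 e by (auto intro: exI[of _ F])
  qed
  \<comment> \<open>Finitely many centres have tails below \<open>d\<close> at a common cutoff, so a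
    point within \<open>e\<close> of a centre has a tail of norm at most \<open>e + d\<close>
    there.\<close>
  have low: "ess_norm T \<le> e" if "e \<in> ?E" for e
  proof (rule field_le_epsilon)
    fix d :: real assume d: "d > 0"
    from that obtain F where F: "e > 0" "finite F" "F \<subseteq> L" "T ` ?B \<subseteq> (\<Union>c\<in>F. {x\<in>L. nrm (x - c) \<le> e})"
      by blast
    have "\<exists>N. \<forall>n\<ge>N. nrm (tail n c) < d" if "c \<in> F" for c
      using tail_tendsto d F(3) that by blast
    then obtain N where N: "\<And>c n. c \<in> F \<Longrightarrow> n \<ge> N c \<Longrightarrow> nrm (tail n c) < d" by metis
    define M where "M = (\<Sum>c\<in>F. N c)"
    have M: "nrm (tail M c) < d" if "c \<in> F" for c
      using that F(2) unfolding M_def by (intro N member_le_sum) auto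
    have "nrm (tail M (T x)) \<le> e + d" if x: "x \<in> L" "nrm x \<le> 1" for x
    proof -
      have "T x \<in> T ` ?B" using x by (auto simp: unit_ball_def)
      then obtain c where c: "c \<in> F" "nrm (T x - c) \<le> e" using F(4) by blast
      have L': "T x \<in> L" "c \<in> L" using blo_L[OF T x(1)] c F by auto
      have "tail M (T x) = tail M (T x - c) + tail M c" by (simp flip: tail_add)
      then have "nrm (tail M (T x)) \<le> nrm (tail M (T x - c)) + nrm (tail M c)"
        using nrm_add[OF tail_L[OF L_diff[OF L']] tail_L[OF L'(2)]] by metis
      then show ?thesis using nrm_tail_le[OF L_diff[OF L'], of M] c M[OF c(1)] by linarith
    qed
    then show "ess_norm T \<le> e + d"
      by (intro ess_norm_le[of _ M] tail_bound_from_ball[OF T]) (use F(1) d in auto)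
  qed
  have hm: "hmnc L nrm T = Inf ?E" by (simp add: hmnc_def hmnc_set_def)
  show ?thesis
  proof (rule antisym)
    show "hmnc L nrm T \<le> ess_norm T"
    proof (rule field_le_epsilon)
      fix e :: real assume e: "e > 0"
      have "ess_norm T + e / 2 + e / 2 \<in> ?E" by (rule up) (use e in auto)
      then have "Inf ?E \<le> ess_norm T + e / 2 + e / 2" by (intro cInf_lower) (auto intro!: bdd_belowI[of _ 0])
      then show "hmnc L nrm T \<le> ess_norm T + e" unfolding hm by simp
    qed
    have "?E \<noteq> {}" using up[of "ess_norm T + 1" 1] by auto
    then show "ess_norm T \<le> hmnc L nrm T" unfolding hm by (rule cInf_greatest) (rule low)
  qed
qed

end

section \<open>The Calkin algebra\<close>

context oc_seq_space
begin

text \<open>Otherwise every cutoff \<open>N\<close> has a vector of the ball whose image keeps a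
  tail above \<open>e\<close>. A convergent subsequence of these images would have a limit with
  small tails, which is impossible.\<close>

lemma compact_imp_ess_norm_0:
  assumes "compact_operator L nrm T" shows "ess_norm T = 0"
proof (rule ccontr)
  assume ne: "ess_norm T \<noteq> 0"
  have T: "blo T" using assms by (simp add: compact_operator_def)
  define e where "e = ess_norm T / 2"
  have e: "e > 0" "e < ess_norm T" using ne ess_norm_nonneg[OF T] by (auto simp: e_def)
  have "\<exists>x\<in>L. nrm x \<le> 1 \<and> nrm (tail N (T x)) > e" for N
  proof (rule ccontr)
    assume "\<not> (\<exists>x\<in>L. nrm x \<le> 1 \<and> nrm (tail N (T x)) > e)"
    then have "nrm (tail N (T x)) \<le> e" if "x \<in> L" "nrm x \<le> 1" for x
      using that by (meson not_le)
    then have "ess_norm T \<le> e"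
      using e(1) by (intro ess_norm_le[of _ N] tail_bound_from_ball[OF T]) auto
    with e show False by simp
  qed
  then obtain X where X: "\<And>N. X N \<in> L" "\<And>N. nrm (X N) \<le> 1" "\<And>N. nrm (tail N (T (X N))) > e" by metis
  then have "\<forall>n. X n \<in> unit_ball L nrm" by (simp add: unit_ball_def)
  then obtain \<phi> :: "nat \<Rightarrow> nat" and y where \<phi>: "strict_mono \<phi>" "y \<in> L" "(\<lambda>n. nrm (T (X (\<phi> n)) - y)) \<longlonglongrightarrow> 0"
    using assms unfolding compact_operator_def by blast
  obtain N where N: "\<forall>n\<ge>N. nrm (tail n y) < e / 2" using tail_tendsto[OF \<phi>(2)] e(1) by (meson half_gt_zero)
  have "\<forall>\<^sub>F n in sequentially. nrm (T (X (\<phi> n)) - y) < e / 2"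
    by (rule order_tendstoD(2)[OF \<phi>(3) half_gt_zero[OF e(1)]])
  then obtain n where n: "n \<ge> N" "nrm (T (X (\<phi> n)) - y) < e / 2"
    unfolding eventually_sequentially by (meson linear)
  let ?k = "\<phi> n"
  \<comment> \<open>The cutoff belonging to the vector \<open>X (\<phi> n)\<close> is
    \<open>\<phi> n\<close>, which is at least \<open>n\<close> by strict monotonicity.\<close>
  have k: "?k \<ge> N" using seq_suble[OF \<phi>(1), of n] n(1) by simp
  have TL: "T (X ?k) \<in> L" by (rule blo_L[OF T X(1)])
  have "tail ?k (T (X ?k)) = tail ?k (T (X ?k) - y) + tail ?k y" by (simp flip: tail_add)
  then have "nrm (tail ?k (T (X ?k))) \<le> nrm (tail ?k (T (X ?k) - y)) + nrm (tail ?k y)"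
    using nrm_add[OF tail_L[OF L_diff[OF TL \<phi>(2)]] tail_L[OF \<phi>(2)]] by metis
  also have "\<dots> < e / 2 + e / 2"
    using nrm_tail_le[OF L_diff[OF TL \<phi>(2)], of ?k] n(2) N k by (intro add_strict_mono) auto
  finally show False using X(3)[of ?k] by simp
qed

text \<open>A subsequence of the images converges in every coordinate. The tails of the images are
  uniformly small and finitely many coordinates control the heads, so this subsequence is Cauchy in
  norm.\<close>

lemma ess_norm_0_imp_compact:
  assumes T: "blo T" and 0: "ess_norm T = 0" shows "compact_operator L nrm T"
  unfolding compact_operator_def
proof (intro conjI allI impI T)
  fix X :: "nat \<Rightarrow> seq" assume X: "\<forall>n. X n \<in> unit_ball L nrm"
  then have XL: "X n \<in> L" "nrm (X n) \<le> 1" for n by (auto simp: unit_ball_def)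
  have TL: "T (X n) \<in> L" for n by (rule blo_L[OF T XL(1)])
  obtain C where C: "C > 0" "\<And>x. x \<in> L \<Longrightarrow> nrm (T x) \<le> C * nrm x" using blo_bound[OF T] by blast
  have "norm (T (X n) i) \<le> C" for n i
  proof -
    have "C * nrm (X n) \<le> C * 1" using XL C by (intro mult_left_mono) auto
    then show ?thesis using coord_le_nrm[OF TL[of n], of i] C(2)[OF XL(1)[of n]] by linarith
  qed
  \<comment> \<open>Diagonal extraction, applicable because all coordinates are bounded by the same
    \<open>C\<close>.\<close>
  then obtain \<phi> where \<phi>: "strict_mono (\<phi>::nat\<Rightarrow>nat)" "\<And>i. \<exists>l. (\<lambda>n. T (X (\<phi> n)) i) \<longlonglongrightarrow> l"
    using function_convergent_subsequence[of "UNIV :: nat set" "\<lambda>n. T (X n)" C] by (metis UNIV_I countableI_type)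
  define Y where "Y n = T (X (\<phi> n))" for n
  have YL: "Y n \<in> L" for n unfolding Y_def by (rule TL)
  obtain l where l: "\<And>i. (\<lambda>n. Y n i) \<longlonglongrightarrow> l i" using \<phi>(2) unfolding Y_def by metis
  have "\<exists>M. \<forall>p\<ge>M. \<forall>q\<ge>M. nrm (Y p - Y q) < e" if e: "e > 0" for e
  proof -
    obtain N where N: "\<And>x. x \<in> L \<Longrightarrow> nrm (tail N (T x)) \<le> e / 4 * nrm x"
      using ess_norm_lessD[OF T, of "e / 4"] 0 e by auto
    have tY: "nrm (tail N (Y n)) \<le> e / 4" for n
    proof -
      have "e / 4 * nrm (X (\<phi> n)) \<le> e / 4 * 1" using XL e by (intro mult_left_mono) auto
      then show ?thesis using N[OF XL(1)[of "\<phi> n"]] unfolding Y_def by linarith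
    qed
    have "(\<lambda>n. \<Sum>i<N. cmod (Y n i - l i)) \<longlonglongrightarrow> (\<Sum>i<N. cmod (l i - l i))"
      by (intro tendsto_intros l)
    then have "\<forall>\<^sub>F n in sequentially. (\<Sum>i<N. cmod (Y n i - l i)) < e / 4"
      using e by (intro order_tendstoD(2)) auto
    then obtain M where M: "\<And>n. n \<ge> M \<Longrightarrow> (\<Sum>i<N. cmod (Y n i - l i)) < e / 4"
      unfolding eventually_sequentially by blast
    have "nrm (Y p - Y q) < e" if "p \<ge> M" "q \<ge> M" for p q
    proof -
      have D: "Y p - Y q \<in> L" by (rule L_diff[OF YL YL])
      have "nrm (head N (Y p - Y q)) \<le> (\<Sum>i<N. cmod ((Y p - Y q) i))" by (rule nrm_head_le_sum[OF D])
      also have "\<dots> \<le> (\<Sum>i<N. cmod (Y p i - l i) + cmod (Y q i - l i))"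
      proof (rule sum_mono)
        fix i show "cmod ((Y p - Y q) i) \<le> cmod (Y p i - l i) + cmod (Y q i - l i)"
          using norm_triangle_ineq4[of "Y p i - l i" "Y q i - l i"] by simp
      qed
      also have "\<dots> < e / 4 + e / 4"
        unfolding sum.distrib by (intro add_strict_mono M that)
      finally have "nrm (head N (Y p - Y q)) < e / 2" by simp
      moreover have "nrm (tail N (Y p - Y q)) \<le> e / 2"
        using nrm_diff[OF tail_L[OF YL] tail_L[OF YL], of N p N q] tY[of p] tY[of q]
        unfolding tail_diff by linarith
      moreover have "nrm (Y p - Y q) \<le> nrm (head N (Y p - Y q)) + nrm (tail N (Y p - Y q))"
        using nrm_add[OF head_L[OF D] tail_L[OF D], of N N] by (simp only: head_plus_tail)
      ultimately show ?thesis by linarith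
    qed
    then show ?thesis by blast
  qed
  then obtain y where "y \<in> L" "(\<lambda>n. nrm (Y n - y)) \<longlonglongrightarrow> 0" using L_complete[of Y] YL by blast
  then show "\<exists>\<phi> y. strict_mono \<phi> \<and> y \<in> L \<and> (\<lambda>n. nrm (T (X (\<phi> n)) - y)) \<longlonglongrightarrow> 0"
    using \<phi>(1) unfolding Y_def by blast
qed

lemma compact_operator_iff: "compact_operator L nrm T \<longleftrightarrow> blo T \<and> ess_norm T = 0"
  using compact_imp_ess_norm_0 ess_norm_0_imp_compact by (auto simp: compact_operator_def)

text \<open>Equality of cosets in the Calkin algebra. Boundedness of both sides is built in, so that
  chains of equalities carry it along.\<close>

definition ess_eq :: "seqop \<Rightarrow> seqop \<Rightarrow> bool" where
  "ess_eq T U \<longleftrightarrow> blo T \<and> blo U \<and> ess_norm (\<lambda>x. T x - U x) = 0"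

lemma ess_eqI_le: "blo T \<Longrightarrow> blo U \<Longrightarrow> ess_norm (\<lambda>x. T x - U x) \<le> 0 \<Longrightarrow> ess_eq T U"
  using ess_norm_nonneg[OF blo_diff_op] unfolding ess_eq_def by (metis antisym)

lemma ess_eq_blo: "ess_eq T U \<Longrightarrow> blo T" "ess_eq T U \<Longrightarrow> blo U"
  by (auto simp: ess_eq_def)

lemma ess_norm_zero: "ess_norm (\<lambda>x. 0) = 0"
  using ess_norm_le_bound[of 0 "\<lambda>x. 0"] ess_norm_nonneg[OF blo_zero_op] by simp

lemma ess_eq_on_L: assumes "blo T" "\<And>x. x \<in> L \<Longrightarrow> U x = T x" shows "ess_eq T U"
proof -
  have "ess_norm (\<lambda>x. T x - U x) = ess_norm (\<lambda>x. 0)" by (rule ess_norm_cong) (simp add: assms(2))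
  then show ?thesis unfolding ess_eq_def using assms(1) blo_cong[OF assms] ess_norm_zero by metis
qed

lemma ess_eq_refl: "blo T \<Longrightarrow> ess_eq T T"
  by (rule ess_eq_on_L) simp_all

lemma ess_eq_sym: assumes "ess_eq T U" shows "ess_eq U T"
proof (rule ess_eqI_le)
  show T: "blo T" and U: "blo U" using assms by (rule ess_eq_blo)+
  have "ess_norm (\<lambda>x. U x - T x) = ess_norm (\<lambda>x. seq_scale (-1) (T x - U x))"
    by (rule ess_norm_cong) (rule ext, simp)
  also have "\<dots> \<le> cmod (-1) * ess_norm (\<lambda>x. T x - U x)" by (rule ess_norm_scale_le[OF blo_diff_op[OF T U]])
  also have "\<dots> = 0" using assms by (simp add: ess_eq_def)
  finally show "ess_norm (\<lambda>x. U x - T x) \<le> 0" .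
qed

lemma ess_eq_trans [trans]: assumes "ess_eq T U" "ess_eq U V" shows "ess_eq T V"
proof (rule ess_eqI_le)
  show T: "blo T" and V: "blo V" using assms by (auto dest: ess_eq_blo)
  have U: "blo U" using assms by (auto dest: ess_eq_blo)
  have "ess_norm (\<lambda>x. T x - V x) = ess_norm (\<lambda>x. (T x - U x) + (U x - V x))"
    by (rule ess_norm_cong) simp
  also have "\<dots> \<le> ess_norm (\<lambda>x. T x - U x) + ess_norm (\<lambda>x. U x - V x)"
    by (rule ess_norm_add[OF blo_diff_op[OF T U] blo_diff_op[OF U V]])
  also have "\<dots> = 0" using assms by (simp add: ess_eq_def)
  finally show "ess_norm (\<lambda>x. T x - V x) \<le> 0" .
qed

lemma ess_eq_comp: assumes "ess_eq T T'" "ess_eq U U'" shows "ess_eq (\<lambda>x. T (U x)) (\<lambda>x. T' (U' x))"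
proof (rule ess_eqI_le)
  note T = ess_eq_blo(1)[OF assms(1)] and T' = ess_eq_blo(2)[OF assms(1)]
  note U = ess_eq_blo(1)[OF assms(2)] and U' = ess_eq_blo(2)[OF assms(2)]
  show "blo (\<lambda>x. T (U x))" "blo (\<lambda>x. T' (U' x))" by (rule blo_comp[OF T U], rule blo_comp[OF T' U'])
  have dT: "blo (\<lambda>x. T x - T' x)" and dU: "blo (\<lambda>x. U x - U' x)"
    by (rule blo_diff_op[OF T T'], rule blo_diff_op[OF U U'])
  have "ess_norm (\<lambda>x. T (U x) - T' (U' x)) = ess_norm (\<lambda>x. T (U x - U' x) + (T (U' x) - T' (U' x)))"
    by (rule ess_norm_cong) (simp add: blo_diff[OF T] blo_L[OF U] blo_L[OF U'])
  also have "\<dots> \<le> ess_norm (\<lambda>x. T (U x - U' x)) + ess_norm (\<lambda>x. T (U' x) - T' (U' x))"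
    using ess_norm_add[OF blo_comp[OF T dU] blo_comp[OF dT U']] .
  also have "\<dots> \<le> ess_norm T * ess_norm (\<lambda>x. U x - U' x) + ess_norm (\<lambda>x. T x - T' x) * ess_norm U'"
    using ess_norm_comp[OF T dU] ess_norm_comp[OF dT U'] by (rule add_mono)
  also have "\<dots> = 0" using assms by (simp add: ess_eq_def)
  finally show "ess_norm (\<lambda>x. T (U x) - T' (U' x)) \<le> 0" .
qed

lemma ess_eq_diff: assumes "ess_eq T T'" "ess_eq U U'" shows "ess_eq (\<lambda>x. T x - U x) (\<lambda>x. T' x - U' x)"
proof (rule ess_eqI_le)
  note T = ess_eq_blo(1)[OF assms(1)] and T' = ess_eq_blo(2)[OF assms(1)]
  note U = ess_eq_blo(1)[OF assms(2)] and U' = ess_eq_blo(2)[OF assms(2)]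
  show "blo (\<lambda>x. T x - U x)" "blo (\<lambda>x. T' x - U' x)" by (rule blo_diff_op[OF T U], rule blo_diff_op[OF T' U'])
  have "ess_norm (\<lambda>x. (T x - U x) - (T' x - U' x)) = ess_norm (\<lambda>x. (T x - T' x) - (U x - U' x))"
    by (rule ess_norm_cong) simp
  also have "\<dots> \<le> ess_norm (\<lambda>x. T x - T' x) + ess_norm (\<lambda>x. U x - U' x)"
    by (rule ess_norm_diff[OF blo_diff_op[OF T T'] blo_diff_op[OF U U']])
  also have "\<dots> = 0" using assms by (simp add: ess_eq_def)
  finally show "ess_norm (\<lambda>x. (T x - U x) - (T' x - U' x)) \<le> 0" .
qed

lemma ess_eq_scale: assumes "ess_eq T U" shows "ess_eq (\<lambda>x. seq_scale c (T x)) (\<lambda>x. seq_scale c (U x))"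
proof -
  have "blo (seq_scale c)" using blo_scale_op[OF blo_id, of c] by simp
  then show ?thesis by (rule ess_eq_comp[OF ess_eq_refl assms])
qed

lemma ess_eq_norm_le: assumes "ess_eq T U" shows "ess_norm T \<le> ess_norm U"
proof -
  note T = ess_eq_blo(1)[OF assms] and U = ess_eq_blo(2)[OF assms]
  have "ess_norm T = ess_norm (\<lambda>x. (T x - U x) + U x)" by (rule ess_norm_cong) simp
  also have "\<dots> \<le> ess_norm (\<lambda>x. T x - U x) + ess_norm U" by (rule ess_norm_add[OF blo_diff_op[OF T U] U])
  also have "\<dots> = ess_norm U" using assms by (simp add: ess_eq_def)
  finally show ?thesis .
qed

text \<open>The difference lives on the first \<open>N\<close> coordinates, so its own
  \<open>N\<close>-th tail is 0: cutting off is a finite rank perturbation.\<close>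

lemma ess_eq_tail: assumes "blo T" shows "ess_eq (\<lambda>x. tail N (T x)) T"
proof (rule ess_eqI_le)
  show "blo (\<lambda>x. tail N (T x))" "blo T" by (rule blo_comp[OF blo_tail assms], rule assms)
  have z: "tail N (tail N y - y) = 0" for y by (rule ext) (simp add: tail_def)
  show "ess_norm (\<lambda>x. tail N (T x) - T x) \<le> 0" by (rule ess_norm_le[of _ N]) (simp_all only: z nrm_zero order_refl mult_zero_left)
qed

text \<open>Via \<open>compact_operator_iff\<close> both compactness conditions become
  \<open>ess_eq\<close>, so invertibility modulo compact operators can be handled by equational
  reasoning.\<close>

lemma not_ess_spectrum_iff:
  assumes T: "blo T"
  shows "z \<notin> ess_spectrum L nrm T \<longleftrightarrow> (\<exists>S. ess_eq (\<lambda>x. S (seq_scale z x - T x)) (\<lambda>x. x) \<and>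
     ess_eq (\<lambda>x. seq_scale z (S x) - T (S x)) (\<lambda>x. x) \<and> blo S)"
proof -
  have X: "blo (\<lambda>x. seq_scale z x - T x)" by (rule blo_diff_op[OF blo_scale_op[OF blo_id] T])
  have "compact_operator L nrm (\<lambda>x. S (seq_scale z x - T x) - x) \<longleftrightarrow> ess_eq (\<lambda>x. S (seq_scale z x - T x)) (\<lambda>x. x)"
    "compact_operator L nrm (\<lambda>x. seq_scale z (S x) - T (S x) - x) \<longleftrightarrow> ess_eq (\<lambda>x. seq_scale z (S x) - T (S x)) (\<lambda>x. x)"
    if S: "blo S" for S
    unfolding compact_operator_iff ess_eq_def
    using blo_comp[OF S X] blo_comp[OF X S] blo_id blo_diff_op[OF blo_comp[OF S X] blo_id]
      blo_diff_op[OF blo_comp[OF X S] blo_id] by blast+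
  then show ?thesis unfolding ess_spectrum_def by blast
qed

section \<open>Norm limits and the Neumann series\<close>

lemma nrm_limit_unique:
  assumes "\<And>n. X n \<in> L" "a \<in> L" "b \<in> L" "(\<lambda>n. nrm (X n - a)) \<longlonglongrightarrow> 0" "(\<lambda>n. nrm (X n - b)) \<longlonglongrightarrow> 0"
  shows "a = b"
proof
  fix i show "a i = b i"
    by (rule LIMSEQ_unique[OF nrm_limit_coord[OF assms(1,2,4)] nrm_limit_coord[OF assms(1,3,5)]])
qed

text \<open>The partial sums are Cauchy by the geometric series, and completeness gives
  \<open>S\<close>. Convergence of the partial sums is kept as a conclusion because positivity of
  \<open>S\<close> is later read off from them.\<close>

lemma Neumann_series:
  assumes V: "blo V" and q: "0 \<le> q" "q < 1" "\<And>x. x \<in> L \<Longrightarrow> nrm (V x) \<le> q * nrm x"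
  obtains S where "blo S" "\<And>x. x \<in> L \<Longrightarrow> S x - V (S x) = x" "\<And>x. x \<in> L \<Longrightarrow> S (x - V x) = x"
    "\<And>x. x \<in> L \<Longrightarrow> (\<lambda>n. nrm ((\<Sum>k<n. (V ^^ k) x) - S x)) \<longlonglongrightarrow> 0"
proof -
  define P where "P n x = (\<Sum>k<n. (V ^^ k) x)" for n x
  have VL: "(V ^^ k) x \<in> L" if "x \<in> L" for k x by (rule blo_L[OF blo_funpow[OF V] that])
  have P: "blo (P n)" for n unfolding P_def[abs_def] by (rule blo_sum_op[OF blo_funpow[OF V]])
  have PL: "P n x \<in> L" if "x \<in> L" for n x by (rule blo_L[OF P that])
  have Vk: "nrm ((V ^^ k) x) \<le> q ^ k * nrm x" if x: "x \<in> L" for k x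
  proof (induction k)
    case (Suc k)
    have "nrm ((V ^^ Suc k) x) \<le> q * nrm ((V ^^ k) x)" using q(3)[OF VL[OF x]] by simp
    also have "\<dots> \<le> q * (q ^ k * nrm x)" using Suc q by (intro mult_left_mono) auto
    finally show ?case by simp
  qed simp
  have diff: "nrm (P (p + r) x - P p x) \<le> q ^ p / (1 - q) * nrm x" if x: "x \<in> L" for p r x
  proof -
    have "P (p + r) x - P p x = (\<Sum>k\<in>{p..<p + r}. (V ^^ k) x)"
      unfolding P_def lessThan_atLeast0 by (simp only: sum_diff_nat_ivl le0 le_add1)
    then have "nrm (P (p + r) x - P p x) \<le> (\<Sum>k\<in>{p..<p + r}. nrm ((V ^^ k) x))"
      using nrm_sum[of "{p..<p + r}" "\<lambda>k. (V ^^ k) x"] VL[OF x] by metis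
    also have "\<dots> \<le> (\<Sum>k\<in>{p..<p + r}. q ^ k * nrm x)" by (intro sum_mono Vk x)
    also have "\<dots> = (\<Sum>k<r. q ^ (k + p)) * nrm x"
      using sum.shift_bounds_nat_ivl[of "\<lambda>k. q ^ k * nrm x" 0 p r]
      by (simp add: lessThan_atLeast0 sum_distrib_right add.commute)
    also have "\<dots> = q ^ p * (\<Sum>k<r. q ^ k) * nrm x" by (simp add: power_add sum_distrib_left mult.commute)
    also have "\<dots> \<le> q ^ p * (1 / (1 - q)) * nrm x"
    proof -
      have "(\<Sum>k<r. q ^ k) = (1 - q ^ r) / (1 - q)" using q by (simp add: sum_gp_strict)
      also have "\<dots> \<le> 1 / (1 - q)" using q by (intro divide_right_mono) auto
      finally show ?thesis using q nrm_nonneg[OF x] by (intro mult_right_mono mult_left_mono) auto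
    qed
    finally show ?thesis by simp
  qed
  have "\<exists>y\<in>L. (\<lambda>n. nrm (P n x - y)) \<longlonglongrightarrow> 0" if x: "x \<in> L" for x
  proof (rule L_complete)
    show "\<forall>n. P n x \<in> L" using PL[OF x] by blast
    show "\<forall>e>0. \<exists>M. \<forall>p\<ge>M. \<forall>r\<ge>M. nrm (P p x - P r x) < e"
    proof (intro allI impI)
      fix e :: real assume e: "e > 0"
      have "(\<lambda>p. q ^ p / (1 - q) * nrm x) \<longlonglongrightarrow> 0 / (1 - q) * nrm x"
        using q by (intro tendsto_intros LIMSEQ_realpow_zero) auto
      then have "\<forall>\<^sub>F p in sequentially. q ^ p / (1 - q) * nrm x < e"
        using e by (intro order_tendstoD(2)) auto
      then obtain M where M: "\<And>p. p \<ge> M \<Longrightarrow> q ^ p / (1 - q) * nrm x < e"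
        unfolding eventually_sequentially by blast
      have *: "nrm (P p x - P r x) < e" if "r \<ge> M" "p \<ge> r" for p r
        using diff[OF x, of r "p - r"] M[OF that(1)] that by simp
      have "nrm (P p x - P r x) < e" if "p \<ge> M" "r \<ge> M" for p r
      proof (cases "p \<ge> r")
        case False
        then show ?thesis using *[of p r] that nrm_minus_commute[OF PL[OF x] PL[OF x], of p r] by simp
      qed (use * that in blast)
      then show "\<exists>M. \<forall>p\<ge>M. \<forall>r\<ge>M. nrm (P p x - P r x) < e" by blast
    qed
  qed
  then obtain S where SL: "\<And>x. x \<in> L \<Longrightarrow> S x \<in> L" and S: "\<And>x. x \<in> L \<Longrightarrow> (\<lambda>n. nrm (P n x - S x)) \<longlonglongrightarrow> 0"
    by metis
  \<comment> \<open>Limits are unique, so linearity of \<open>S\<close> and its commutation with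
    \<open>V\<close> follow from the same facts for the partial sums.\<close>
  have SI: "S x = y" if "x \<in> L" "y \<in> L" "(\<lambda>n. nrm (P n x - y)) \<longlonglongrightarrow> 0" for x y
    by (rule nrm_limit_unique[OF PL[OF that(1)] SL[OF that(1)] that(2) S[OF that(1)] that(3)])
  have lim0: "f \<longlonglongrightarrow> 0" if "\<And>n. 0 \<le> f n" "\<And>n. f n \<le> g n" "g \<longlonglongrightarrow> 0" for f g :: "nat \<Rightarrow> real"
    by (rule tendsto_sandwich[OF _ _ tendsto_const that(3)]) (simp_all add: that(1,2))
  have Sblo: "blo S"
  proof (rule bloI[of _ "1 / (1 - q)"])
    fix x assume x: "x \<in> L"
    show "S x \<in> L" by (rule SL[OF x])
    show "S (x + y) = S x + S y" if y: "y \<in> L" for y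
    proof (rule SI[OF L_add[OF x y] L_add[OF SL[OF x] SL[OF y]]])
      have le: "nrm (P n (x + y) - (S x + S y)) \<le> nrm (P n x - S x) + nrm (P n y - S y)" for n
      proof -
        have "P n (x + y) - (S x + S y) = (P n x - S x) + (P n y - S y)"
          unfolding blo_add[OF P x y] by simp
        then show ?thesis
          using nrm_add[OF L_diff[OF PL[OF x] SL[OF x]] L_diff[OF PL[OF y] SL[OF y]]] by metis
      qed
      show "(\<lambda>n. nrm (P n (x + y) - (S x + S y))) \<longlonglongrightarrow> 0"
        by (rule lim0[OF nrm_nonneg le])
          (use L_diff[OF PL[OF L_add[OF x y]] L_add[OF SL[OF x] SL[OF y]]] tendsto_add[OF S[OF x] S[OF y]] in simp_all)
    qed
    show "S (seq_scale c x) = seq_scale c (S x)" for c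
    proof (rule SI[OF L_scale[OF x] L_scale[OF SL[OF x]]])
      have "P n (seq_scale c x) - seq_scale c (S x) = seq_scale c (P n x - S x)" for n
        unfolding blo_scale[OF P x] by (rule ext) (simp add: algebra_simps)
      then have "nrm (P n (seq_scale c x) - seq_scale c (S x)) = cmod c * nrm (P n x - S x)" for n
        using nrm_scale[OF L_diff[OF PL[OF x] SL[OF x]]] by metis
      then show "(\<lambda>n. nrm (P n (seq_scale c x) - seq_scale c (S x))) \<longlonglongrightarrow> 0"
        using tendsto_mult_right_zero[OF S[OF x], of "cmod c"] by simp
    qed
    show "nrm (S x) \<le> 1 / (1 - q) * nrm x"
    proof (rule tendsto_lowerbound)
      show "(\<lambda>n. 1 / (1 - q) * nrm x + nrm (P n x - S x)) \<longlonglongrightarrow> 1 / (1 - q) * nrm x"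
        using tendsto_add[OF tendsto_const S[OF x]] by simp
      have "nrm (S x) \<le> 1 / (1 - q) * nrm x + nrm (P n x - S x)" for n
      proof -
        have "P 0 x = 0" by (simp add: P_def)
        then have "nrm (P n x) \<le> 1 / (1 - q) * nrm x" using diff[OF x, of 0 n] by simp
        moreover have "nrm (S x) \<le> nrm (P n x) + nrm (P n x - S x)"
          using nrm_diff[OF PL[OF x] L_diff[OF PL[OF x] SL[OF x]], of n n] by simp
        ultimately show ?thesis by linarith
      qed
      then show "\<forall>\<^sub>F n in sequentially. nrm (S x) \<le> 1 / (1 - q) * nrm x + nrm (P n x - S x)" by simp
    qed simp
  qed
  have VSL: "V (S x) \<in> L" if "x \<in> L" for x by (rule blo_L[OF V SL[OF that]])
  have VPL: "V (P n x) \<in> L" if "x \<in> L" for n x by (rule blo_L[OF V PL[OF that]])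
  have VP: "(\<lambda>n. nrm (V (P n x) - V (S x))) \<longlonglongrightarrow> 0" if x: "x \<in> L" for x
  proof (rule lim0)
    fix n
    show "0 \<le> nrm (V (P n x) - V (S x))" by (rule nrm_nonneg[OF L_diff[OF VPL[OF x] VSL[OF x]]])
    show "nrm (V (P n x) - V (S x)) \<le> q * nrm (P n x - S x)"
      using q(3)[OF L_diff[OF PL[OF x] SL[OF x]], of n] unfolding blo_diff[OF V PL[OF x] SL[OF x]] .
  qed (use tendsto_mult_right_zero[OF S[OF x]] in simp)
  have 1: "S x - V (S x) = x" if x: "x \<in> L" for x
  proof -
    have Psuc: "P (Suc n) x = x + V (P n x)" for n
    proof -
      have "V (P n x) = (\<Sum>k<n. (V ^^ Suc k) x)" unfolding P_def using blo_sum[OF V VL[OF x]] by simp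
      then show ?thesis unfolding P_def by (simp only: sum.lessThan_Suc_shift) simp
    qed
    have "S x = x + V (S x)"
    proof (rule nrm_limit_unique[of "\<lambda>n. P (Suc n) x"])
      show "(\<lambda>n. nrm (P (Suc n) x - S x)) \<longlonglongrightarrow> 0" by (rule LIMSEQ_Suc[OF S[OF x]])
      show "(\<lambda>n. nrm (P (Suc n) x - (x + V (S x)))) \<longlonglongrightarrow> 0" unfolding Psuc using VP[OF x] by simp
    qed (rule PL[OF x] SL[OF x] L_add[OF x VSL[OF x]])+
    then show ?thesis by (simp add: diff_eq_eq)
  qed
  have 2: "S (x - V x) = x" if x: "x \<in> L" for x
  proof -
    have Vx: "V x \<in> L" by (rule blo_L[OF V x])
    have "P n (V x) = V (P n x)" for n
    proof -
      have "V (P n x) = (\<Sum>k<n. V ((V ^^ k) x))" unfolding P_def by (rule blo_sum[OF V VL[OF x]])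
      then show ?thesis unfolding P_def by (simp add: funpow_swap1)
    qed
    then have "S (V x) = V (S x)" using SI[OF Vx VSL[OF x]] VP[OF x] by simp
    then show ?thesis using 1[OF x] blo_diff[OF Sblo x Vx] by simp
  qed
  show thesis by (rule that[OF Sblo 1 2]) (use S in \<open>simp_all add: P_def\<close>)
qed

end

section \<open>The essential spectral radius of a positive operator\<close>

lemma cmod_le_of_le: "complex_of_real (cmod w) \<le> v \<Longrightarrow> cmod w \<le> cmod v"
  using complex_Re_le_cmod[of v] by (simp add: less_eq_complex_def)

lemma seq_scale_mono: "c \<ge> 0 \<Longrightarrow> x \<le> y \<Longrightarrow> seq_scale (complex_of_real c) x \<le> seq_scale (complex_of_real c) y"
  by (auto simp: le_fun_def less_eq_complex_def mult_left_mono)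

lemma seq_scale_nonneg: "c \<ge> 0 \<Longrightarrow> 0 \<le> x \<Longrightarrow> 0 \<le> seq_scale (complex_of_real c) x"
  using seq_scale_mono[of c 0 x] by simp

lemma seq_scale_diff_right: "seq_scale c (x - y) = seq_scale c x - seq_scale c y"
  by (rule ext) (simp add: right_diff_distrib)

lemma seq_scale_cancel: "k \<noteq> 0 \<Longrightarrow> seq_scale (complex_of_real (1 / k)) (seq_scale (complex_of_real k) x) = x"
  by simp

lemma abs_seq_scale: "abs_seq (seq_scale c x) = seq_scale (complex_of_real (cmod c)) (abs_seq x)"
  by (rule ext) (simp add: abs_seq_def norm_mult)

lemma tail_nonneg: "0 \<le> x \<Longrightarrow> 0 \<le> tail N x"
  by (auto simp: le_fun_def tail_def)

context oc_seq_space
begin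

section \<open>Parametrices from truncated Neumann series\<close>

definition pow_norm :: "seqop \<Rightarrow> nat \<Rightarrow> real" where
  "pow_norm T n = ess_norm (T ^^ n)"

lemma submult_pow_norm: assumes T: "blo T" shows "submult_seq (pow_norm T)"
proof
  show "pow_norm T n \<ge> 0" for n unfolding pow_norm_def by (rule ess_norm_nonneg[OF blo_funpow[OF T]])
  show "pow_norm T (p + q) \<le> pow_norm T p * pow_norm T q" for p q
    unfolding pow_norm_def funpow_add comp_def by (rule ess_norm_comp[OF blo_funpow[OF T] blo_funpow[OF T]])
qed

text \<open>The first \<open>n\<close> terms of the expansion of the resolvent of \<open>T\<close>
  at \<open>z\<close> in powers of \<open>1 / z\<close>.\<close>

definition resolvent_sum :: "complex \<Rightarrow> seqop \<Rightarrow> nat \<Rightarrow> seqop" where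
  "resolvent_sum z T n x = (\<Sum>i<n. seq_scale (1 / z ^ Suc i) ((T ^^ i) x))"

text \<open>With \<open>a i\<close> the \<open>i\<close>-th power of \<open>T / z\<close> at
  \<open>x\<close>, the summands are \<open>a i - a (Suc i)\<close> and telescope. Both orders give
  the same result because \<open>T\<close> commutes with its powers.\<close>

lemma resolvent_sum:
  assumes T: "blo T" and z: "z \<noteq> 0"
  shows "blo (resolvent_sum z T n)"
    and "x \<in> L \<Longrightarrow> resolvent_sum z T n (seq_scale z x - T x) = x - seq_scale (1 / z ^ n) ((T ^^ n) x)"
    and "x \<in> L \<Longrightarrow> seq_scale z (resolvent_sum z T n x) - T (resolvent_sum z T n x)
      = x - seq_scale (1 / z ^ n) ((T ^^ n) x)"
proof -
  show F: "blo (resolvent_sum z T n)"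
    unfolding resolvent_sum_def[abs_def] by (rule blo_sum_op[OF blo_scale_op[OF blo_funpow[OF T]]])
  have X: "blo (\<lambda>x. seq_scale z x - T x)" by (rule blo_diff_op[OF blo_scale_op[OF blo_id] T])
  show 1: "resolvent_sum z T n (seq_scale z x - T x) = x - seq_scale (1 / z ^ n) ((T ^^ n) x)" if x: "x \<in> L" for x
  proof -
    define a where "a i = seq_scale (1 / z ^ i) ((T ^^ i) x)" for i
    have "seq_scale (1 / z ^ Suc i) ((T ^^ i) (seq_scale z x - T x)) = a i - a (Suc i)" for i
    proof -
      have "(T ^^ i) (seq_scale z x - T x) = seq_scale z ((T ^^ i) x) - (T ^^ Suc i) x"
        unfolding blo_diff[OF blo_funpow[OF T] L_scale[OF x] blo_L[OF T x]] blo_scale[OF blo_funpow[OF T] x]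
        by (simp add: funpow_swap1)
      then show ?thesis using z by (simp add: a_def seq_scale_diff_right)
    qed
    then have "resolvent_sum z T n (seq_scale z x - T x) = (\<Sum>i<n. a i - a (Suc i))"
      by (simp only: resolvent_sum_def)
    also have "\<dots> = a 0 - a n" by (rule sum_lessThan_telescope')
    finally show ?thesis by (simp add: a_def)
  qed
  show "seq_scale z (resolvent_sum z T n x) - T (resolvent_sum z T n x)
      = x - seq_scale (1 / z ^ n) ((T ^^ n) x)" if x: "x \<in> L"
  proof -
    have TL: "(T ^^ i) x \<in> L" for i by (rule blo_L[OF blo_funpow[OF T] x])
    have "seq_scale z (resolvent_sum z T n x) - T (resolvent_sum z T n x)
        = (\<Sum>i<n. seq_scale z (seq_scale (1 / z ^ Suc i) ((T ^^ i) x)) - T (seq_scale (1 / z ^ Suc i) ((T ^^ i) x)))"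
      unfolding resolvent_sum_def by (rule blo_sum[OF X L_scale[OF TL]])
    also have "\<dots> = (\<Sum>i<n. seq_scale (1 / z ^ Suc i) ((T ^^ i) (seq_scale z x - T x)))"
    proof (rule sum.cong[OF refl])
      fix i
      have "(T ^^ i) (seq_scale z x - T x) = seq_scale z ((T ^^ i) x) - T ((T ^^ i) x)"
        unfolding blo_diff[OF blo_funpow[OF T] L_scale[OF x] blo_L[OF T x]] blo_scale[OF blo_funpow[OF T] x]
        by (simp add: funpow_swap1)
      then show "seq_scale z (seq_scale (1 / z ^ Suc i) ((T ^^ i) x)) - T (seq_scale (1 / z ^ Suc i) ((T ^^ i) x))
        = seq_scale (1 / z ^ Suc i) ((T ^^ i) (seq_scale z x - T x))"
        unfolding blo_scale[OF T TL] by (simp add: seq_scale_diff_right mult.commute)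
    qed
    also have "\<dots> = x - seq_scale (1 / z ^ n) ((T ^^ n) x)" using 1[OF x] by (simp only: resolvent_sum_def)
    finally show ?thesis .
  qed
qed

text \<open>If the \<open>n\<close>-th power of \<open>T / z\<close> has essential norm below 1,
  some tail \<open>V\<close> of it has norm below 1, and \<open>id - V\<close> is inverted by a
  Neumann series \<open>S\<close>. Modulo compact operators the truncated resolvent sum inverts
  \<open>z - T\<close> up to the factor \<open>id - V\<close>, which \<open>S\<close> removes. The
  shape of \<open>V\<close> and the series for \<open>S\<close> are exposed for the positivity
  argument.\<close>

lemma parametrix:
  assumes T: "blo T" and z: "z \<noteq> 0" and c: "pow_norm T n < cmod z ^ n"
  obtains S V N where "blo S" "V = (\<lambda>x. seq_scale (1 / z ^ n) (tail N ((T ^^ n) x)))"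
    "\<And>x. x \<in> L \<Longrightarrow> (\<lambda>m. nrm ((\<Sum>k<m. (V ^^ k) x) - S x)) \<longlonglongrightarrow> 0"
    "ess_eq (\<lambda>x. S (resolvent_sum z T n (seq_scale z x - T x))) (\<lambda>x. x)"
    "ess_eq (\<lambda>x. seq_scale z (S (resolvent_sum z T n x)) - T (S (resolvent_sum z T n x))) (\<lambda>x. x)"
proof -
  \<comment> \<open>A midpoint leaves strict room on both sides: above the essential norm to find a
    cutoff, below \<open>cmod z ^ n\<close> for a contraction.\<close>
  define d where "d = (pow_norm T n + cmod z ^ n) / 2"
  have "pow_norm T n \<ge> 0" unfolding pow_norm_def by (rule ess_norm_nonneg[OF blo_funpow[OF T]])
  with c have d: "pow_norm T n < d" "0 \<le> d" "d < cmod z ^ n" by (auto simp: d_def)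
  obtain N where N: "\<And>x. x \<in> L \<Longrightarrow> nrm (tail N ((T ^^ n) x)) \<le> d * nrm x"
    using ess_norm_lessD[OF blo_funpow[OF T], of n d] d(1) unfolding pow_norm_def by blast
  define V where "V = (\<lambda>x. seq_scale (1 / z ^ n) (tail N ((T ^^ n) x)))"
  have Tn: "blo (T ^^ n)" by (rule blo_funpow[OF T])
  have V: "blo V" unfolding V_def by (rule blo_scale_op[OF blo_comp[OF blo_tail Tn]])
  have q: "0 \<le> d / cmod z ^ n" "d / cmod z ^ n < 1" using d z by auto
  have Vq: "nrm (V x) \<le> d / cmod z ^ n * nrm x" if x: "x \<in> L" for x
  proof -
    have "nrm (V x) = 1 / cmod z ^ n * nrm (tail N ((T ^^ n) x))"
      unfolding V_def nrm_scale[OF tail_L[OF blo_L[OF Tn x]]] by (simp add: norm_divide norm_power)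
    also have "\<dots> \<le> 1 / cmod z ^ n * (d * nrm x)" using N[OF x] by (intro mult_left_mono) auto
    finally show ?thesis by simp
  qed
  obtain S where S: "blo S" "\<And>x. x \<in> L \<Longrightarrow> S x - V (S x) = x" "\<And>x. x \<in> L \<Longrightarrow> S (x - V x) = x"
    "\<And>x. x \<in> L \<Longrightarrow> (\<lambda>n. nrm ((\<Sum>k<n. (V ^^ k) x) - S x)) \<longlonglongrightarrow> 0"
    using Neumann_series[OF V q Vq] by blast
  let ?F = "resolvent_sum z T n" and ?X = "\<lambda>x. seq_scale z x - T x"
  let ?W = "\<lambda>x. x - seq_scale (1 / z ^ n) ((T ^^ n) x)"
  have F: "blo ?F" by (rule resolvent_sum(1)[OF T z])
  have X: "blo ?X" by (rule blo_diff_op[OF blo_scale_op[OF blo_id] T])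
  have WV: "ess_eq ?W (\<lambda>x. x - V x)"
    unfolding V_def
    by (rule ess_eq_diff[OF ess_eq_refl[OF blo_id] ess_eq_scale[OF ess_eq_sym[OF ess_eq_tail[OF Tn]]]])
  have FX: "ess_eq (\<lambda>x. ?F (?X x)) ?W"
    by (rule ess_eq_on_L[OF blo_comp[OF F X]]) (rule resolvent_sum(2)[OF T z, symmetric])
  have XF: "ess_eq (\<lambda>x. ?X (?F x)) ?W"
    by (rule ess_eq_on_L[OF blo_comp[OF X F]]) (rule resolvent_sum(3)[OF T z, symmetric])
  have iV: "blo (\<lambda>x. x - V x)" by (rule blo_diff_op[OF blo_id V])
  have L1: "ess_eq (\<lambda>x. S (?F (?X x))) (\<lambda>x. x)"
  proof -
    have "ess_eq (\<lambda>x. S (?F (?X x))) (\<lambda>x. S (x - V x))"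
      by (rule ess_eq_comp[OF ess_eq_refl[OF S(1)] ess_eq_trans[OF FX WV]])
    also have "ess_eq (\<lambda>x. S (x - V x)) (\<lambda>x. x)"
      by (rule ess_eq_on_L[OF blo_comp[OF S(1) iV]]) (rule S(3)[symmetric])
    finally show ?thesis .
  qed
  have R1: "ess_eq (\<lambda>x. ?X (?F (S x))) (\<lambda>x. x)"
  proof -
    have "ess_eq (\<lambda>x. ?X (?F (S x))) (\<lambda>x. S x - V (S x))"
      by (rule ess_eq_comp[OF ess_eq_trans[OF XF WV] ess_eq_refl[OF S(1)]])
    also have "ess_eq (\<lambda>x. S x - V (S x)) (\<lambda>x. x)"
      by (rule ess_eq_on_L[OF blo_comp[OF iV S(1)]]) (rule S(2)[symmetric])
    finally show ?thesis .
  qed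
  have SF: "blo (\<lambda>x. S (?F x))" and FS: "blo (\<lambda>x. ?F (S x))"
    by (rule blo_comp[OF S(1) F], rule blo_comp[OF F S(1)])
  \<comment> \<open>A left inverse and a right inverse agree modulo compact operators, so the left
    inverse \<open>S\<close> after \<open>?F\<close> is two-sided.\<close>
  have GG: "ess_eq (\<lambda>x. S (?F x)) (\<lambda>x. ?F (S x))"
    using ess_eq_trans[OF ess_eq_sym[OF ess_eq_comp[OF ess_eq_refl[OF SF] R1]]
        ess_eq_comp[OF L1 ess_eq_refl[OF FS]]] .
  have R2: "ess_eq (\<lambda>x. ?X (S (?F x))) (\<lambda>x. x)"
    by (rule ess_eq_trans[OF ess_eq_comp[OF ess_eq_refl[OF X] GG] R1])
  show thesis by (rule that[OF S(1) V_def S(4) L1 R2])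
qed

lemma root_lim_less_imp_pow_less:
  assumes T: "blo T" and l: "root_lim (pow_norm T) < l"
  shows "\<forall>\<^sub>F n in sequentially. pow_norm T n < l ^ n"
proof -
  interpret submult_seq "pow_norm T" by (rule submult_pow_norm[OF T])
  have l0: "l > 0" using l root_lim_nonneg by linarith
  have "\<forall>\<^sub>F n in sequentially. pow_norm T n powr (1 / real n) < l"
    by (rule order_tendstoD(2)[OF root_lim_tendsto l])
  then show ?thesis using eventually_ge_at_top[of 1]
  proof eventually_elim
    case (elim n)
    have "pow_norm T n = (pow_norm T n powr (1 / real n)) ^ n"
      using elim(2) nonneg[of n] by (cases "pow_norm T n = 0") (simp_all add: powr_power)
    also have "\<dots> < l ^ n" using elim by (intro power_strict_mono) auto
    finally show ?case .
  qed
qed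

text \<open>The easy half of the spectral radius formula: beyond the limit of the roots some power
  satisfies the hypothesis of \<open>parametrix\<close>.\<close>

lemma ess_spectrum_bound:
  assumes T: "blo T" and z: "z \<in> ess_spectrum L nrm T"
  shows "cmod z \<le> root_lim (pow_norm T)"
proof (rule ccontr)
  assume "\<not> ?thesis"
  then have l: "root_lim (pow_norm T) < cmod z" by simp
  interpret submult_seq "pow_norm T" by (rule submult_pow_norm[OF T])
  have z0: "z \<noteq> 0" using l root_lim_nonneg by auto
  obtain n where "pow_norm T n < cmod z ^ n"
    using eventually_happens[OF root_lim_less_imp_pow_less[OF T l]] by auto
  then obtain S V N where S: "blo S"
    "ess_eq (\<lambda>x. S (resolvent_sum z T n (seq_scale z x - T x))) (\<lambda>x. x)"
    "ess_eq (\<lambda>x. seq_scale z (S (resolvent_sum z T n x)) - T (S (resolvent_sum z T n x))) (\<lambda>x. x)"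
    by (rule parametrix[OF T z0])
  have "z \<notin> ess_spectrum L nrm T"
    unfolding not_ess_spectrum_iff[OF T]
    by (rule exI[of _ "\<lambda>x. S (resolvent_sum z T n x)"])
      (intro conjI S blo_comp[OF S(1) resolvent_sum(1)[OF T z0]])
  with z show False by contradiction
qed

text \<open>The domination of \<open>abs_seq (T x)\<close> is a clause of its own: for a nonnegative
  matrix it is the triangle inequality along each row, and it is the form in which
  \<open>ess_norm_mono\<close> compares operators.\<close>

definition pos_op :: "seqop \<Rightarrow> bool" where
  "pos_op T \<longleftrightarrow> blo T \<and> (\<forall>x\<in>L. 0 \<le> x \<longrightarrow> 0 \<le> T x) \<and> (\<forall>x\<in>L. abs_seq (T x) \<le> T (abs_seq x))"

lemma pos_opD:
  assumes "pos_op T"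
  shows "blo T" "x \<in> L \<Longrightarrow> 0 \<le> x \<Longrightarrow> 0 \<le> T x" "x \<in> L \<Longrightarrow> abs_seq (T x) \<le> T (abs_seq x)"
  using assms by (auto simp: pos_op_def)

lemma pos_op_mono: assumes T: "pos_op T" and "x \<in> L" "y \<in> L" "x \<le> y" shows "T x \<le> T y"
proof -
  have "0 \<le> T (y - x)" using assms by (intro pos_opD(2)[OF T] L_diff) simp_all
  then show ?thesis by (simp add: blo_diff[OF pos_opD(1)[OF T]] assms)
qed

lemma pos_op_comp: assumes T: "pos_op T" and U: "pos_op U" shows "pos_op (\<lambda>x. T (U x))"
  unfolding pos_op_def
proof (intro conjI ballI impI)
  show "blo (\<lambda>x. T (U x))" by (rule blo_comp[OF pos_opD(1)[OF T] pos_opD(1)[OF U]])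
  have UL: "U x \<in> L" if "x \<in> L" for x by (rule blo_L[OF pos_opD(1)[OF U] that])
  fix x assume x: "x \<in> L"
  show "0 \<le> T (U x)" if "0 \<le> x" by (rule pos_opD(2)[OF T UL[OF x] pos_opD(2)[OF U x that]])
  have "abs_seq (T (U x)) \<le> T (abs_seq (U x))" by (rule pos_opD(3)[OF T UL[OF x]])
  also have "\<dots> \<le> T (U (abs_seq x))"
    by (rule pos_op_mono[OF T abs_seq_L[OF UL[OF x]] UL[OF abs_seq_L[OF x]] pos_opD(3)[OF U x]])
  finally show "abs_seq (T (U x)) \<le> T (U (abs_seq x))" .
qed

lemma pos_op_funpow: assumes T: "pos_op T" shows "pos_op (T ^^ n)"
proof (induction n)
  case 0
  show ?case using blo_id by (simp add: pos_op_def id_def)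
next
  case (Suc n)
  show ?case using pos_op_comp[OF T Suc] by (simp add: comp_def)
qed

text \<open>Solidity turns the domination into an inequality for every tail. Only values of
  \<open>U\<close> at moduli enter, which suits the later use with a composed parametrix as
  \<open>U\<close>.\<close>

lemma ess_norm_mono:
  assumes T: "blo T" and U: "blo U" and TU: "\<And>x. x \<in> L \<Longrightarrow> abs_seq (T x) \<le> U (abs_seq x)"
  shows "ess_norm T \<le> ess_norm U"
proof (rule dense_ge)
  fix c assume c: "ess_norm U < c"
  obtain N where N: "\<And>x. x \<in> L \<Longrightarrow> nrm (tail N (U x)) \<le> c * nrm x" using ess_norm_lessD[OF U c] by blast
  show "ess_norm T \<le> c"
  proof (rule ess_norm_le[of _ N])
    show "0 \<le> c" using c ess_norm_nonneg[OF U] by linarith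
    fix x assume x: "x \<in> L"
    have "cmod (T x i) \<le> cmod (U (abs_seq x) i)" for i
      using TU[OF x] by (intro cmod_le_of_le) (simp add: le_fun_def abs_seq_def[of "T x"])
    then have "nrm (tail N (T x)) \<le> nrm (tail N (U (abs_seq x)))"
      by (intro L_solid(2)[OF tail_L[OF blo_L[OF U abs_seq_L[OF x]]]]) (simp add: tail_def)
    also have "\<dots> \<le> c * nrm (abs_seq x)" by (rule N[OF abs_seq_L[OF x]])
    finally show "nrm (tail N (T x)) \<le> c * nrm x" by (simp add: nrm_abs_seq x)
  qed
qed

text \<open>Partial sums of nonnegative terms dominate their zeroth term \<open>x\<close>, and the
  inequality passes to the limit in each coordinate.\<close>

lemma pos_Neumann_ge:
  assumes V: "blo V" "\<And>x. x \<in> L \<Longrightarrow> 0 \<le> x \<Longrightarrow> 0 \<le> V x" and S: "blo S"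
    and lim: "\<And>x. x \<in> L \<Longrightarrow> (\<lambda>m. nrm ((\<Sum>k<m. (V ^^ k) x) - S x)) \<longlonglongrightarrow> 0"
    and x: "x \<in> L" "0 \<le> x"
  shows "x \<le> S x"
proof (rule le_funI)
  fix i
  have VL: "(V ^^ k) x \<in> L" for k by (rule blo_L[OF blo_funpow[OF V(1)] x(1)])
  have V0: "0 \<le> (V ^^ k) x" for k
  proof (induction k)
    case 0
    show ?case by (simp only: funpow_0 x(2))
  next
    case (Suc k)
    show ?case by (simp only: funpow.simps comp_apply) (rule V(2)[OF VL Suc])
  qed
  \<comment> \<open>Sums below \<open>Suc m\<close> are nonempty and hence contain the term
    \<open>x\<close>.\<close>
  have "(\<Sum>k<Suc m. (V ^^ k) x) \<ge> x" for m
    unfolding sum.lessThan_Suc_shift using sum_nonneg[of "{..<m}" "\<lambda>k. (V ^^ Suc k) x"] V0[of "Suc _"]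
    by (simp del: funpow.simps(2))
  then have ge: "x i \<le> (\<Sum>k<Suc m. (V ^^ k) x) i" for m by (simp only: le_fun_def)
  have lim': "(\<lambda>m. (\<Sum>k<Suc m. (V ^^ k) x) i) \<longlonglongrightarrow> S x i"
    by (rule LIMSEQ_Suc) (rule nrm_limit_coord[OF L_sum[OF VL] blo_L[OF S x(1)] lim[OF x(1)]])
  \<comment> \<open>The complex order consists of an inequality of real parts and an equality of
    imaginary parts, so the two limits are taken separately.\<close>
  have "Re (x i) \<le> Re (S x i)"
    by (rule LIMSEQ_le_const[OF tendsto_Re[OF lim']]) (use ge in \<open>auto simp: less_eq_complex_def\<close>)
  moreover have "Im (x i) = Im (S x i)"
  proof (rule LIMSEQ_unique[OF _ tendsto_Im[OF lim']])
    have "Im ((\<Sum>k<Suc m. (V ^^ k) x) i) = Im (x i)" for m using ge[of m] by (simp only: less_eq_complex_def)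
    then show "(\<lambda>m. Im ((\<Sum>k<Suc m. (V ^^ k) x) i)) \<longlonglongrightarrow> Im (x i)" by simp
  qed
  ultimately show "x i \<le> S x i" by (simp add: less_eq_complex_def)
qed

text \<open>If \<open>\<nu>\<close> were not in the essential spectrum, the parametrices \<open>G\<close> at \<open>l > \<nu>\<close> would stay
  bounded as \<open>l\<close> decreases to \<open>\<nu>\<close>; as \<open>G \<circ> G\<close> dominates \<open>(i + 1) l\<^bsup>-i-2\<^esup> T\<^bsup>i\<^esup>\<close>, this makes
  \<open>\<nu>\<^bsup>-i\<^esup> \<parallel>T\<^bsup>i\<^esup>\<parallel>\<close> tend to 0, contradicting submultiplicativity.\<close>
lemma pos_op_pow_norm_bound:
  assumes T: "pos_op T" and \<nu>: "root_lim (pow_norm T) = \<nu>" "\<nu> > 0"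
    and G0: "blo G0" "ess_eq (\<lambda>x. seq_scale (complex_of_real \<nu>) (G0 x) - T (G0 x)) (\<lambda>x. x)"
    and l: "l > \<nu>" "(l - \<nu>) * ess_norm G0 \<le> 1 / 2"
  shows "real (Suc i) * pow_norm T i \<le> l ^ (i + 2) * (2 * ess_norm G0)\<^sup>2"
proof -
  note Tb = pos_opD(1)[OF T]
  have l0: "l > 0" using l \<nu> by simp
  define z where "z = complex_of_real l"
  have z: "z \<noteq> 0" "cmod z = l" using l0 by (auto simp: z_def)
  have "\<forall>\<^sub>F n in sequentially. pow_norm T n < l ^ n"
    by (rule root_lim_less_imp_pow_less[OF Tb]) (simp add: \<nu> l)
  \<comment> \<open>\<open>n\<close> also has to exceed \<open>i\<close>, so that the truncated
    resolvent sum contains all powers up to the \<open>i\<close>-th.\<close>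
  with eventually_gt_at_top[of i] obtain n where n: "pow_norm T n < cmod z ^ n" "i < n"
    using eventually_happens'[OF sequentially_bot eventually_conj] z by (metis (no_types, lifting))
  obtain S V N where S: "blo S" "V = (\<lambda>x. seq_scale (1 / z ^ n) (tail N ((T ^^ n) x)))"
    "\<And>x. x \<in> L \<Longrightarrow> (\<lambda>m. nrm ((\<Sum>k<m. (V ^^ k) x) - S x)) \<longlonglongrightarrow> 0"
    "ess_eq (\<lambda>x. S (resolvent_sum z T n (seq_scale z x - T x))) (\<lambda>x. x)"
    by (rule parametrix[OF Tb z(1) n(1)]) (rule that)
  define F where "F = resolvent_sum z T n"
  have F: "blo F" unfolding F_def by (rule resolvent_sum(1)[OF Tb z(1)])
  define G where "G x = S (F x)" for x
  have G: "blo G" unfolding G_def[abs_def] by (rule blo_comp[OF S(1) F])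
  have GX: "ess_eq (\<lambda>x. G (seq_scale z x - T x)) (\<lambda>x. x)" using S(4) by (simp add: G_def F_def)
  have Xz: "blo (\<lambda>x. seq_scale z x - T x)" by (rule blo_diff_op[OF blo_scale_op[OF blo_id] Tb])
  let ?d = "complex_of_real (l - \<nu>)"
  let ?g = "ess_norm G0"
  have g0: "?g \<ge> 0" by (rule ess_norm_nonneg[OF G0(1)])
  have GG0: "blo (\<lambda>x. G (G0 x))" by (rule blo_comp[OF G G0(1)])
  \<comment> \<open>The resolvent identity modulo compact operators: \<open>G\<close> equals
    \<open>G0 - (l - \<nu>) G G0\<close>. The smallness of \<open>l - \<nu>\<close> makes the last
    term at most half the essential norm of \<open>G\<close>, which is absorbed on the left.\<close>
  have "ess_norm G \<le> 2 * ?g"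
  proof -
    let ?Y = "\<lambda>x. seq_scale (complex_of_real \<nu>) (G0 x) - T (G0 x)"
    have "ess_eq G (\<lambda>x. G (?Y x))" by (rule ess_eq_comp[OF ess_eq_refl[OF G] ess_eq_sym[OF G0(2)]])
    also have "ess_eq (\<lambda>x. G (?Y x)) (\<lambda>x. G (seq_scale z (G0 x) - T (G0 x)) - seq_scale ?d (G (G0 x)))"
    proof (rule ess_eq_on_L[OF ess_eq_blo(2)[OF calculation]])
      fix x assume "x \<in> L"
      then have g: "G0 x \<in> L" by (rule blo_L[OF G0(1)])
      have "?Y x = (seq_scale z (G0 x) - T (G0 x)) - seq_scale ?d (G0 x)"
        by (rule ext) (simp add: z_def algebra_simps)
      then show "G (seq_scale z (G0 x) - T (G0 x)) - seq_scale ?d (G (G0 x)) = G (?Y x)"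
        using blo_diff[OF G blo_L[OF Xz g] L_scale[OF g]] blo_scale[OF G g] by metis
    qed
    also have "ess_eq (\<lambda>x. G (seq_scale z (G0 x) - T (G0 x)) - seq_scale ?d (G (G0 x)))
        (\<lambda>x. G0 x - seq_scale ?d (G (G0 x)))"
      by (rule ess_eq_diff[OF ess_eq_comp[OF GX ess_eq_refl[OF G0(1)]] ess_eq_refl[OF blo_scale_op[OF GG0]]])
    finally have "ess_norm G \<le> ess_norm (\<lambda>x. G0 x - seq_scale ?d (G (G0 x)))" by (rule ess_eq_norm_le)
    also have "\<dots> \<le> ?g + ess_norm (\<lambda>x. seq_scale ?d (G (G0 x)))"
      by (rule ess_norm_diff[OF G0(1) blo_scale_op[OF GG0]])
    also have "ess_norm (\<lambda>x. seq_scale ?d (G (G0 x))) \<le> cmod ?d * (ess_norm G * ?g)"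
      using ess_norm_scale_le[OF GG0, of ?d] mult_left_mono[OF ess_norm_comp[OF G G0(1)], of "cmod ?d"]
      by (rule order_trans) simp
    also have "cmod ?d = l - \<nu>" using l(1) by (simp only: norm_of_real)
    also have "(l - \<nu>) * (ess_norm G * ?g) = ((l - \<nu>) * ?g) * ess_norm G" by simp
    also have "\<dots> \<le> 1 / 2 * ess_norm G" by (rule mult_right_mono[OF l(2) ess_norm_nonneg[OF G]])
    finally show ?thesis by simp
  qed
  note G2 = this
  have one: "1 / z ^ k = complex_of_real (1 / l ^ k)" for k by (simp add: z_def)
  have Tk: "pos_op (T ^^ k)" for k by (rule pos_op_funpow[OF T])
  have TL: "(T ^^ k) w \<in> L" if "w \<in> L" for k w by (rule blo_L[OF pos_opD(1)[OF Tk] that])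
  have Vpos: "0 \<le> V x" if "x \<in> L" "0 \<le> x" for x
    unfolding S(2) one using l0 by (intro seq_scale_nonneg tail_nonneg pos_opD(2)[OF Tk that]) simp
  have Vb: "blo V" unfolding S(2) by (rule blo_scale_op[OF blo_comp[OF blo_tail pos_opD(1)[OF Tk]]])
  have term_pos: "0 \<le> seq_scale (1 / z ^ Suc a) ((T ^^ a) w)" if "w \<in> L" "0 \<le> w" for a w
    unfolding one using l0 by (intro seq_scale_nonneg pos_opD(2)[OF Tk that]) simp
  have Fge: "(\<Sum>a\<in>A. seq_scale (1 / z ^ Suc a) ((T ^^ a) w)) \<le> F w" if "A \<subseteq> {..i}" "w \<in> L" "0 \<le> w" for A w
    unfolding F_def resolvent_sum_def
    by (rule sum_mono2) (use that n(2) term_pos in \<open>auto dest!: subsetD[OF that(1)] simp del: power_Suc\<close>)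
  have Ggeq: "F w \<le> G w" if w: "w \<in> L" "0 \<le> w" for w
  proof -
    have "0 \<le> F w" using Fge[of "{}" w] w by simp
    then show ?thesis unfolding G_def
      using pos_Neumann_ge[OF Vb Vpos S(1) S(3) blo_L[OF F w(1)]] by blast
  qed
  have GG: "seq_scale (complex_of_real (real (Suc i) / l ^ (i + 2))) ((T ^^ i) w) \<le> G (G w)"
    if w: "w \<in> L" "0 \<le> w" for w
  proof -
    have Gw: "G w \<in> L" by (rule blo_L[OF G w(1)])
    have "0 \<le> F w" using Fge[of "{}" w] w by simp
    then have Gw0: "0 \<le> G w" using Ggeq[OF w] by (rule order_trans)
    \<comment> \<open>Pair the \<open>a\<close>-th term of the outer sum with the
      \<open>b\<close>-th term of the inner one, where \<open>a + b = i\<close>. The exponents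
      \<open>a + 1\<close> and \<open>b + 1\<close> of \<open>1 / l\<close> add up to
      \<open>i + 2\<close>, and the \<open>i + 1\<close> choices of \<open>a\<close> produce the
      factor \<open>Suc i\<close>.\<close>
    have "seq_scale (complex_of_real (1 / l ^ (i + 2))) ((T ^^ i) w)
        \<le> seq_scale (1 / z ^ Suc a) ((T ^^ a) (G w))" if a: "a \<le> i" for a
    proof -
      let ?b = "i - a"
      have sL: "seq_scale (1 / z ^ Suc ?b) ((T ^^ ?b) w) \<in> L" by (rule L_scale[OF TL[OF w(1)]])
      have "seq_scale (1 / z ^ Suc ?b) ((T ^^ ?b) w) \<le> G w"
        using order_trans[OF Fge[of "{?b}" w] Ggeq[OF w]] w by simp
      then have "(T ^^ a) (seq_scale (1 / z ^ Suc ?b) ((T ^^ ?b) w)) \<le> (T ^^ a) (G w)"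
        by (rule pos_op_mono[OF Tk sL Gw])
      then have "seq_scale (1 / z ^ Suc a) ((T ^^ a) (seq_scale (1 / z ^ Suc ?b) ((T ^^ ?b) w)))
          \<le> seq_scale (1 / z ^ Suc a) ((T ^^ a) (G w))"
        unfolding one using l0 by (intro seq_scale_mono) simp
      moreover have "(T ^^ a) (seq_scale (1 / z ^ Suc ?b) ((T ^^ ?b) w)) = seq_scale (1 / z ^ Suc ?b) ((T ^^ i) w)"
      proof -
        have "(T ^^ a) ((T ^^ ?b) w) = (T ^^ i) w" using a funpow_add[of a ?b T] by simp
        then show ?thesis unfolding blo_scale[OF pos_opD(1)[OF Tk] TL[OF w(1)]] by simp
      qed
      moreover have "1 / z ^ Suc a * (1 / z ^ Suc ?b) = complex_of_real (1 / l ^ (i + 2))"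
      proof -
        have "z ^ Suc a * z ^ Suc ?b = z ^ (i + 2)" using a by (simp flip: power_add del: power_Suc)
        then show ?thesis by (simp add: z_def del: power_Suc)
      qed
      ultimately show ?thesis by simp
    qed
    then have "(\<Sum>a\<le>i. seq_scale (complex_of_real (1 / l ^ (i + 2))) ((T ^^ i) w))
        \<le> (\<Sum>a\<le>i. seq_scale (1 / z ^ Suc a) ((T ^^ a) (G w)))"
      by (intro sum_mono) simp
    also have "\<dots> \<le> F (G w)" by (rule Fge[OF order_refl Gw Gw0])
    also have "\<dots> \<le> G (G w)" by (rule Ggeq[OF Gw Gw0])
    also have "(\<Sum>a\<le>i. seq_scale (complex_of_real (1 / l ^ (i + 2))) ((T ^^ i) w))
        = seq_scale (complex_of_real (real (Suc i) / l ^ (i + 2))) ((T ^^ i) w)"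
      by (rule ext) (simp add: sum_seq_apply)
    finally show ?thesis .
  qed
  let ?k = "real (Suc i) / l ^ (i + 2)"
  have k0: "?k > 0" using l0 by simp
  note Ti = pos_opD(1)[OF Tk[of i]]
  have "ess_norm (\<lambda>x. seq_scale (complex_of_real ?k) ((T ^^ i) x)) \<le> ess_norm (\<lambda>x. G (G x))"
  proof (rule ess_norm_mono[OF blo_scale_op[OF Ti] blo_comp[OF G G]])
    fix x assume x: "x \<in> L"
    have "abs_seq (seq_scale (complex_of_real ?k) ((T ^^ i) x)) = seq_scale (complex_of_real ?k) (abs_seq ((T ^^ i) x))"
      unfolding abs_seq_scale using k0 by (simp only: norm_of_real abs_of_pos)
    also have "\<dots> \<le> seq_scale (complex_of_real ?k) ((T ^^ i) (abs_seq x))"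
      by (rule seq_scale_mono[OF less_imp_le[OF k0] pos_opD(3)[OF Tk x]])
    also have "\<dots> \<le> G (G (abs_seq x))" by (rule GG[OF abs_seq_L[OF x] abs_seq_nonneg])
    finally show "abs_seq (seq_scale (complex_of_real ?k) ((T ^^ i) x)) \<le> G (G (abs_seq x))" .
  qed
  also have "\<dots> \<le> ess_norm G * ess_norm G" by (rule ess_norm_comp[OF G G])
  also have "\<dots> \<le> (2 * ?g)\<^sup>2"
    unfolding power2_eq_square using G2 g0 ess_norm_nonneg[OF G] by (intro mult_mono) auto
  finally have le: "ess_norm (\<lambda>x. seq_scale (complex_of_real ?k) ((T ^^ i) x)) \<le> (2 * ?g)\<^sup>2" .
  have "pow_norm T i = ess_norm (\<lambda>x. seq_scale (complex_of_real (1 / ?k)) (seq_scale (complex_of_real ?k) ((T ^^ i) x)))"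
    unfolding pow_norm_def by (intro ess_norm_cong seq_scale_cancel[symmetric] less_imp_neq[OF k0, symmetric])
  also have "\<dots> \<le> cmod (complex_of_real (1 / ?k)) * ess_norm (\<lambda>x. seq_scale (complex_of_real ?k) ((T ^^ i) x))"
    by (rule ess_norm_scale_le[OF blo_scale_op[OF Ti]])
  also have "\<dots> \<le> 1 / ?k * (2 * ?g)\<^sup>2"
    using k0 by (simp only: norm_of_real abs_of_pos zero_less_divide_1_iff) (intro mult_left_mono le, use l0 in simp)
  finally show ?thesis using l0 by (simp add: field_simps)
qed

text \<open>If \<open>\<nu>\<close> were outside the essential spectrum, letting \<open>l\<close>
  decrease to \<open>\<nu>\<close> in \<open>pos_op_pow_norm_bound\<close> and bounding
  \<open>pow_norm T i\<close> below by \<open>\<nu> ^ i\<close> would leave \<open>i + 1\<close>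
  bounded in \<open>i\<close>. Thus the supremum in \<open>ess_rad\<close> is attained at
  \<open>\<nu>\<close>.\<close>

theorem ess_rad_pos_op:
  assumes T: "pos_op T" shows "ess_rad L nrm T = root_lim (pow_norm T)"
proof -
  note Tb = pos_opD(1)[OF T]
  interpret submult_seq "pow_norm T" by (rule submult_pow_norm[OF Tb])
  define \<nu> where "\<nu> = root_lim (pow_norm T)"
  let ?M = "{cmod z | z. z \<in> ess_spectrum L nrm T} \<union> {0}"
  have ub: "y \<le> \<nu>" if "y \<in> ?M" for y
    using that ess_spectrum_bound[OF Tb] root_lim_nonneg by (auto simp: \<nu>_def)
  have "\<nu> \<in> ?M"
  \<comment> \<open>For \<open>\<nu> = 0\<close> the element 0 adjoined in \<open>ess_rad\<close> is
    the maximum.\<close>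
  proof (cases "\<nu> = 0")
    case False
    then have \<nu>: "\<nu> > 0" using root_lim_nonneg unfolding \<nu>_def by simp
    have "complex_of_real \<nu> \<in> ess_spectrum L nrm T"
    proof (rule ccontr)
      assume "complex_of_real \<nu> \<notin> ess_spectrum L nrm T"
      then obtain G0 where G0: "blo G0" "ess_eq (\<lambda>x. seq_scale (complex_of_real \<nu>) (G0 x) - T (G0 x)) (\<lambda>x. x)"
        unfolding not_ess_spectrum_iff[OF Tb] by blast
      define g where "g = ess_norm G0"
      have g0: "g \<ge> 0" unfolding g_def by (rule ess_norm_nonneg[OF G0(1)])
      have "real (Suc i) * \<nu> ^ i \<le> \<nu> ^ (i + 2) * (2 * g)\<^sup>2" if i: "i \<ge> 1" for i
      proof (rule tendsto_lowerbound)
        show "((\<lambda>l. l ^ (i + 2) * (2 * g)\<^sup>2) \<longlongrightarrow> \<nu> ^ (i + 2) * (2 * g)\<^sup>2) (at_right \<nu>)"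
          by (intro tendsto_intros)
        \<comment> \<open>The width of this interval ensures
          \<open>(l - \<nu>) * g \<le> 1 / 2\<close>; \<open>g + 1\<close> in place of
          \<open>g\<close> avoids division by 0.\<close>
        have "real (Suc i) * \<nu> ^ i \<le> l ^ (i + 2) * (2 * g)\<^sup>2" if l: "l > \<nu>" "l < \<nu> + 1 / (2 * (g + 1))" for l
        proof -
          have "(l - \<nu>) * g \<le> 1 / (2 * (g + 1)) * (g + 1)" using l g0 by (intro mult_mono) auto
          also have "\<dots> = 1 / 2" using g0 by (simp add: add_nonneg_eq_0_iff)
          finally have "real (Suc i) * pow_norm T i \<le> l ^ (i + 2) * (2 * g)\<^sup>2"
            unfolding g_def by (intro pos_op_pow_norm_bound[OF T \<nu>_def[symmetric] \<nu> G0 l(1)])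
          moreover have "real (Suc i) * \<nu> ^ i \<le> real (Suc i) * pow_norm T i"
            unfolding \<nu>_def by (intro mult_left_mono root_lim_pow_le i) simp
          ultimately show ?thesis by linarith
        qed
        moreover have "\<nu> < \<nu> + 1 / (2 * (g + 1))" using g0 by simp
        ultimately show "\<forall>\<^sub>F l in at_right \<nu>. real (Suc i) * \<nu> ^ i \<le> l ^ (i + 2) * (2 * g)\<^sup>2"
          unfolding eventually_at_right_field by blast
      qed simp
      then have "real (Suc i) * \<nu> ^ i \<le> (\<nu>\<^sup>2 * (2 * g)\<^sup>2) * \<nu> ^ i" if "i \<ge> 1" for i
        using that by (simp add: power_add power2_eq_square mult_ac)
      then have le: "real (Suc i) \<le> \<nu>\<^sup>2 * (2 * g)\<^sup>2" if "i \<ge> 1" for i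
        using that \<nu> by (simp only: mult_le_cancel_right_pos zero_less_power)
      obtain k :: nat where "real k > \<nu>\<^sup>2 * (2 * g)\<^sup>2" using reals_Archimedean2 by blast
      with le[of "Suc k"] show False by simp
    qed
    then show ?thesis using \<nu> by force
  qed simp
  then have "Sup ?M = \<nu>" using ub by (intro cSup_eq_maximum) auto
  then show ?thesis by (simp add: ess_rad_def \<nu>_def)
qed

end

section \<open>Nonnegative matrices and Hadamard products\<close>

context oc_seq_space
begin

text \<open>The constant is explicit so that one \<open>C\<close> can serve a whole set of matrices
  and be multiplied along products.\<close>

definition mat_bd :: "real \<Rightarrow> mat \<Rightarrow> bool" where
  "mat_bd C A \<longleftrightarrow> nonneg_mat A \<and> defines_op R L A \<and> (\<forall>x\<in>L. nrm (mat_op R A x) \<le> C * nrm x)"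

lemma mat_bdD:
  assumes "mat_bd C A"
  shows "A i j \<ge> 0" "x \<in> L \<Longrightarrow> mat_op R A x \<in> L" "x \<in> L \<Longrightarrow> nrm (mat_op R A x) \<le> C * nrm x"
    "x \<in> L \<Longrightarrow> i \<in> R \<Longrightarrow> (\<lambda>j. A i j * cmod (x j)) summable_on R"
    "x \<in> L \<Longrightarrow> i \<in> R \<Longrightarrow> (\<lambda>j. complex_of_real (A i j) * x j) summable_on R"
proof -
  show A0: "A i j \<ge> 0" for i j using assms by (simp add: mat_bd_def nonneg_mat_def)
  show "x \<in> L \<Longrightarrow> mat_op R A x \<in> L" "x \<in> L \<Longrightarrow> nrm (mat_op R A x) \<le> C * nrm x"
    using assms by (auto simp: mat_bd_def defines_op_def)
  assume "x \<in> L" "i \<in> R"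
  then have *: "(\<lambda>j. norm (complex_of_real (A i j) * x j)) summable_on R"
    using assms by (auto simp: mat_bd_def defines_op_def)
  then show "(\<lambda>j. A i j * cmod (x j)) summable_on R" by (simp add: norm_mult A0)
  show "(\<lambda>j. complex_of_real (A i j) * x j) summable_on R" by (rule abs_summable_summable[OF *])
qed

lemma mat_op_apply: "i \<in> R \<Longrightarrow> mat_op R A x i = (\<Sum>\<^sub>\<infinity>j\<in>R. complex_of_real (A i j) * x j)"
  and mat_op_outside: "i \<notin> R \<Longrightarrow> mat_op R A x i = 0"
  by (simp_all add: mat_op_def)

lemma mat_op_abs_seq:
  assumes "mat_bd C A" "x \<in> L" "i \<in> R"
  shows "mat_op R A (abs_seq x) i = complex_of_real (\<Sum>\<^sub>\<infinity>j\<in>R. A i j * cmod (x j))"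
proof -
  have "((\<lambda>j. complex_of_real (A i j * cmod (x j))) has_sum complex_of_real (\<Sum>\<^sub>\<infinity>j\<in>R. A i j * cmod (x j))) R"
    by (rule has_sum_of_real) (rule has_sum_infsum[OF mat_bdD(4)[OF assms]])
  then show ?thesis using assms(3) by (simp add: mat_op_apply abs_seq_def infsumI)
qed

lemma blo_mat_op: assumes A: "mat_bd C A" shows "blo (mat_op R A)"
proof (rule bloI[of _ C])
  fix x assume x: "x \<in> L"
  show "mat_op R A (x + y) = mat_op R A x + mat_op R A y" if y: "y \<in> L" for y
  proof
    fix i show "mat_op R A (x + y) i = (mat_op R A x + mat_op R A y) i"
      using mat_bdD(5)[OF A x, of i] mat_bdD(5)[OF A y, of i]
      by (cases "i \<in> R") (simp_all add: mat_op_apply mat_op_outside distrib_left infsum_add)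
  qed
  show "mat_op R A (seq_scale c x) = seq_scale c (mat_op R A x)" for c
  proof
    fix i
    have "(\<Sum>\<^sub>\<infinity>j\<in>R. complex_of_real (A i j) * (c * x j)) = c * (\<Sum>\<^sub>\<infinity>j\<in>R. complex_of_real (A i j) * x j)"
      by (subst infsum_cmult_right'[symmetric]) (simp add: mult_ac)
    then show "mat_op R A (seq_scale c x) i = seq_scale c (mat_op R A x) i"
      by (cases "i \<in> R") (simp_all add: mat_op_apply mat_op_outside)
  qed
qed (rule mat_bdD[OF A], assumption)+

lemma pos_op_mat_op: assumes A: "mat_bd C A" shows "pos_op (mat_op R A)"
  unfolding pos_op_def
proof (intro conjI ballI impI)
  show "blo (mat_op R A)" by (rule blo_mat_op[OF A])
  fix x assume x: "x \<in> L"
  show "0 \<le> mat_op R A x" if "0 \<le> x"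
  proof (rule le_funI)
    fix i
    have "0 \<le> complex_of_real (A i j) * x j" for j
      using that mat_bdD(1)[OF A, of i j] by (simp add: le_fun_def less_eq_complex_def)
    then have "0 \<le> (\<Sum>\<^sub>\<infinity>j\<in>R. complex_of_real (A i j) * x j)" if "i \<in> R"
      by (intro infsum_nonneg_complex mat_bdD(5)[OF A x that])
    then show "0 i \<le> mat_op R A x i" by (cases "i \<in> R") (simp_all add: mat_op_apply mat_op_outside)
  qed
  show "abs_seq (mat_op R A x) \<le> mat_op R A (abs_seq x)"
  proof (rule le_funI)
    fix i
    have "cmod (mat_op R A x i) \<le> (\<Sum>\<^sub>\<infinity>j\<in>R. A i j * cmod (x j))" if i: "i \<in> R"
    proof -
      have "cmod (\<Sum>\<^sub>\<infinity>j\<in>R. complex_of_real (A i j) * x j) \<le> (\<Sum>\<^sub>\<infinity>j\<in>R. cmod (complex_of_real (A i j) * x j))"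
        by (rule norm_infsum_bound) (simp add: norm_mult mat_bdD(1)[OF A] mat_bdD(4)[OF A x i])
      then show ?thesis using i by (simp add: mat_op_apply norm_mult mat_bdD(1)[OF A])
    qed
    then show "abs_seq (mat_op R A x) i \<le> mat_op R A (abs_seq x) i"
      by (cases "i \<in> R") (simp_all add: mat_op_abs_seq[OF A x] mat_op_outside abs_seq_def[of "mat_op R A x"] less_eq_complex_def)
  qed
qed

lemma mat_op_unit_vec:
  assumes "i \<in> R" "l \<in> R" shows "mat_op R A (unit_vec l) i = complex_of_real (A i l)"
proof -
  have "(\<Sum>\<^sub>\<infinity>j\<in>R. complex_of_real (A i j) * unit_vec l j) = (\<Sum>\<^sub>\<infinity>j\<in>{l}. complex_of_real (A i j) * unit_vec l j)"
    by (rule infsum_cong_neutral) (use assms in \<open>auto simp: unit_vec_def\<close>)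
  then show ?thesis using assms by (simp add: mat_op_apply unit_vec_def)
qed

text \<open>Apply \<open>A\<close> to a unit vector, which has norm 1, and read off coordinate
  \<open>i\<close>. So a tail bound is also a bound for the entries, as the domination hypothesis of
  \<open>weighted_am_gm\<close> requires.\<close>

lemma tail_entry_bound:
  assumes A: "mat_bd C A" and t: "\<And>x. x \<in> L \<Longrightarrow> nrm (tail N (mat_op R A x)) \<le> t * nrm x"
    and i: "i \<in> R" "l \<in> R" "N \<le> i"
  shows "A i l \<le> t"
proof -
  have u: "mat_op R A (unit_vec l) \<in> L" by (rule mat_bdD(2)[OF A unit_vec_L[OF i(2)]])
  have "A i l = cmod (tail N (mat_op R A (unit_vec l)) i)"
    using i mat_bdD(1)[OF A] by (simp add: tail_def mat_op_unit_vec)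
  also have "\<dots> \<le> nrm (tail N (mat_op R A (unit_vec l)))" by (rule coord_le_nrm[OF tail_L[OF u]])
  also have "\<dots> \<le> t" using t[OF unit_vec_L[OF i(2)]] nrm_unit_vec[OF i(2)] by simp
  finally show ?thesis .
qed

text \<open>Along each row from \<open>N\<close> on, \<open>H\<close> applied to \<open>x\<close> is
  bounded by the combination of the \<open>A j\<close> applied to the modulus of \<open>x\<close>;
  solidity then transfers membership and norm. Restricting to these rows lets the lemma serve
  boundedness (\<open>N = 0\<close>) as well as essential norms.\<close>

lemma dominated:
  assumes fin: "finite J" and c: "\<And>j. j \<in> J \<Longrightarrow> c j \<ge> 0" and A: "\<And>j. j \<in> J \<Longrightarrow> mat_bd (D j) (A j)"
    and H: "nonneg_mat H" and le: "\<And>i l. i \<in> R \<Longrightarrow> l \<in> R \<Longrightarrow> N \<le> i \<Longrightarrow> H i l \<le> (\<Sum>j\<in>J. c j * A j i l)"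
    and t: "\<And>j x. j \<in> J \<Longrightarrow> x \<in> L \<Longrightarrow> nrm (tail N (mat_op R (A j) x)) \<le> t j * nrm x"
    and x: "x \<in> L"
  shows "i \<in> R \<Longrightarrow> N \<le> i \<Longrightarrow> (\<lambda>l. norm (complex_of_real (H i l) * x l)) summable_on R"
    and "tail N (mat_op R H x) \<in> L" and "nrm (tail N (mat_op R H x)) \<le> (\<Sum>j\<in>J. c j * t j) * nrm x"
proof -
  have H0: "H i l \<ge> 0" for i l using H by (simp add: nonneg_mat_def)
  define y where "y = (\<Sum>j\<in>J. seq_scale (complex_of_real (c j)) (tail N (mat_op R (A j) (abs_seq x))))"
  have ax: "abs_seq x \<in> L" by (rule abs_seq_L[OF x])
  have tL: "tail N (mat_op R (A j) (abs_seq x)) \<in> L" if "j \<in> J" for j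
    by (rule tail_L[OF mat_bdD(2)[OF A[OF that] ax]])
  have yL: "y \<in> L" unfolding y_def by (rule L_sum[OF L_scale[OF tL]])
  define s where "s i = (\<Sum>j\<in>J. c j * (\<Sum>\<^sub>\<infinity>l\<in>R. A j i l * cmod (x l)))" for i
  have row: "(\<lambda>l. norm (complex_of_real (H i l) * x l)) summable_on R \<and> cmod (mat_op R H x i) \<le> cmod (y i)"
    if i: "i \<in> R" "N \<le> i" for i
  proof -
    have hs: "((\<lambda>l. \<Sum>j\<in>J. c j * (A j i l * cmod (x l))) has_sum s i) R"
      unfolding s_def
      by (intro has_sum_sum fin has_sum_cmult_right has_sum_infsum mat_bdD(4)[OF A x i(1)])
    have bd: "norm (complex_of_real (H i l) * x l) \<le> (\<Sum>j\<in>J. c j * (A j i l * cmod (x l)))" if "l \<in> R" for l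
    proof -
      have "norm (complex_of_real (H i l) * x l) = H i l * cmod (x l)" by (simp add: norm_mult H0)
      also have "\<dots> \<le> (\<Sum>j\<in>J. c j * A j i l) * cmod (x l)" by (intro mult_right_mono le i that) simp
      also have "\<dots> = (\<Sum>j\<in>J. c j * (A j i l * cmod (x l)))" by (simp add: sum_distrib_right mult.assoc)
      finally show ?thesis .
    qed
    have sm: "(\<lambda>l. norm (complex_of_real (H i l) * x l)) summable_on R"
      by (rule Infinite_Sum.abs_summable_on_comparison_test'[OF has_sum_imp_summable[OF hs] bd])
    have "cmod (mat_op R H x i) \<le> (\<Sum>\<^sub>\<infinity>l\<in>R. norm (complex_of_real (H i l) * x l))"
      unfolding mat_op_apply[OF i(1)] by (rule norm_infsum_bound[OF sm])
    also have "\<dots> \<le> (\<Sum>\<^sub>\<infinity>l\<in>R. \<Sum>j\<in>J. c j * (A j i l * cmod (x l)))"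
      by (rule infsum_mono[OF sm has_sum_imp_summable[OF hs] bd])
    also have "\<dots> = s i" by (rule infsumI[OF hs])
    also have "s i \<le> cmod (y i)"
    proof -
      have "y i = complex_of_real (s i)"
        using i by (simp add: y_def sum_seq_apply tail_def s_def mat_op_abs_seq[OF A x i(1)])
      then show ?thesis by simp
    qed
    finally show ?thesis using sm by blast
  qed
  have le_y: "cmod (tail N (mat_op R H x) i) \<le> cmod (y i)" for i
    using row[of i] by (cases "i \<in> R \<and> N \<le> i") (auto simp: tail_def mat_op_outside)
  show "(\<lambda>l. norm (complex_of_real (H i l) * x l)) summable_on R" if "i \<in> R" "N \<le> i"
    using row[OF that] by blast
  show "tail N (mat_op R H x) \<in> L" by (rule L_solid(1)[OF yL le_y])
  have "nrm (tail N (mat_op R H x)) \<le> nrm y" by (rule L_solid(2)[OF yL le_y])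
  also have "\<dots> \<le> (\<Sum>j\<in>J. nrm (seq_scale (complex_of_real (c j)) (tail N (mat_op R (A j) (abs_seq x)))))"
    unfolding y_def by (rule nrm_sum[OF L_scale[OF tL]])
  also have "\<dots> \<le> (\<Sum>j\<in>J. c j * (t j * nrm x))"
  proof (rule sum_mono)
    fix j assume j: "j \<in> J"
    have "nrm (seq_scale (complex_of_real (c j)) (tail N (mat_op R (A j) (abs_seq x))))
        = c j * nrm (tail N (mat_op R (A j) (abs_seq x)))"
      using c[OF j] by (simp add: nrm_scale[OF tL[OF j]])
    also have "\<dots> \<le> c j * (t j * nrm x)"
      using t[OF j ax] c[OF j] by (intro mult_left_mono) (simp_all add: nrm_abs_seq x)
    finally show "nrm (seq_scale (complex_of_real (c j)) (tail N (mat_op R (A j) (abs_seq x)))) \<le> c j * (t j * nrm x)" .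
  qed
  finally show "nrm (tail N (mat_op R H x)) \<le> (\<Sum>j\<in>J. c j * t j) * nrm x"
    by (simp add: sum_distrib_right mult.assoc)
qed

lemma mat_bd_dominated:
  assumes "finite J" "\<And>j. j \<in> J \<Longrightarrow> c j \<ge> 0" and A: "\<And>j. j \<in> J \<Longrightarrow> mat_bd (t j) (A j)"
    and "nonneg_mat H" "\<And>i l. i \<in> R \<Longrightarrow> l \<in> R \<Longrightarrow> H i l \<le> (\<Sum>j\<in>J. c j * A j i l)"
  shows "mat_bd (\<Sum>j\<in>J. c j * t j) H"
  using dominated[of J c t A H 0 t] assms mat_bdD(3)[OF A]
  unfolding mat_bd_def[of "\<Sum>j\<in>J. c j * t j"] defines_op_def by simp

text \<open>Entries outside \<open>R \<times> R\<close> are junk: \<open>mat_op\<close> ignores them, and already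
  \<open>mat_mult R A id_mat\<close> differs from \<open>A\<close> there.\<close>
definition mat_le :: "mat \<Rightarrow> mat \<Rightarrow> bool" where
  "mat_le A B \<longleftrightarrow> (\<forall>i\<in>R. \<forall>j\<in>R. A i j \<le> B i j)"

lemma mat_le_refl: "mat_le A A"
  by (simp add: mat_le_def)

lemma mat_le_trans [trans]: "mat_le A B \<Longrightarrow> mat_le B C \<Longrightarrow> mat_le A C"
  unfolding mat_le_def by (meson order_trans)

lemma mat_bd_mono:
  assumes "mat_bd C B" "nonneg_mat A" "mat_le A B" shows "mat_bd C A"
  using mat_bd_dominated[of "{0::nat}" "\<lambda>_. 1" "\<lambda>_. C" "\<lambda>_. B" A] assms by (simp add: mat_le_def)

lemma mat_bd_weaken: "mat_bd C A \<Longrightarrow> C \<le> D \<Longrightarrow> mat_bd D A"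
  unfolding mat_bd_def by (meson mult_right_mono nrm_nonneg order_trans)

lemma mat_bd_sum:
  assumes "finite I" "\<And>i. i \<in> I \<Longrightarrow> mat_bd (C i) (F i)"
  shows "mat_bd (\<Sum>i\<in>I. C i) (\<lambda>a b. \<Sum>i\<in>I. F i a b)"
proof -
  have "nonneg_mat (\<lambda>a b. \<Sum>i\<in>I. F i a b)"
    using mat_bdD(1)[OF assms(2)] by (auto simp: nonneg_mat_def intro: sum_nonneg)
  then show ?thesis
    using mat_bd_dominated[OF assms(1), of "\<lambda>_. 1" C F "\<lambda>a b. \<Sum>i\<in>I. F i a b"] assms(2) by simp
qed

section \<open>The identity matrix and matrix products\<close>

lemma mat_bd_id: "mat_bd 1 id_mat" and mat_op_id: "x \<in> L \<Longrightarrow> mat_op R id_mat x = x"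
proof -
  have fs: "(\<lambda>j. norm (complex_of_real (id_mat i j) * x j)) summable_on R" for x i
    by (rule finite_nonzero_values_imp_summable_on, rule finite_subset[of _ "{i}"]) (auto simp: id_mat_def)
  show id: "mat_op R id_mat x = x" if x: "x \<in> L" for x
  proof
    fix i
    have "(\<Sum>\<^sub>\<infinity>j\<in>R. complex_of_real (id_mat i j) * x j) = (\<Sum>\<^sub>\<infinity>j\<in>{i}. complex_of_real (id_mat i j) * x j)" if "i \<in> R"
      by (rule infsum_cong_neutral) (use that in \<open>auto simp: id_mat_def\<close>)
    then show "mat_op R id_mat x i = x i"
      using L_outside[OF x, of i] by (cases "i \<in> R") (simp_all add: mat_op_apply mat_op_outside id_mat_def)
  qed
  show "mat_bd 1 id_mat"
    using id fs by (auto simp: mat_bd_def defines_op_def nonneg_mat_def) (simp add: id_mat_def)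
qed

text \<open>Column \<open>j\<close> of \<open>B\<close> is the image of a unit vector, hence an
  element of \<open>L\<close> to which row \<open>i\<close> of \<open>A\<close> may be
  applied.\<close>

lemma mat_mult_summable:
  assumes A: "mat_bd C A" and B: "mat_bd D B" and ij: "i \<in> R" "j \<in> R"
  shows "(\<lambda>l. A i l * B l j) summable_on R"
proof -
  have "(\<lambda>l. A i l * cmod (mat_op R B (unit_vec j) l)) summable_on R"
    by (rule mat_bdD(4)[OF A mat_bdD(2)[OF B unit_vec_L[OF ij(2)]] ij(1)])
  then show ?thesis
    by (rule summable_on_cong[THEN iffD1, rotated])
      (simp add: mat_op_unit_vec ij mat_bdD(1)[OF B])
qed

lemma
  assumes A: "mat_bd C A" and B: "mat_bd D B"
  shows mat_op_mult: "x \<in> L \<Longrightarrow> mat_op R (mat_mult R A B) x = mat_op R A (mat_op R B x)"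
    and mat_bd_mult: "C \<ge> 0 \<Longrightarrow> mat_bd (C * D) (mat_mult R A B)"
proof -
  note A0 = mat_bdD(1)[OF A] and B0 = mat_bdD(1)[OF B]
  have AB0: "mat_mult R A B i j \<ge> 0" for i j
    unfolding mat_mult_def by (intro infsum_nonneg mult_nonneg_nonneg A0 B0)
  have main: "(\<lambda>j. norm (complex_of_real (mat_mult R A B i j) * x j)) summable_on R
      \<and> mat_op R (mat_mult R A B) x i = mat_op R A (mat_op R B x) i" if x: "x \<in> L" and i: "i \<in> R" for x i
  proof -
    define f where "f l j = complex_of_real (A i l) * (complex_of_real (B l j) * x j)" for l j
    have nf: "norm (f l j) = A i l * (B l j * cmod (x j))" for l j
      by (simp add: f_def norm_mult A0 B0)
    \<comment> \<open>Fubini needs absolute summability over both indices: the inner sums are the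
      coordinates of \<open>B\<close> applied to the modulus of \<open>x\<close>, an element of
      \<open>L\<close>, so row \<open>i\<close> of \<open>A\<close> sums them absolutely.\<close>
    have sm: "(\<lambda>p. norm (case p of (l, j) \<Rightarrow> f l j)) summable_on (R \<times> R)"
      unfolding Infinite_Sum.abs_summable_on_Sigma_iff
    proof (intro conjI ballI)
      fix l assume l: "l \<in> R"
      show "(\<lambda>j. norm (case (l, j) of (l, j) \<Rightarrow> f l j)) summable_on R"
        by (simp add: nf) (intro summable_on_cmult_right mat_bdD(4)[OF B x l])
    next
      have "(\<Sum>\<^sub>\<infinity>j\<in>R. norm (f l j)) = A i l * cmod (mat_op R B (abs_seq x) l)" if l: "l \<in> R" for l
      proof -
        have "0 \<le> (\<Sum>\<^sub>\<infinity>j\<in>R. B l j * cmod (x j))" by (intro infsum_nonneg mult_nonneg_nonneg B0) simp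
        then show ?thesis by (simp add: nf infsum_cmult_right' mat_op_abs_seq[OF B x l])
      qed
      then have "(\<lambda>l. \<Sum>\<^sub>\<infinity>j\<in>R. norm (f l j)) summable_on R \<longleftrightarrow>
          (\<lambda>l. A i l * cmod (mat_op R B (abs_seq x) l)) summable_on R"
        by (rule summable_on_cong)
      then have "(\<lambda>l. \<Sum>\<^sub>\<infinity>j\<in>R. norm (f l j)) summable_on R"
        using mat_bdD(4)[OF A mat_bdD(2)[OF B abs_seq_L[OF x]] i] by blast
      then show "(\<lambda>l. norm (\<Sum>\<^sub>\<infinity>j\<in>R. norm (case (l, j) of (l, j) \<Rightarrow> f l j))) summable_on R"
        by (simp add: infsum_nonneg)
    qed
    have sm': "(\<lambda>p. norm (case p of (j, l) \<Rightarrow> f l j)) summable_on (R \<times> R)"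
      using sm by (subst (asm) summable_on_swap) (simp add: case_prod_unfold)
    have col: "(\<Sum>\<^sub>\<infinity>l\<in>R. norm (f l j)) = norm (complex_of_real (mat_mult R A B i j) * x j)"
      and col': "(\<Sum>\<^sub>\<infinity>l\<in>R. f l j) = complex_of_real (mat_mult R A B i j) * x j" if j: "j \<in> R" for j
    proof -
      have hs: "((\<lambda>l. A i l * B l j) has_sum mat_mult R A B i j) R"
        unfolding mat_mult_def by (rule has_sum_infsum[OF mat_mult_summable[OF A B i j]])
      have "((\<lambda>l. complex_of_real (A i l * B l j) * x j) has_sum complex_of_real (mat_mult R A B i j) * x j) R"
        by (intro has_sum_cmult_left has_sum_of_real hs)
      then show "(\<Sum>\<^sub>\<infinity>l\<in>R. f l j) = complex_of_real (mat_mult R A B i j) * x j"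
        by (intro infsumI) (simp add: f_def mult_ac)
      have "((\<lambda>l. (A i l * B l j) * cmod (x j)) has_sum mat_mult R A B i j * cmod (x j)) R"
        by (intro has_sum_cmult_left hs)
      then show "(\<Sum>\<^sub>\<infinity>l\<in>R. norm (f l j)) = norm (complex_of_real (mat_mult R A B i j) * x j)"
        by (intro infsumI) (simp add: nf mult_ac norm_mult AB0)
    qed
    have "(\<lambda>j. \<Sum>\<^sub>\<infinity>l\<in>R. norm (f l j)) summable_on R"
      using sm' unfolding Infinite_Sum.abs_summable_on_Sigma_iff by (simp add: infsum_nonneg)
    then have 1: "(\<lambda>j. norm (complex_of_real (mat_mult R A B i j) * x j)) summable_on R"
      by (rule summable_on_cong[THEN iffD1, rotated]) (rule col)
    have "mat_op R A (mat_op R B x) i = (\<Sum>\<^sub>\<infinity>l\<in>R. \<Sum>\<^sub>\<infinity>j\<in>R. f l j)"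
      unfolding mat_op_apply[OF i]
      by (rule infsum_cong) (simp add: mat_op_apply f_def infsum_cmult_right')
    also have "\<dots> = (\<Sum>\<^sub>\<infinity>j\<in>R. \<Sum>\<^sub>\<infinity>l\<in>R. f l j)"
      by (rule infsum_swap_banach[OF abs_summable_summable[OF sm]])
    also have "\<dots> = mat_op R (mat_mult R A B) x i"
      unfolding mat_op_apply[OF i] by (rule infsum_cong) (rule col')
    finally show ?thesis using 1 by simp
  qed
  show op: "mat_op R (mat_mult R A B) x = mat_op R A (mat_op R B x)" if x: "x \<in> L" for x
  proof
    fix i show "mat_op R (mat_mult R A B) x i = mat_op R A (mat_op R B x) i"
      using main[OF x, of i] by (cases "i \<in> R") (simp_all add: mat_op_outside)
  qed
  show "mat_bd (C * D) (mat_mult R A B)" if C: "C \<ge> 0"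
    unfolding mat_bd_def defines_op_def nonneg_mat_def
  proof (intro conjI ballI allI AB0)
    fix x assume x: "x \<in> L"
    have BL: "mat_op R B x \<in> L" by (rule mat_bdD(2)[OF B x])
    show "mat_op R (mat_mult R A B) x \<in> L" unfolding op[OF x] by (rule mat_bdD(2)[OF A BL])
    have "nrm (mat_op R A (mat_op R B x)) \<le> C * nrm (mat_op R B x)" by (rule mat_bdD(3)[OF A BL])
    also have "\<dots> \<le> C * (D * nrm x)" by (rule mult_left_mono[OF mat_bdD(3)[OF B x] C])
    finally show "nrm (mat_op R (mat_mult R A B) x) \<le> C * D * nrm x" unfolding op[OF x] by simp
    show "(\<lambda>j. norm (complex_of_real (mat_mult R A B i j) * x j)) summable_on R" if "i \<in> R" for i
      using main[OF x that] by blast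
  qed
qed

text \<open>Unit vectors recover the entries in \<open>R \<times> R\<close>; thus identities between
  operators return to entrywise comparisons.\<close>

lemma mat_op_eqD:
  assumes "\<And>x. x \<in> L \<Longrightarrow> mat_op R A x = mat_op R B x" shows "mat_le A B"
  unfolding mat_le_def
proof (intro ballI)
  fix i j assume ij: "i \<in> R" "j \<in> R"
  have "mat_op R A (unit_vec j) i = mat_op R B (unit_vec j) i" using assms[OF unit_vec_L[OF ij(2)]] by simp
  then show "A i j \<le> B i j" using ij by (simp add: mat_op_unit_vec)
qed

lemma mat_mult_mono:
  assumes A: "mat_bd C A'" and B: "mat_bd D B'" and "nonneg_mat A" "nonneg_mat B" and le: "mat_le A A'" "mat_le B B'"
  shows "mat_le (mat_mult R A B) (mat_mult R A' B')"
  unfolding mat_le_def mat_mult_def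
proof (intro ballI infsum_mono)
  fix i j assume ij: "i \<in> R" "j \<in> R"
  show "(\<lambda>l. A i l * B l j) summable_on R"
    by (rule mat_mult_summable[OF mat_bd_mono[OF A assms(3) le(1)] mat_bd_mono[OF B assms(4) le(2)] ij])
  show "(\<lambda>l. A' i l * B' l j) summable_on R" by (rule mat_mult_summable[OF A B ij])
  show "A i l * B l j \<le> A' i l * B' l j" if "l \<in> R" for l
    using le that ij assms(3,4) mat_bdD(1)[OF A]
    by (intro mult_mono) (auto simp: mat_le_def nonneg_mat_def)
qed

lemma ess_norm_mat_mono:
  assumes B: "mat_bd C B" and A: "nonneg_mat A" "mat_le A B"
  shows "ess_norm (mat_op R A) \<le> ess_norm (mat_op R B)"
proof (rule dense_ge)
  fix c assume c: "ess_norm (mat_op R B) < c"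
  obtain N where N: "\<And>x. x \<in> L \<Longrightarrow> nrm (tail N (mat_op R B x)) \<le> c * nrm x"
    using ess_norm_lessD[OF blo_mat_op[OF B] c] by blast
  show "ess_norm (mat_op R A) \<le> c"
  proof (rule ess_norm_le[of _ N])
    show "0 \<le> c" using c ess_norm_nonneg[OF blo_mat_op[OF B]] by linarith
    show "nrm (tail N (mat_op R A x)) \<le> c * nrm x" if "x \<in> L" for x
      using dominated(3)[of "{0::nat}" "\<lambda>_. 1" "\<lambda>_. C" "\<lambda>_. B" A N "\<lambda>_. c" x] that assms N
      by (simp add: mat_le_def)
  qed
qed

end

section \<open>Weighted Hadamard products of matrices\<close>

locale hadamard_weights = oc_seq_space +
  fixes \<alpha> :: "nat \<Rightarrow> real" and m :: nat
  assumes m: "m \<ge> 1" and \<alpha>_pos: "\<And>j. j \<in> {1..m} \<Longrightarrow> \<alpha> j > 0" and \<alpha>_sum: "(\<Sum>j\<in>{1..m}. \<alpha> j) \<ge> 1"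
begin

definition hadamard :: "(nat \<Rightarrow> mat) \<Rightarrow> mat" where
  "hadamard A = (\<lambda>a b. \<Prod>j\<in>{1..m}. A j a b powr \<alpha> j)"

lemma nonneg_hadamard: "nonneg_mat (hadamard A)"
  by (simp add: nonneg_mat_def hadamard_def prod_nonneg)

text \<open>The tail bounds \<open>t j\<close> also bound the entries of the \<open>A j\<close> in
  these rows, so \<open>weighted_am_gm\<close> dominates the Hadamard product by a linear
  combination of the \<open>A j\<close>. Its coefficients weighted by the same \<open>t j\<close>
  sum to the product of powers.\<close>

lemma tail_hadamard_bound:
  assumes A: "\<And>j. j \<in> {1..m} \<Longrightarrow> mat_bd (D j) (A j)" and t: "\<And>j. j \<in> {1..m} \<Longrightarrow> t j > 0"
    and bd: "\<And>j x. j \<in> {1..m} \<Longrightarrow> x \<in> L \<Longrightarrow> nrm (tail N (mat_op R (A j) x)) \<le> t j * nrm x"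
    and x: "x \<in> L"
  shows "i \<in> R \<Longrightarrow> N \<le> i \<Longrightarrow> (\<lambda>l. norm (complex_of_real (hadamard A i l) * x l)) summable_on R"
    and "tail N (mat_op R (hadamard A) x) \<in> L"
    and "nrm (tail N (mat_op R (hadamard A) x)) \<le> (\<Prod>j\<in>{1..m}. t j powr \<alpha> j) * nrm x"
proof -
  define c where "c j = (\<Prod>j\<in>{1..m}. t j powr \<alpha> j) * (\<alpha> j / sum \<alpha> {1..m}) / t j" for j
  have c: "c j \<ge> 0" if "j \<in> {1..m}" for j
    unfolding c_def using t[OF that] \<alpha>_pos[OF that] \<alpha>_sum
    by (intro divide_nonneg_nonneg mult_nonneg_nonneg prod_nonneg) auto
  have le: "hadamard A i l \<le> (\<Sum>j\<in>{1..m}. c j * A j i l)" if "i \<in> R" "l \<in> R" "N \<le> i" for i l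
    unfolding hadamard_def c_def
    by (rule weighted_am_gm)
      (use m \<alpha>_pos \<alpha>_sum mat_bdD(1)[OF A] t tail_entry_bound[OF A bd that(1,2,3)] in auto)
  note d = dominated[OF finite_atLeastAtMost c A nonneg_hadamard le bd x]
  show "i \<in> R \<Longrightarrow> N \<le> i \<Longrightarrow> (\<lambda>l. norm (complex_of_real (hadamard A i l) * x l)) summable_on R"
    "tail N (mat_op R (hadamard A) x) \<in> L"
    by (rule d(1), assumption+, rule d(2))
  have "(\<Sum>j\<in>{1..m}. c j * t j) = (\<Prod>j\<in>{1..m}. t j powr \<alpha> j)"
    unfolding c_def by (rule weighted_am_gm_coeffs[OF \<alpha>_sum t])
  then show "nrm (tail N (mat_op R (hadamard A) x)) \<le> (\<Prod>j\<in>{1..m}. t j powr \<alpha> j) * nrm x"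
    using d(3) by simp
qed

lemma mat_bd_hadamard:
  assumes A: "\<And>j. j \<in> {1..m} \<Longrightarrow> mat_bd (t j) (A j)" and t: "\<And>j. j \<in> {1..m} \<Longrightarrow> t j > 0"
  shows "mat_bd (\<Prod>j\<in>{1..m}. t j powr \<alpha> j) (hadamard A)"
proof -
  have "nrm (tail 0 (mat_op R (A j) x)) \<le> t j * nrm x" if "j \<in> {1..m}" "x \<in> L" for j x
    using mat_bdD(3)[OF A[OF that(1)] that(2)] by simp
  note b = tail_hadamard_bound[OF A t this]
  show ?thesis
    unfolding mat_bd_def defines_op_def
    using b(1) b(2,3)[unfolded tail_0] nonneg_hadamard by simp
qed

text \<open>Essential norms may be 0 while \<open>tail_hadamard_bound\<close> divides by its bounds;
  hence each is raised by \<open>d > 0\<close>. The limit \<open>d\<close> to 0 uses that powers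
  with positive exponents are continuous at 0 from the right.\<close>

lemma ess_norm_hadamard:
  assumes A: "\<And>j. j \<in> {1..m} \<Longrightarrow> mat_bd (D j) (A j)"
  shows "ess_norm (mat_op R (hadamard A)) \<le> (\<Prod>j\<in>{1..m}. ess_norm (mat_op R (A j)) powr \<alpha> j)"
proof -
  let ?e = "\<lambda>j. ess_norm (mat_op R (A j))"
  have e0: "?e j \<ge> 0" if "j \<in> {1..m}" for j by (rule ess_norm_nonneg[OF blo_mat_op[OF A[OF that]]])
  have *: "ess_norm (mat_op R (hadamard A)) \<le> (\<Prod>j\<in>{1..m}. (?e j + d) powr \<alpha> j)" if d: "d > 0" for d
  proof -
    have "\<exists>N. \<forall>n\<ge>N. \<forall>x\<in>L. nrm (tail n (mat_op R (A j) x)) \<le> (?e j + d) * nrm x" if "j \<in> {1..m}" for j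
      by (rule ess_norm_lessD[OF blo_mat_op[OF A[OF that]]]) (use d in simp)
    then obtain N where N: "\<And>j n x. j \<in> {1..m} \<Longrightarrow> n \<ge> N j \<Longrightarrow> x \<in> L \<Longrightarrow>
        nrm (tail n (mat_op R (A j) x)) \<le> (?e j + d) * nrm x" by metis
    define M where "M = (\<Sum>j\<in>{1..m}. N j)"
    have M: "N j \<le> M" if "j \<in> {1..m}" for j unfolding M_def using that by (intro member_le_sum) auto
    show ?thesis
    proof (rule ess_norm_le[of _ M])
      show "nrm (tail M (mat_op R (hadamard A) x)) \<le> (\<Prod>j\<in>{1..m}. (?e j + d) powr \<alpha> j) * nrm x" if "x \<in> L" for x
        by (rule tail_hadamard_bound(3)[OF A]) (use e0 d N M that in \<open>auto intro: add_nonneg_pos\<close>)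
    qed (simp add: prod_nonneg)
  qed
  show ?thesis
  proof (rule tendsto_lowerbound)
    show "((\<lambda>d. \<Prod>j\<in>{1..m}. (?e j + d) powr \<alpha> j) \<longlongrightarrow> (\<Prod>j\<in>{1..m}. ?e j powr \<alpha> j)) (at_right 0)"
    proof (rule tendsto_prod)
      fix j assume j: "j \<in> {1..m}"
      have "((\<lambda>d. ?e j + d) \<longlongrightarrow> ?e j) (at_right 0)" by (auto intro!: tendsto_eq_intros)
      moreover have "\<forall>\<^sub>F d in at_right 0. 0 \<le> ?e j + d"
        unfolding eventually_at_right_field using e0[OF j] by (intro exI[of _ 1]) auto
      ultimately show "((\<lambda>d. (?e j + d) powr \<alpha> j) \<longlongrightarrow> ?e j powr \<alpha> j) (at_right 0)"
        by (intro tendsto_powr2 tendsto_const \<alpha>_pos[OF j])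
    qed
    show "\<forall>\<^sub>F d in at_right 0. ess_norm (mat_op R (hadamard A)) \<le> (\<Prod>j\<in>{1..m}. (?e j + d) powr \<alpha> j)"
      unfolding eventually_at_right_field using * by (intro exI[of _ 1]) auto
  qed simp
qed

text \<open>Each entry of the product is a sum over \<open>l\<close> of products of powers, so this
  is \<open>Holder_infsum\<close> applied to the terms \<open>A j i l * B j l k\<close>.\<close>

lemma hadamard_mult:
  assumes A: "\<And>j. j \<in> {1..m} \<Longrightarrow> mat_bd (C j) (A j)" and B: "\<And>j. j \<in> {1..m} \<Longrightarrow> mat_bd (D j) (B j)"
  shows "mat_le (mat_mult R (hadamard A) (hadamard B)) (hadamard (\<lambda>j. mat_mult R (A j) (B j)))"
  unfolding mat_le_def
proof (intro ballI)
  fix i k assume ik: "i \<in> R" "k \<in> R"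
  have "mat_mult R (hadamard A) (hadamard B) i k = (\<Sum>\<^sub>\<infinity>l\<in>R. \<Prod>j\<in>{1..m}. (A j i l * B j l k) powr \<alpha> j)"
    unfolding mat_mult_def hadamard_def prod.distrib[symmetric]
    by (intro infsum_cong prod.cong refl powr_mult[symmetric])
  also have "\<dots> \<le> (\<Prod>j\<in>{1..m}. (\<Sum>\<^sub>\<infinity>l\<in>R. A j i l * B j l k) powr \<alpha> j)"
    by (rule Holder_infsum)
      (use m \<alpha>_pos \<alpha>_sum mat_bdD(1)[OF A] mat_bdD(1)[OF B] mat_mult_summable[OF A B ik] in auto)
  finally show "mat_mult R (hadamard A) (hadamard B) i k \<le> hadamard (\<lambda>j. mat_mult R (A j) (B j)) i k"
    by (simp add: hadamard_def mat_mult_def)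
qed

text \<open>Hoelder's inequality over \<open>I\<close>, entry by entry; the counterpart of
  \<open>hadamard_mult\<close> for sums.\<close>

lemma hadamard_sum:
  assumes "finite I" "\<And>i j. i \<in> I \<Longrightarrow> j \<in> {1..m} \<Longrightarrow> nonneg_mat (F i j)"
  shows "mat_le (\<lambda>a b. \<Sum>i\<in>I. hadamard (F i) a b) (hadamard (\<lambda>j a b. \<Sum>i\<in>I. F i j a b))"
  unfolding mat_le_def hadamard_def
  by (intro ballI Holder_sum) (use m \<alpha>_pos \<alpha>_sum assms in \<open>auto simp: nonneg_mat_def\<close>)

end

section \<open>Joint and generalized essential spectral radii\<close>

context oc_seq_space
begin

section \<open>Powers of sets of matrices and of operators\<close>

abbreviation mat_pow :: "mat set \<Rightarrow> nat \<Rightarrow> mat set" where "mat_pow \<equiv> mat_set_pow R"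

abbreviation ess :: "mat \<Rightarrow> real" where "ess A \<equiv> ess_norm (mat_op R A)"

text \<open>The bound is strictly positive so that it can be used as \<open>t j\<close> in
  \<open>mat_bd_hadamard\<close>.\<close>

definition bdd_mats :: "mat set \<Rightarrow> bool" where
  "bdd_mats S \<longleftrightarrow> (\<exists>C>0. \<forall>A\<in>S. mat_bd C A)"

text \<open>Matrix products and compositions of operators are compared only on \<open>L\<close>,
  where the row sums converge. Working up to this relation also replaces associativity of
  \<open>mat_mult\<close> by associativity of composition.\<close>

definition op_eq :: "mat \<Rightarrow> seqop \<Rightarrow> bool" where
  "op_eq A T \<longleftrightarrow> (\<forall>x\<in>L. mat_op R A x = T x)"

lemma bdd_matsE:
  assumes "bdd_mats S" obtains C where "C > 0" "\<And>A. A \<in> S \<Longrightarrow> mat_bd C A"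
  using assms unfolding bdd_mats_def by blast

lemma mat_bd_pow:
  assumes C: "C > 0" "\<And>A. A \<in> S \<Longrightarrow> mat_bd C A"
  shows "A \<in> mat_pow S n \<Longrightarrow> mat_bd (C ^ n) A"
proof (induction n arbitrary: A)
  case 0
  then show ?case using mat_bd_id by simp
next
  case (Suc n)
  then obtain X Y where "A = mat_mult R X Y" "X \<in> S" "Y \<in> mat_pow S n" by auto
  then show ?case using mat_bd_mult[OF C(2) Suc.IH, of X Y] C(1) by simp
qed

lemma bdd_mats_pow: assumes "bdd_mats S" shows "bdd_mats (mat_pow S n)"
proof -
  obtain C where C: "C > 0" "\<And>A. A \<in> S \<Longrightarrow> mat_bd C A" by (rule bdd_matsE[OF assms]) (rule that)
  then show ?thesis
    unfolding bdd_mats_def using mat_bd_pow[OF C] by (intro exI[of _ "C ^ n"]) simp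
qed

lemma bdd_mats_mat_bd: "bdd_mats S \<Longrightarrow> A \<in> S \<Longrightarrow> \<exists>C>0. mat_bd C A"
  unfolding bdd_mats_def by blast

lemma op_eq_mult:
  assumes "bdd_mats S" "bdd_mats S'" "A \<in> S" "B \<in> S'" "op_eq A T" "op_eq B U"
  shows "op_eq (mat_mult R A B) (\<lambda>x. T (U x))"
proof -
  obtain C D where A: "mat_bd C A" and B: "mat_bd D B" using bdd_mats_mat_bd assms by meson
  show ?thesis unfolding op_eq_def
  proof
    fix x assume x: "x \<in> L"
    have "mat_op R (mat_mult R A B) x = mat_op R A (mat_op R B x)" by (rule mat_op_mult[OF A B x])
    also have "\<dots> = T (mat_op R B x)" using assms(5) mat_bdD(2)[OF B x] by (simp add: op_eq_def)
    also have "\<dots> = T (U x)" using assms(6) x by (simp add: op_eq_def)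
    finally show "mat_op R (mat_mult R A B) x = T (U x)" .
  qed
qed

lemma op_set_pow_imp_mat_pow:
  assumes S: "bdd_mats S"
  shows "T \<in> op_set_pow (mat_op R ` S) n \<Longrightarrow> \<exists>A\<in>mat_pow S n. op_eq A T"
proof (induction n arbitrary: T)
  case 0
  then show ?case by (simp add: op_eq_def mat_op_id)
next
  case (Suc n)
  then obtain A U where T: "T = mat_op R A \<circ> U" and A: "A \<in> S" and U: "U \<in> op_set_pow (mat_op R ` S) n" by auto
  obtain B where B: "B \<in> mat_pow S n" "op_eq B U" using Suc.IH[OF U] by blast
  have "op_eq (mat_mult R A B) T"
    using op_eq_mult[OF S bdd_mats_pow[OF S] A B(1) _ B(2), of "mat_op R A"] by (simp add: T op_eq_def)
  moreover have "mat_mult R A B \<in> mat_pow S (Suc n)" using A B by auto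
  ultimately show ?case by blast
qed

lemma mat_pow_imp_op_set_pow:
  assumes S: "bdd_mats S"
  shows "A \<in> mat_pow S n \<Longrightarrow> \<exists>T\<in>op_set_pow (mat_op R ` S) n. op_eq A T"
proof (induction n arbitrary: A)
  case 0
  then show ?case by (simp add: op_eq_def mat_op_id)
next
  case (Suc n)
  then obtain X Y where A: "A = mat_mult R X Y" and X: "X \<in> S" and Y: "Y \<in> mat_pow S n" by auto
  obtain U where U: "U \<in> op_set_pow (mat_op R ` S) n" "op_eq Y U" using Suc.IH[OF Y] by blast
  have "op_eq A (mat_op R X \<circ> U)"
    unfolding A using op_eq_mult[OF S bdd_mats_pow[OF S] X Y _ U(2), of "mat_op R X"] by (simp add: op_eq_def)
  moreover have "mat_op R X \<circ> U \<in> op_set_pow (mat_op R ` S) (Suc n)" using X U by auto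
  ultimately show ?case by blast
qed

lemma mat_pow_concat:
  assumes S: "bdd_mats S" and X: "X \<in> mat_pow S p" and Y: "Y \<in> mat_pow S q"
  shows "\<exists>Z\<in>mat_pow S (p + q). op_eq Z (\<lambda>x. mat_op R X (mat_op R Y x))"
  using X
proof (induction p arbitrary: X)
  case 0
  obtain C where "mat_bd C Y" using bdd_mats_mat_bd[OF bdd_mats_pow[OF S] Y] by blast
  then have "op_eq Y (\<lambda>x. mat_op R X (mat_op R Y x))"
    using 0 by (simp add: op_eq_def mat_op_id mat_bdD(2))
  then show ?case using Y by auto
next
  case (Suc p)
  then obtain X1 X2 where X: "X = mat_mult R X1 X2" and X1: "X1 \<in> S" and X2: "X2 \<in> mat_pow S p" by auto
  obtain Z where Z: "Z \<in> mat_pow S (p + q)" "op_eq Z (\<lambda>x. mat_op R X2 (mat_op R Y x))"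
    using Suc.IH[OF X2] by blast
  obtain C where Yb: "mat_bd C Y" using bdd_mats_mat_bd[OF bdd_mats_pow[OF S] Y] by blast
  have e: "op_eq X (\<lambda>x. mat_op R X1 (mat_op R X2 x))"
    unfolding X by (rule op_eq_mult[OF S bdd_mats_pow[OF S] X1 X2]) (simp_all add: op_eq_def)
  have "op_eq (mat_mult R X1 Z) (\<lambda>x. mat_op R X1 (mat_op R X2 (mat_op R Y x)))"
    by (rule op_eq_mult[OF S bdd_mats_pow[OF S] X1 Z(1) _ Z(2)]) (simp add: op_eq_def)
  then have "op_eq (mat_mult R X1 Z) (\<lambda>x. mat_op R X (mat_op R Y x))"
    using e mat_bdD(2)[OF Yb] by (simp add: op_eq_def)
  moreover have "mat_mult R X1 Z \<in> mat_pow S (Suc p + q)" using X1 Z by auto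
  ultimately show ?case by blast
qed

lemma mat_pow_split:
  assumes S: "bdd_mats S"
  shows "A \<in> mat_pow S (p + q) \<Longrightarrow>
    \<exists>X\<in>mat_pow S p. \<exists>Y\<in>mat_pow S q. op_eq A (\<lambda>x. mat_op R X (mat_op R Y x))"
proof (induction p arbitrary: A)
  case 0
  obtain C where "mat_bd C A" using bdd_mats_mat_bd[OF bdd_mats_pow[OF S] 0] by blast
  then have "op_eq A (\<lambda>x. mat_op R id_mat (mat_op R A x))" by (simp add: op_eq_def mat_op_id mat_bdD(2))
  then show ?case using 0 by auto
next
  case (Suc p)
  then obtain A1 A2 where A: "A = mat_mult R A1 A2" and A1: "A1 \<in> S" and A2: "A2 \<in> mat_pow S (p + q)" by auto
  obtain X Y where X: "X \<in> mat_pow S p" and Y: "Y \<in> mat_pow S q"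
    and XY: "op_eq A2 (\<lambda>x. mat_op R X (mat_op R Y x))" using Suc.IH[OF A2] by blast
  obtain C where Yb: "mat_bd C Y" using bdd_mats_mat_bd[OF bdd_mats_pow[OF S] Y] by blast
  have e: "op_eq (mat_mult R A1 X) (\<lambda>x. mat_op R A1 (mat_op R X x))"
    by (rule op_eq_mult[OF S bdd_mats_pow[OF S] A1 X]) (simp_all add: op_eq_def)
  have "op_eq A (\<lambda>x. mat_op R A1 (mat_op R X (mat_op R Y x)))"
    unfolding A by (rule op_eq_mult[OF S bdd_mats_pow[OF S] A1 A2 _ XY]) (simp add: op_eq_def)
  then have "op_eq A (\<lambda>x. mat_op R (mat_mult R A1 X) (mat_op R Y x))"
    using e mat_bdD(2)[OF Yb] by (simp add: op_eq_def)
  moreover have "mat_mult R A1 X \<in> mat_pow S (Suc p)" using A1 X by auto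
  ultimately show ?case using Y by blast
qed

text \<open>Regrouping \<open>p\<close> blocks of \<open>n\<close> factors into one product changes
  the bracketing, so the result is a matrix with the same operator on \<open>L\<close>.\<close>

lemma mat_pow_pow:
  assumes S: "bdd_mats S"
  shows "A \<in> mat_pow (mat_pow S n) p \<Longrightarrow> \<exists>B\<in>mat_pow S (n * p). op_eq B (mat_op R A)"
proof (induction p arbitrary: A)
  case 0
  then show ?case by (simp add: op_eq_def)
next
  case (Suc p)
  then obtain X Y where A: "A = mat_mult R X Y" and X: "X \<in> mat_pow S n" and Y: "Y \<in> mat_pow (mat_pow S n) p" by auto
  obtain B where B: "B \<in> mat_pow S (n * p)" "op_eq B (mat_op R Y)" using Suc.IH[OF Y] by blast
  obtain Z where Z: "Z \<in> mat_pow S (n + n * p)" "op_eq Z (\<lambda>x. mat_op R X (mat_op R B x))"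
    using mat_pow_concat[OF S X B(1)] by blast
  have "op_eq A (\<lambda>x. mat_op R X (mat_op R Y x))"
    unfolding A
    by (rule op_eq_mult[OF bdd_mats_pow[OF S] bdd_mats_pow[OF bdd_mats_pow[OF S]] X Y]) (simp_all add: op_eq_def)
  then have "op_eq Z (mat_op R A)" using Z(2) B(2) by (simp add: op_eq_def)
  then show ?case using Z(1) by auto
qed

lemma mat_pow_funpow:
  assumes S: "bdd_mats S" and A: "A \<in> mat_pow S p"
  shows "\<exists>Z\<in>mat_pow S (n * p). op_eq Z (mat_op R A ^^ n)"
proof (induction n)
  case 0
  then show ?case by (simp add: op_eq_def mat_op_id)
next
  case (Suc n)
  then obtain Z where Z: "Z \<in> mat_pow S (n * p)" "op_eq Z (mat_op R A ^^ n)" by blast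
  obtain Z' where Z': "Z' \<in> mat_pow S (p + n * p)" "op_eq Z' (\<lambda>x. mat_op R A (mat_op R Z x))"
    using mat_pow_concat[OF S A Z(1)] by blast
  have "op_eq Z' (mat_op R A ^^ Suc n)" using Z'(2) Z(2) by (simp add: op_eq_def)
  then show ?case using Z'(1) by (auto simp: comp_def)
qed

text \<open>Each member needs only some dominating member of \<open>S'\<close>, which is exactly
  what comparing suprema requires; the relation is preserved by powers.\<close>

definition set_le :: "mat set \<Rightarrow> mat set \<Rightarrow> bool" where
  "set_le S S' \<longleftrightarrow> (\<forall>A\<in>S. \<exists>B\<in>S'. mat_le A B)"

lemma set_le_refl: "set_le S S"
  unfolding set_le_def using mat_le_refl by blast

lemma set_le_bdd_nonneg: "bdd_mats S \<Longrightarrow> A \<in> S \<Longrightarrow> nonneg_mat A"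
  using bdd_mats_mat_bd by (auto simp: mat_bd_def)

lemma set_le_pow:
  assumes S: "bdd_mats S" and S': "bdd_mats S'" and le: "set_le S S'"
  shows "set_le (mat_pow S n) (mat_pow S' n)"
proof (induction n)
  case 0
  show ?case by (simp add: set_le_refl)
next
  case (Suc n)
  show ?case unfolding set_le_def
  proof
    fix A assume "A \<in> mat_pow S (Suc n)"
    then obtain X Y where A: "A = mat_mult R X Y" and X: "X \<in> S" and Y: "Y \<in> mat_pow S n" by auto
    obtain X' where X': "X' \<in> S'" "mat_le X X'" using le X by (auto simp: set_le_def)
    obtain Y' where Y': "Y' \<in> mat_pow S' n" "mat_le Y Y'" using Suc Y by (auto simp: set_le_def)
    obtain C D where "mat_bd C X'" "mat_bd D Y'"
      using bdd_mats_mat_bd[OF S' X'(1)] bdd_mats_mat_bd[OF bdd_mats_pow[OF S'] Y'(1)] by blast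
    then have "mat_le A (mat_mult R X' Y')"
      unfolding A using set_le_bdd_nonneg[OF S X] set_le_bdd_nonneg[OF bdd_mats_pow[OF S] Y] X' Y'
      by (intro mat_mult_mono)
    moreover have "mat_mult R X' Y' \<in> mat_pow S' (Suc n)" using X' Y' by auto
    ultimately show "\<exists>B\<in>mat_pow S' (Suc n). mat_le A B" by blast
  qed
qed

lemma ess_op_eq: "op_eq A T \<Longrightarrow> ess A = ess_norm T"
  by (rule ess_norm_cong) (simp add: op_eq_def)

lemma ess_nonneg: "mat_bd C A \<Longrightarrow> ess A \<ge> 0"
  by (rule ess_norm_nonneg[OF blo_mat_op])

text \<open>The adjoined 0 follows the convention in the definitions of the radii and covers empty
  sets.\<close>

definition sup_ess :: "mat set \<Rightarrow> real" where
  "sup_ess S = Sup ({ess A | A. A \<in> S} \<union> {0})"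

lemma sup_ess_le: "c \<ge> 0 \<Longrightarrow> (\<And>A. A \<in> S \<Longrightarrow> ess A \<le> c) \<Longrightarrow> sup_ess S \<le> c"
  unfolding sup_ess_def by (rule cSup_least) auto

lemma sup_ess_bdd: assumes "bdd_mats S" shows "bdd_above ({ess A | A. A \<in> S} \<union> {0})"
proof -
  obtain C where C: "C > 0" "\<And>A. A \<in> S \<Longrightarrow> mat_bd C A" by (rule bdd_matsE[OF assms]) (rule that)
  have "ess A \<le> C" if "A \<in> S" for A
    using C(1) mat_bdD(3)[OF C(2)[OF that]] by (intro ess_norm_le_bound) auto
  then show ?thesis using C(1) by (intro bdd_aboveI[of _ C]) auto
qed

lemma ess_le_sup_ess: "bdd_mats S \<Longrightarrow> A \<in> S \<Longrightarrow> ess A \<le> sup_ess S"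
  unfolding sup_ess_def by (rule cSup_upper[OF _ sup_ess_bdd]) auto

lemma sup_ess_nonneg: "bdd_mats S \<Longrightarrow> sup_ess S \<ge> 0"
  unfolding sup_ess_def by (rule cSup_upper[OF _ sup_ess_bdd]) auto

lemma sup_ess_mono:
  assumes S: "bdd_mats S" and S': "bdd_mats S'" and le: "set_le S S'" shows "sup_ess S \<le> sup_ess S'"
proof (rule sup_ess_le[OF sup_ess_nonneg[OF S']])
  fix A assume A: "A \<in> S"
  obtain B where B: "B \<in> S'" "mat_le A B" using A le by (auto simp: set_le_def)
  obtain C where C: "mat_bd C B" using bdd_mats_mat_bd[OF S' B(1)] by blast
  show "ess A \<le> sup_ess S'"
    using ess_norm_mat_mono[OF C set_le_bdd_nonneg[OF S A] B(2)] ess_le_sup_ess[OF S' B(1)] by linarith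
qed

text \<open>A product of \<open>p + q\<close> factors splits into two products, to which
  \<open>ess_norm_comp\<close> applies; so the joint radius exists as a limit by Fekete's
  lemma.\<close>

lemma submult_sup_ess: assumes S: "bdd_mats S" shows "submult_seq (\<lambda>p. sup_ess (mat_pow S p))"
proof
  show nn: "sup_ess (mat_pow S p) \<ge> 0" for p by (rule sup_ess_nonneg[OF bdd_mats_pow[OF S]])
  fix p q
  show "sup_ess (mat_pow S (p + q)) \<le> sup_ess (mat_pow S p) * sup_ess (mat_pow S q)"
  proof (rule sup_ess_le)
    show "0 \<le> sup_ess (mat_pow S p) * sup_ess (mat_pow S q)" by (rule mult_nonneg_nonneg[OF nn nn])
    fix A assume "A \<in> mat_pow S (p + q)"
    from mat_pow_split[OF S this] obtain X Y where X: "X \<in> mat_pow S p" and Y: "Y \<in> mat_pow S q"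
      and A: "op_eq A (\<lambda>x. mat_op R X (mat_op R Y x))" by blast
    obtain C D where CD: "mat_bd C X" "mat_bd D Y" using bdd_mats_mat_bd[OF bdd_mats_pow[OF S]] X Y by meson
    have "ess A \<le> ess X * ess Y"
      unfolding ess_op_eq[OF A] by (rule ess_norm_comp[OF blo_mat_op[OF CD(1)] blo_mat_op[OF CD(2)]])
    also have "\<dots> \<le> sup_ess (mat_pow S p) * sup_ess (mat_pow S q)"
      by (intro mult_mono ess_le_sup_ess[OF bdd_mats_pow[OF S]] X Y nn ess_nonneg[OF CD(2)])
    finally show "ess A \<le> sup_ess (mat_pow S p) * sup_ess (mat_pow S q)" .
  qed
qed

definition joint_rad :: "mat set \<Rightarrow> real" where
  "joint_rad S = root_lim (\<lambda>p. sup_ess (mat_pow S p))"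

text \<open>Products of operators and of matrices agree on \<open>L\<close>, where
  \<open>hmnc_eq_ess_norm\<close> identifies the measure of noncompactness. The limit over
  \<open>Suc p\<close> is a shift of the full sequence.\<close>

lemma joint_ess_rad_eq: assumes S: "bdd_mats S" shows "joint_ess_rad L nrm (mat_op R ` S) = joint_rad S"
proof -
  interpret submult_seq "\<lambda>p. sup_ess (mat_pow S p)" by (rule submult_sup_ess[OF S])
  have hm: "hmnc L nrm T = ess A" if A: "A \<in> mat_pow S n" "op_eq A T" for A T n
  proof -
    obtain C where C: "mat_bd C A" using bdd_mats_mat_bd[OF bdd_mats_pow[OF S] A(1)] by blast
    have "blo T" by (rule blo_cong[OF blo_mat_op[OF C]]) (use A(2) in \<open>simp add: op_eq_def\<close>)
    then show ?thesis using hmnc_eq_ess_norm ess_op_eq[OF A(2)] by simp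
  qed
  have eq: "{hmnc L nrm T | T. T \<in> op_set_pow (mat_op R ` S) n} = {ess A | A. A \<in> mat_pow S n}" for n
  proof (intro equalityI subsetI)
    fix y assume "y \<in> {hmnc L nrm T | T. T \<in> op_set_pow (mat_op R ` S) n}"
    then obtain T where T: "T \<in> op_set_pow (mat_op R ` S) n" "y = hmnc L nrm T" by blast
    from op_set_pow_imp_mat_pow[OF S T(1)] obtain A where "A \<in> mat_pow S n" "op_eq A T" by blast
    then show "y \<in> {ess A | A. A \<in> mat_pow S n}" using hm T(2) by blast
  next
    fix y assume "y \<in> {ess A | A. A \<in> mat_pow S n}"
    then obtain A where A: "A \<in> mat_pow S n" "y = ess A" by blast
    from mat_pow_imp_op_set_pow[OF S A(1)] obtain T where "T \<in> op_set_pow (mat_op R ` S) n" "op_eq A T" by blast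
    then show "y \<in> {hmnc L nrm T | T. T \<in> op_set_pow (mat_op R ` S) n}" using hm[OF A(1)] A(2) by force
  qed
  have "joint_ess_rad L nrm (mat_op R ` S)
      = lim (\<lambda>p. sup_ess (mat_pow S (Suc p)) powr (1 / real (Suc p)))"
    by (simp only: joint_ess_rad_def sup_ess_def eq)
  also have "\<dots> = joint_rad S" unfolding joint_rad_def by (rule limI[OF LIMSEQ_Suc[OF root_lim_tendsto]])
  finally show ?thesis .
qed

lemma joint_rad_nonneg: "bdd_mats S \<Longrightarrow> joint_rad S \<ge> 0"
  unfolding joint_rad_def by (rule submult_seq.root_lim_nonneg[OF submult_sup_ess])

lemma joint_rad_mono:
  assumes S: "bdd_mats S" and S': "bdd_mats S'" and le: "set_le S S'" shows "joint_rad S \<le> joint_rad S'"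
  unfolding joint_rad_def
proof (rule LIMSEQ_le[OF submult_seq.root_lim_tendsto[OF submult_sup_ess[OF S]]
      submult_seq.root_lim_tendsto[OF submult_sup_ess[OF S']]], intro exI allI impI)
  fix n
  show "sup_ess (mat_pow S n) powr (1 / real n) \<le> sup_ess (mat_pow S' n) powr (1 / real n)"
    by (intro powr_mono2 sup_ess_mono bdd_mats_pow S S' set_le_pow le sup_ess_nonneg) simp
qed

text \<open>This is the essential spectral radius of one nonnegative matrix, written as the joint
  radius of a singleton so that monotonicity and the Hadamard inequality are special cases of the
  joint theory.\<close>

definition mat_rad :: "mat \<Rightarrow> real" where
  "mat_rad A = joint_rad {A}"

lemma bdd_mats_singleton: "mat_bd C A \<Longrightarrow> bdd_mats {A}"
  unfolding bdd_mats_def using mat_bd_weaken[of C A "max C 1"] by (intro exI[of _ "max C 1"]) auto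

lemma mat_pow_singleton:
  assumes A: "mat_bd C A"
  shows "\<exists>X. mat_pow {A} n = {X} \<and> op_eq X (mat_op R A ^^ n)"
proof (induction n)
  case 0
  show ?case by (simp add: op_eq_def mat_op_id)
next
  case (Suc n)
  then obtain X where X: "mat_pow {A} n = {X}" "op_eq X (mat_op R A ^^ n)" by blast
  note S = bdd_mats_singleton[OF A]
  have "op_eq (mat_mult R A X) (mat_op R A ^^ Suc n)"
    using op_eq_mult[OF S bdd_mats_pow[OF S, of n], of A X "mat_op R A", OF _ _ _ X(2)] X(1) by (simp add: op_eq_def)
  then show ?case using X(1) by (auto simp: comp_def)
qed

lemma sup_ess_pow_singleton: assumes A: "mat_bd C A" shows "sup_ess (mat_pow {A} n) = pow_norm (mat_op R A) n"
proof -
  obtain X where X: "mat_pow {A} n = {X}" "op_eq X (mat_op R A ^^ n)" using mat_pow_singleton[OF A] by blast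
  have "ess X = pow_norm (mat_op R A) n" unfolding pow_norm_def by (rule ess_op_eq[OF X(2)])
  moreover have "ess X \<ge> 0"
    using bdd_mats_mat_bd[OF bdd_mats_pow[OF bdd_mats_singleton[OF A]], of X n] X ess_nonneg by auto
  ultimately show ?thesis
    unfolding sup_ess_def X(1) by (intro cSup_eq_maximum) auto
qed

lemma mat_rad_eq: "mat_bd C A \<Longrightarrow> mat_rad A = root_lim (pow_norm (mat_op R A))"
  unfolding mat_rad_def joint_rad_def by (simp add: sup_ess_pow_singleton)

lemma mat_rad_nonneg: "mat_bd C A \<Longrightarrow> mat_rad A \<ge> 0"
  unfolding mat_rad_def by (rule joint_rad_nonneg[OF bdd_mats_singleton])

lemma mat_rad_mono:
  assumes B: "mat_bd C B" and A: "nonneg_mat A" "mat_le A B" shows "mat_rad A \<le> mat_rad B"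
  unfolding mat_rad_def
  by (rule joint_rad_mono[OF bdd_mats_singleton[OF mat_bd_mono[OF B A]] bdd_mats_singleton[OF B]])
    (simp add: set_le_def A)

lemma mat_rad_le:
  assumes A: "mat_bd C A" and C: "C \<ge> 0" shows "mat_rad A \<le> C"
proof -
  interpret submult_seq "pow_norm (mat_op R A)" by (rule submult_pow_norm[OF blo_mat_op[OF A]])
  have "root_lim (pow_norm (mat_op R A)) \<le> pow_norm (mat_op R A) 1" using root_lim_pow_le[of 1] by simp
  also have "\<dots> = ess A" by (simp add: pow_norm_def)
  also have "\<dots> \<le> C" using mat_bdD(3)[OF A] C by (intro ess_norm_le_bound) auto
  finally show ?thesis by (simp add: mat_rad_eq[OF A])
qed

text \<open>Powers of \<open>Z\<close> act as every \<open>n\<close>-th power of \<open>A\<close>,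
  so the roots for \<open>Z\<close> are the \<open>n\<close>-th powers of a subsequence of the roots
  for \<open>A\<close>.\<close>

lemma mat_rad_funpow:
  assumes A: "mat_bd C A" and Z: "mat_bd D Z" "op_eq Z (mat_op R A ^^ n)" and n: "n \<ge> 1"
  shows "mat_rad Z = mat_rad A ^ n"
proof -
  interpret a: submult_seq "pow_norm (mat_op R A)" by (rule submult_pow_norm[OF blo_mat_op[OF A]])
  interpret z: submult_seq "pow_norm (mat_op R Z)" by (rule submult_pow_norm[OF blo_mat_op[OF Z(1)]])
  have AL: "(mat_op R A ^^ k) x \<in> L" if "x \<in> L" for k x
    by (rule blo_L[OF blo_funpow[OF blo_mat_op[OF A]] that])
  have pw: "(mat_op R Z ^^ p) x = (mat_op R A ^^ (n * p)) x" if x: "x \<in> L" for p x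
  proof (induction p)
    case (Suc p)
    have "(mat_op R Z ^^ Suc p) x = (mat_op R A ^^ n) ((mat_op R A ^^ (n * p)) x)"
      using Suc Z(2) AL[OF x, of "n * p"] by (simp add: op_eq_def)
    then show ?case by (simp add: funpow_add)
  qed simp
  then have e: "pow_norm (mat_op R Z) p = pow_norm (mat_op R A) (n * p)" for p
    unfolding pow_norm_def by (intro ess_norm_cong) simp
  have "(\<lambda>p. (pow_norm (mat_op R A) (n * p) powr (1 / real (n * p))) ^ n) \<longlonglongrightarrow> root_lim (pow_norm (mat_op R A)) ^ n"
    by (intro tendsto_power a.root_lim_tendsto_mult n)
  moreover have "(pow_norm (mat_op R A) (n * p) powr (1 / real (n * p))) ^ n = pow_norm (mat_op R Z) p powr (1 / real p)" for p
    using n by (cases "pow_norm (mat_op R A) (n * p) = 0") (simp_all add: e powr_power)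
  ultimately show ?thesis
    unfolding mat_rad_eq[OF A] mat_rad_eq[OF Z(1)] using LIMSEQ_unique[OF z.root_lim_tendsto] by simp
qed

definition gen_rad :: "mat set \<Rightarrow> real" where
  "gen_rad S = Sup ({(Sup ({mat_rad A | A. A \<in> mat_pow S p} \<union> {0})) powr (1 / real p) | p. p \<ge> 1} \<union> {0})"

text \<open>Every product of members of \<open>S\<close> acts as a positive operator on
  \<open>L\<close>, so \<open>ess_rad_pos_op\<close> replaces its spectral definition by the limit
  of roots.\<close>

lemma gen_ess_rad_eq: assumes S: "bdd_mats S" shows "gen_ess_rad L nrm (mat_op R ` S) = gen_rad S"
proof -
  have cong: "ess_rad L nrm T = mat_rad A" if A: "A \<in> mat_pow S n" "op_eq A T" for A T n
  proof -
    obtain C where C: "mat_bd C A" using bdd_mats_mat_bd[OF bdd_mats_pow[OF S] A(1)] by blast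
    have eq: "T x = mat_op R A x" if "x \<in> L" for x using \<open>op_eq A T\<close> that by (simp add: op_eq_def)
    have "pos_op T"
      unfolding pos_op_def
    proof (intro conjI ballI impI)
      show "blo T" by (rule blo_cong[OF blo_mat_op[OF C] eq])
      fix x assume x: "x \<in> L"
      show "0 \<le> T x" if "0 \<le> x" unfolding eq[OF x] by (rule pos_opD(2)[OF pos_op_mat_op[OF C] x that])
      show "abs_seq (T x) \<le> T (abs_seq x)"
        unfolding eq[OF x] eq[OF abs_seq_L[OF x]] by (rule pos_opD(3)[OF pos_op_mat_op[OF C] x])
    qed
    moreover have "pow_norm T = pow_norm (mat_op R A)"
    proof
      fix k
      have "(T ^^ k) x = (mat_op R A ^^ k) x" if x: "x \<in> L" for x
      proof (induction k)
        case (Suc k)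
        then show ?case using eq[OF blo_L[OF blo_funpow[OF blo_mat_op[OF C]] x]] by simp
      qed simp
      then show "pow_norm T k = pow_norm (mat_op R A) k" unfolding pow_norm_def by (rule ess_norm_cong)
    qed
    ultimately show ?thesis using ess_rad_pos_op mat_rad_eq[OF C] by simp
  qed
  have eq: "{ess_rad L nrm T | T. T \<in> op_set_pow (mat_op R ` S) n} = {mat_rad A | A. A \<in> mat_pow S n}" for n
  proof (intro equalityI subsetI)
    fix y assume "y \<in> {ess_rad L nrm T | T. T \<in> op_set_pow (mat_op R ` S) n}"
    then obtain T where T: "T \<in> op_set_pow (mat_op R ` S) n" "y = ess_rad L nrm T" by blast
    from op_set_pow_imp_mat_pow[OF S T(1)] obtain A where "A \<in> mat_pow S n" "op_eq A T" by blast
    then show "y \<in> {mat_rad A | A. A \<in> mat_pow S n}" using cong T(2) by blast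
  next
    fix y assume "y \<in> {mat_rad A | A. A \<in> mat_pow S n}"
    then obtain A where A: "A \<in> mat_pow S n" "y = mat_rad A" by blast
    from mat_pow_imp_op_set_pow[OF S A(1)] obtain T where "T \<in> op_set_pow (mat_op R ` S) n" "op_eq A T" by blast
    then show "y \<in> {ess_rad L nrm T | T. T \<in> op_set_pow (mat_op R ` S) n}" using cong[OF A(1)] A(2) by force
  qed
  show ?thesis by (simp only: gen_ess_rad_def gen_rad_def eq)
qed

lemma mat_rad_pow_le:
  assumes S: "bdd_mats S"
  obtains C where "C > 0" "\<And>p A. A \<in> mat_pow S p \<Longrightarrow> mat_rad A \<le> C ^ p"
proof -
  obtain C where C: "C > 0" "\<And>A. A \<in> S \<Longrightarrow> mat_bd C A" by (rule bdd_matsE[OF S]) (rule that)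
  then show thesis using mat_bd_pow[OF C] by (intro that[of C] mat_rad_le) auto
qed

text \<open>Together the three facts characterise \<open>gen_rad S\<close> as the least
  \<open>c \<ge> 0\<close> with \<open>mat_rad A \<le> c ^ p\<close> for all products
  \<open>A\<close> of \<open>p \<ge> 1\<close> factors. Later estimates use only this form.\<close>

lemma
  assumes S: "bdd_mats S"
  shows gen_rad_nonneg: "gen_rad S \<ge> 0"
    and mat_rad_le_gen_rad: "p \<ge> 1 \<Longrightarrow> A \<in> mat_pow S p \<Longrightarrow> mat_rad A \<le> gen_rad S ^ p"
    and gen_rad_le: "c \<ge> 0 \<Longrightarrow> (\<And>p A. p \<ge> 1 \<Longrightarrow> A \<in> mat_pow S p \<Longrightarrow> mat_rad A \<le> c ^ p) \<Longrightarrow> gen_rad S \<le> c"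
proof -
  obtain C where C: "C > 0" "\<And>p A. A \<in> mat_pow S p \<Longrightarrow> mat_rad A \<le> C ^ p"
    by (rule mat_rad_pow_le[OF S]) (rule that)
  define M where "M p = {mat_rad A | A. A \<in> mat_pow S p} \<union> {0}" for p
  have bM: "bdd_above (M p)" for p
    unfolding M_def using C by (intro bdd_aboveI[of _ "C ^ p"]) auto
  have M0: "Sup (M p) \<ge> 0" for p by (rule cSup_upper[OF _ bM]) (simp add: M_def)
  have root: "Sup (M p) powr (1 / real p) \<le> c"
    if p: "p \<ge> 1" and c: "c \<ge> 0" "\<And>A. A \<in> mat_pow S p \<Longrightarrow> mat_rad A \<le> c ^ p" for p c
  proof -
    have "Sup (M p) \<le> c ^ p" unfolding M_def by (rule cSup_least) (use c in auto)
    then have "Sup (M p) powr (1 / real p) \<le> (c ^ p) powr (1 / real p)" by (intro powr_mono2 M0) auto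
    also have "\<dots> = c" using p c(1) by (cases "c = 0") (simp_all add: powr_powr flip: powr_realpow)
    finally show ?thesis .
  qed
  let ?T = "{Sup (M p) powr (1 / real p) | p. p \<ge> 1} \<union> {0}"
  have g: "gen_rad S = Sup ?T" by (simp add: gen_rad_def M_def)
  have bT: "bdd_above ?T" using root C by (intro bdd_aboveI[of _ C]) auto
  show g0: "gen_rad S \<ge> 0" unfolding g by (rule cSup_upper[OF _ bT]) simp
  show "gen_rad S \<le> c" if "c \<ge> 0" "\<And>p A. p \<ge> 1 \<Longrightarrow> A \<in> mat_pow S p \<Longrightarrow> mat_rad A \<le> c ^ p"
    unfolding g by (rule cSup_least) (use root that in auto)
  show "mat_rad A \<le> gen_rad S ^ p" if p: "p \<ge> 1" and A: "A \<in> mat_pow S p"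
  proof -
    have "mat_rad A \<le> Sup (M p)" by (rule cSup_upper[OF _ bM]) (use A in \<open>auto simp: M_def\<close>)
    also have "\<dots> = (Sup (M p) powr (1 / real p)) ^ p"
      using p M0[of p] by (cases "Sup (M p) = 0") (simp_all add: powr_power)
    also have "\<dots> \<le> gen_rad S ^ p"
      unfolding g by (intro power_mono cSup_upper[OF _ bT]) (use p in auto)
    finally show ?thesis .
  qed
qed

lemma gen_rad_mono:
  assumes S: "bdd_mats S" and S': "bdd_mats S'" and le: "set_le S S'" shows "gen_rad S \<le> gen_rad S'"
proof (rule gen_rad_le[OF S gen_rad_nonneg[OF S']])
  fix p A assume p: "(p::nat) \<ge> 1" and A: "A \<in> mat_pow S p"
  obtain B where B: "B \<in> mat_pow S' p" "mat_le A B" using set_le_pow[OF S S' le] A by (auto simp: set_le_def)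
  obtain C where C: "mat_bd C B" using bdd_mats_mat_bd[OF bdd_mats_pow[OF S'] B(1)] by blast
  have "mat_rad A \<le> mat_rad B" by (rule mat_rad_mono[OF C set_le_bdd_nonneg[OF bdd_mats_pow[OF S] A] B(2)])
  also have "\<dots> \<le> gen_rad S' ^ p" by (rule mat_rad_le_gen_rad[OF S' p B(1)])
  finally show "mat_rad A \<le> gen_rad S' ^ p" .
qed

end

section \<open>Hadamard products of sets of matrices\<close>

context hadamard_weights
begin

abbreviation had_set :: "(nat \<Rightarrow> mat set) \<Rightarrow> mat set" where
  "had_set S \<equiv> hadamard_set S \<alpha> m"

lemma had_set_eq: "had_set S = {hadamard F | F. \<forall>j\<in>{1..m}. F j \<in> S j}"
  by (simp add: hadamard_set_def hadamard_def)

lemma had_setI: "(\<And>j. j \<in> {1..m} \<Longrightarrow> F j \<in> S j) \<Longrightarrow> hadamard F \<in> had_set S"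
  unfolding had_set_eq by blast

lemma had_setE:
  assumes "A \<in> had_set S" obtains F where "A = hadamard F" "\<And>j. j \<in> {1..m} \<Longrightarrow> F j \<in> S j"
  using assms unfolding had_set_eq by blast

lemma bdd_mats_choice:
  assumes "\<And>j. j \<in> {1..m} \<Longrightarrow> bdd_mats (S j)"
  obtains C where "\<And>j. j \<in> {1..m} \<Longrightarrow> C j > 0" "\<And>j A. j \<in> {1..m} \<Longrightarrow> A \<in> S j \<Longrightarrow> mat_bd (C j) A"
proof -
  have "\<forall>j\<in>{1..m}. \<exists>C>0. \<forall>A\<in>S j. mat_bd C A" using assms by (simp add: bdd_mats_def)
  from bchoice[OF this] show thesis using that by blast
qed

lemma bdd_had_set:
  assumes "\<And>j. j \<in> {1..m} \<Longrightarrow> bdd_mats (S j)" shows "bdd_mats (had_set S)"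
proof -
  obtain C where C: "\<And>j. j \<in> {1..m} \<Longrightarrow> C j > 0" "\<And>j A. j \<in> {1..m} \<Longrightarrow> A \<in> S j \<Longrightarrow> mat_bd (C j) A"
    by (rule bdd_mats_choice[OF assms]) (assumption, rule that)
  have "mat_bd (\<Prod>j\<in>{1..m}. C j powr \<alpha> j) A" if A: "A \<in> had_set S" for A
  proof -
    obtain F where F: "A = hadamard F" "\<And>j. j \<in> {1..m} \<Longrightarrow> F j \<in> S j" by (rule had_setE[OF A]) (rule that)
    show ?thesis unfolding F(1) by (rule mat_bd_hadamard[OF C(2)[OF _ F(2)] C(1)])
  qed
  moreover have "(\<Prod>j\<in>{1..m}. C j powr \<alpha> j) > 0" by (intro prod_pos) (use C(1) in force)
  ultimately show ?thesis unfolding bdd_mats_def by blast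
qed

text \<open>Induction on \<open>n\<close>: monotonicity of the product allows the right factor to be
  enlarged by the induction hypothesis, and \<open>hadamard_mult\<close> then merges the two
  Hadamard products.\<close>

lemma had_pow_le:
  assumes S: "\<And>j. j \<in> {1..m} \<Longrightarrow> bdd_mats (S j)"
  shows "set_le (mat_pow (had_set S) n) (had_set (\<lambda>j. mat_pow (S j) n))"
proof (induction n)
  case 0
  have "mat_le id_mat (hadamard (\<lambda>j. id_mat))"
    by (auto simp: mat_le_def hadamard_def id_mat_def prod_nonneg)
  moreover have "hadamard (\<lambda>j. id_mat) \<in> had_set (\<lambda>j. mat_pow (S j) 0)" by (rule had_setI) simp
  ultimately show ?case by (auto simp: set_le_def)
next
  case (Suc n)
  have Sn: "bdd_mats (mat_pow (S j) n)" if "j \<in> {1..m}" for j by (rule bdd_mats_pow[OF S[OF that]])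
  show ?case unfolding set_le_def
  proof
    fix A assume "A \<in> mat_pow (had_set S) (Suc n)"
    then obtain X Y where A: "A = mat_mult R X Y" and X: "X \<in> had_set S" and Y: "Y \<in> mat_pow (had_set S) n" by auto
    obtain F where F: "X = hadamard F" "\<And>j. j \<in> {1..m} \<Longrightarrow> F j \<in> S j" by (rule had_setE[OF X]) (rule that)
    obtain Y' where Y': "Y' \<in> had_set (\<lambda>j. mat_pow (S j) n)" "mat_le Y Y'" using Suc Y by (auto simp: set_le_def)
    obtain G where G: "Y' = hadamard G" "\<And>j. j \<in> {1..m} \<Longrightarrow> G j \<in> mat_pow (S j) n"
      by (rule had_setE[OF Y'(1)]) (rule that)
    obtain C where C: "\<And>j. j \<in> {1..m} \<Longrightarrow> C j > 0" "\<And>j A. j \<in> {1..m} \<Longrightarrow> A \<in> S j \<Longrightarrow> mat_bd (C j) A"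
      by (rule bdd_mats_choice[OF S]) (assumption, rule that)
    obtain D where D: "\<And>j. j \<in> {1..m} \<Longrightarrow> D j > 0" "\<And>j A. j \<in> {1..m} \<Longrightarrow> A \<in> mat_pow (S j) n \<Longrightarrow> mat_bd (D j) A"
      by (rule bdd_mats_choice[OF Sn]) (assumption, rule that)
    have "mat_le A (mat_mult R X Y')"
      unfolding A
    proof (rule mat_mult_mono)
      show "mat_bd (\<Prod>j\<in>{1..m}. C j powr \<alpha> j) X"
        unfolding F(1) by (rule mat_bd_hadamard[OF C(2)[OF _ F(2)] C(1)])
      show "mat_bd (\<Prod>j\<in>{1..m}. D j powr \<alpha> j) Y'"
        unfolding G(1) by (rule mat_bd_hadamard[OF D(2)[OF _ G(2)] D(1)])
      show "nonneg_mat X" unfolding F(1) by (rule nonneg_hadamard)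
      show "nonneg_mat Y" by (rule set_le_bdd_nonneg[OF bdd_mats_pow[OF bdd_had_set[OF S]] Y])
    qed (rule mat_le_refl Y'(2))+
    also have "mat_le \<dots> (hadamard (\<lambda>j. mat_mult R (F j) (G j)))"
      unfolding F(1) G(1) by (rule hadamard_mult[OF C(2)[OF _ F(2)] D(2)[OF _ G(2)]])
    finally have "mat_le A (hadamard (\<lambda>j. mat_mult R (F j) (G j)))" .
    moreover have "hadamard (\<lambda>j. mat_mult R (F j) (G j)) \<in> had_set (\<lambda>j. mat_pow (S j) (Suc n))"
      by (rule had_setI) (use F(2) G(2) in auto)
    ultimately show "\<exists>B\<in>had_set (\<lambda>j. mat_pow (S j) (Suc n)). mat_le A B" by blast
  qed
qed

text \<open>A product of \<open>n * p\<close> factors is cut into \<open>p\<close> blocks of length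
  \<open>n\<close>, and \<open>had_pow_le\<close> enlarges each block to a single member of the
  Hadamard set of the \<open>n\<close>-th powers.\<close>

lemma had_block_le:
  assumes S: "\<And>j. j \<in> {1..m} \<Longrightarrow> bdd_mats (S j)" and A: "A \<in> mat_pow (had_set S) (n * p)"
  shows "\<exists>B\<in>mat_pow (had_set (\<lambda>j. mat_pow (S j) n)) p. mat_le A B"
  using A
proof (induction p arbitrary: A)
  case 0
  then show ?case using mat_le_refl by simp
next
  case (Suc p)
  have H: "bdd_mats (had_set S)" by (rule bdd_had_set[OF S])
  have Hn: "bdd_mats (had_set (\<lambda>j. mat_pow (S j) n))" by (rule bdd_had_set[OF bdd_mats_pow[OF S]])
  have "A \<in> mat_pow (had_set S) (n + n * p)" using Suc.prems by simp
  from mat_pow_split[OF H this] obtain X Y where X: "X \<in> mat_pow (had_set S) n"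
    and Y: "Y \<in> mat_pow (had_set S) (n * p)" and XY: "op_eq A (\<lambda>x. mat_op R X (mat_op R Y x))" by blast
  obtain X' where X': "X' \<in> had_set (\<lambda>j. mat_pow (S j) n)" "mat_le X X'"
    using had_pow_le[of S n, OF S] X by (auto simp: set_le_def)
  obtain Y' where Y': "Y' \<in> mat_pow (had_set (\<lambda>j. mat_pow (S j) n)) p" "mat_le Y Y'" using Suc.IH[OF Y] by blast
  have "op_eq (mat_mult R X Y) (\<lambda>x. mat_op R X (mat_op R Y x))"
    by (rule op_eq_mult[OF bdd_mats_pow[OF H] bdd_mats_pow[OF H] X Y]) (simp_all add: op_eq_def)
  then have "mat_le A (mat_mult R X Y)" using XY by (intro mat_op_eqD) (simp add: op_eq_def)
  also have "mat_le (mat_mult R X Y) (mat_mult R X' Y')"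
  proof -
    obtain C D where "mat_bd C X'" "mat_bd D Y'"
      using bdd_mats_mat_bd[OF Hn X'(1)] bdd_mats_mat_bd[OF bdd_mats_pow[OF Hn] Y'(1)] by blast
    then show ?thesis
      by (rule mat_mult_mono[OF _ _ set_le_bdd_nonneg[OF bdd_mats_pow[OF H] X]
            set_le_bdd_nonneg[OF bdd_mats_pow[OF H] Y] X'(2) Y'(2)])
  qed
  finally have "mat_le A (mat_mult R X' Y')" .
  moreover have "mat_mult R X' Y' \<in> mat_pow (had_set (\<lambda>j. mat_pow (S j) n)) (Suc p)" using X' Y' by auto
  ultimately show ?case by blast
qed

text \<open>After \<open>had_pow_le\<close> for the \<open>n\<close>-th powers, each component is a
  product of \<open>p\<close> blocks. \<open>mat_pow_pow\<close> replaces it by a member of the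
  power \<open>n * p\<close> with the same operator, hence the same entries in
  \<open>R \<times> R\<close>.\<close>

lemma had_pow_pow_le:
  assumes S: "\<And>j. j \<in> {1..m} \<Longrightarrow> bdd_mats (S j)"
    and B: "B \<in> mat_pow (had_set (\<lambda>j. mat_pow (S j) n)) p"
  obtains F where "mat_le B (hadamard F)" "\<And>j. j \<in> {1..m} \<Longrightarrow> F j \<in> mat_pow (S j) (n * p)"
proof -
  obtain A where A: "A \<in> had_set (\<lambda>j. mat_pow (mat_pow (S j) n) p)" "mat_le B A"
    using had_pow_le[of "\<lambda>j. mat_pow (S j) n" p, OF bdd_mats_pow[OF S]] B by (auto simp: set_le_def)
  obtain G where G: "A = hadamard G" "\<And>j. j \<in> {1..m} \<Longrightarrow> G j \<in> mat_pow (mat_pow (S j) n) p"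
    by (rule had_setE[OF A(1)]) (rule that)
  have "\<forall>j\<in>{1..m}. \<exists>F\<in>mat_pow (S j) (n * p). op_eq F (mat_op R (G j))"
    using mat_pow_pow[OF S G(2)] by blast
  then obtain F where F: "\<And>j. j \<in> {1..m} \<Longrightarrow> F j \<in> mat_pow (S j) (n * p)"
    "\<And>j. j \<in> {1..m} \<Longrightarrow> op_eq (F j) (mat_op R (G j))" by metis
  have "mat_le (hadamard G) (hadamard F)"
    unfolding mat_le_def hadamard_def
  proof (intro ballI prod_mono conjI powr_mono2)
    fix a b j assume ab: "a \<in> R" "b \<in> R" and j: "j \<in> {1..m}"
    have "mat_le (G j) (F j)" using F(2)[OF j] by (intro mat_op_eqD) (simp add: op_eq_def)
    then show "G j a b \<le> F j a b" using ab by (simp add: mat_le_def)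
    show "0 \<le> G j a b"
      using set_le_bdd_nonneg[OF bdd_mats_pow[OF bdd_mats_pow[OF S[OF j]]] G(2)[OF j]] by (simp add: nonneg_mat_def)
    show "0 \<le> \<alpha> j" using \<alpha>_pos[OF j] by simp
  qed simp
  then have "mat_le B (hadamard F)" using A(2) unfolding G(1) by (rule mat_le_trans[rotated])
  then show thesis using F(1) by (rule that)
qed

text \<open>The limit defining the left side is taken along the multiples \<open>n * p\<close>,
  where \<open>had_block_le\<close> applies; the root of order \<open>n * p\<close> factors into
  those of orders \<open>p\<close> and \<open>n\<close>.\<close>

lemma joint_rad_block:
  assumes S: "\<And>j. j \<in> {1..m} \<Longrightarrow> bdd_mats (S j)" and n: "n \<ge> 1"
  shows "joint_rad (had_set S) \<le> joint_rad (had_set (\<lambda>j. mat_pow (S j) n)) powr (1 / real n)"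
proof -
  have H: "bdd_mats (had_set S)" by (rule bdd_had_set[OF S])
  have Hn: "bdd_mats (had_set (\<lambda>j. mat_pow (S j) n))" by (rule bdd_had_set[OF bdd_mats_pow[OF S]])
  interpret a: submult_seq "\<lambda>p. sup_ess (mat_pow (had_set S) p)" by (rule submult_sup_ess[OF H])
  interpret b: submult_seq "\<lambda>p. sup_ess (mat_pow (had_set (\<lambda>j. mat_pow (S j) n)) p)" by (rule submult_sup_ess[OF Hn])
  show ?thesis
    unfolding joint_rad_def
  proof (rule LIMSEQ_le[OF a.root_lim_tendsto_mult[OF n]])
    show "(\<lambda>p. (sup_ess (mat_pow (had_set (\<lambda>j. mat_pow (S j) n)) p) powr (1 / real p)) powr (1 / real n))
        \<longlonglongrightarrow> root_lim (\<lambda>p. sup_ess (mat_pow (had_set (\<lambda>j. mat_pow (S j) n)) p)) powr (1 / real n)"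
      using n by (intro tendsto_powr2 b.root_lim_tendsto tendsto_const) auto
    have "sup_ess (mat_pow (had_set S) (n * p)) powr (1 / real (n * p))
        \<le> (sup_ess (mat_pow (had_set (\<lambda>j. mat_pow (S j) n)) p) powr (1 / real p)) powr (1 / real n)" for p
    proof -
      have "sup_ess (mat_pow (had_set S) (n * p)) \<le> sup_ess (mat_pow (had_set (\<lambda>j. mat_pow (S j) n)) p)"
        by (rule sup_ess_mono[OF bdd_mats_pow[OF H] bdd_mats_pow[OF Hn]])
          (unfold set_le_def, rule ballI, rule had_block_le[OF S])
      then have "sup_ess (mat_pow (had_set S) (n * p)) powr (1 / real (n * p))
          \<le> sup_ess (mat_pow (had_set (\<lambda>j. mat_pow (S j) n)) p) powr (1 / real (n * p))"
        by (intro powr_mono2 a.nonneg) simp_all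
      then show ?thesis by (simp add: powr_powr mult.commute)
    qed
    then show "\<exists>N. \<forall>p\<ge>N. sup_ess (mat_pow (had_set S) (n * p)) powr (1 / real (n * p))
        \<le> (sup_ess (mat_pow (had_set (\<lambda>j. mat_pow (S j) n)) p) powr (1 / real p)) powr (1 / real n)" by blast
  qed
qed

lemma sup_ess_prod:
  assumes S: "\<And>j. j \<in> {1..m} \<Longrightarrow> bdd_mats (S j)"
  shows "sup_ess (mat_pow (had_set (\<lambda>j. mat_pow (S j) n)) p) \<le> (\<Prod>j\<in>{1..m}. sup_ess (mat_pow (S j) (n * p)) powr \<alpha> j)"
proof (rule sup_ess_le)
  show "0 \<le> (\<Prod>j\<in>{1..m}. sup_ess (mat_pow (S j) (n * p)) powr \<alpha> j)" by (simp add: prod_nonneg)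
  fix B assume B: "B \<in> mat_pow (had_set (\<lambda>j. mat_pow (S j) n)) p"
  have Snp: "bdd_mats (mat_pow (S j) q)" if "j \<in> {1..m}" for j q by (rule bdd_mats_pow[OF S[OF that]])
  obtain F where F: "mat_le B (hadamard F)" "\<And>j. j \<in> {1..m} \<Longrightarrow> F j \<in> mat_pow (S j) (n * p)"
    by (rule had_pow_pow_le[OF S B]) (assumption, rule that)
  obtain C where C: "\<And>j. j \<in> {1..m} \<Longrightarrow> C j > 0" "\<And>j A. j \<in> {1..m} \<Longrightarrow> A \<in> mat_pow (S j) (n * p) \<Longrightarrow> mat_bd (C j) A"
    by (rule bdd_mats_choice[OF Snp]) (assumption, rule that)
  note Fb = C(2)[OF _ F(2)]
  have "nonneg_mat B" by (rule set_le_bdd_nonneg[OF bdd_mats_pow[OF bdd_had_set[OF bdd_mats_pow[OF S]]] B])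
  then have "ess B \<le> ess (hadamard F)" using ess_norm_mat_mono[OF mat_bd_hadamard[OF Fb C(1)] _ F(1)] by blast
  also have "\<dots> \<le> (\<Prod>j\<in>{1..m}. ess (F j) powr \<alpha> j)" by (rule ess_norm_hadamard[OF Fb])
  also have "\<dots> \<le> (\<Prod>j\<in>{1..m}. sup_ess (mat_pow (S j) (n * p)) powr \<alpha> j)"
  proof (intro prod_mono conjI powr_mono2)
    fix j assume j: "j \<in> {1..m}"
    show "0 \<le> \<alpha> j" using \<alpha>_pos[OF j] by simp
    show "0 \<le> ess (F j)" by (rule ess_nonneg[OF Fb[OF j j]])
    show "ess (F j) \<le> sup_ess (mat_pow (S j) (n * p))" by (rule ess_le_sup_ess[OF Snp[OF j] F(2)[OF j]])
  qed simp
  finally show "ess B \<le> (\<Prod>j\<in>{1..m}. sup_ess (mat_pow (S j) (n * p)) powr \<alpha> j)" .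
qed

text \<open>Take roots of order \<open>n * p\<close> in \<open>sup_ess_prod\<close>: on the right
  they give the joint radius of each \<open>S j\<close> along multiples of \<open>n\<close>, on the
  left the outer power \<open>1 / n\<close> appears.\<close>

lemma joint_rad_prod:
  assumes S: "\<And>j. j \<in> {1..m} \<Longrightarrow> bdd_mats (S j)" and n: "n \<ge> 1"
  shows "joint_rad (had_set (\<lambda>j. mat_pow (S j) n)) powr (1 / real n) \<le> (\<Prod>j\<in>{1..m}. joint_rad (S j) powr \<alpha> j)"
proof -
  have Hn: "bdd_mats (had_set (\<lambda>j. mat_pow (S j) n))" by (rule bdd_had_set[OF bdd_mats_pow[OF S]])
  interpret b: submult_seq "\<lambda>p. sup_ess (mat_pow (had_set (\<lambda>j. mat_pow (S j) n)) p)" by (rule submult_sup_ess[OF Hn])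
  let ?u = "\<lambda>j p. sup_ess (mat_pow (S j) p)"
  show ?thesis
    unfolding joint_rad_def
  proof (rule LIMSEQ_le)
    show "(\<lambda>p. (sup_ess (mat_pow (had_set (\<lambda>j. mat_pow (S j) n)) p) powr (1 / real p)) powr (1 / real n))
        \<longlonglongrightarrow> root_lim (\<lambda>p. sup_ess (mat_pow (had_set (\<lambda>j. mat_pow (S j) n)) p)) powr (1 / real n)"
      using n by (intro tendsto_powr2 b.root_lim_tendsto tendsto_const) auto
    show "(\<lambda>p. \<Prod>j\<in>{1..m}. (?u j (n * p) powr (1 / real (n * p))) powr \<alpha> j) \<longlonglongrightarrow> (\<Prod>j\<in>{1..m}. root_lim (?u j) powr \<alpha> j)"
    proof (rule tendsto_prod)
      fix j assume j: "j \<in> {1..m}"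
      interpret u: submult_seq "?u j" by (rule submult_sup_ess[OF S[OF j]])
      show "(\<lambda>p. (?u j (n * p) powr (1 / real (n * p))) powr \<alpha> j) \<longlonglongrightarrow> root_lim (?u j) powr \<alpha> j"
        by (intro tendsto_powr2 u.root_lim_tendsto_mult n tendsto_const \<alpha>_pos[OF j]) simp
    qed
    have "(sup_ess (mat_pow (had_set (\<lambda>j. mat_pow (S j) n)) p) powr (1 / real p)) powr (1 / real n)
        \<le> (\<Prod>j\<in>{1..m}. (?u j (n * p) powr (1 / real (n * p))) powr \<alpha> j)" for p
    proof -
      have "(sup_ess (mat_pow (had_set (\<lambda>j. mat_pow (S j) n)) p) powr (1 / real p)) powr (1 / real n)
          = sup_ess (mat_pow (had_set (\<lambda>j. mat_pow (S j) n)) p) powr (1 / real (n * p))"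
        by (simp add: powr_powr mult.commute)
      also have "\<dots> \<le> (\<Prod>j\<in>{1..m}. ?u j (n * p) powr \<alpha> j) powr (1 / real (n * p))"
        by (intro powr_mono2 b.nonneg sup_ess_prod S) simp_all
      also have "\<dots> = (\<Prod>j\<in>{1..m}. (?u j (n * p) powr \<alpha> j) powr (1 / real (n * p)))"
        by (simp add: prod_powr_distrib)
      finally show ?thesis by (simp only: powr_powr mult.commute)
    qed
    then show "\<exists>N. \<forall>p\<ge>N. (sup_ess (mat_pow (had_set (\<lambda>j. mat_pow (S j) n)) p) powr (1 / real p)) powr (1 / real n)
        \<le> (\<Prod>j\<in>{1..m}. (?u j (n * p) powr (1 / real (n * p))) powr \<alpha> j)" by blast
  qed
qed

text \<open>The joint estimates for singletons with \<open>n = 1\<close>; the generalized radius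
  rests on this single-matrix case.\<close>

lemma mat_rad_hadamard:
  assumes A: "\<And>j. j \<in> {1..m} \<Longrightarrow> mat_bd (C j) (A j)"
  shows "mat_rad (hadamard A) \<le> (\<Prod>j\<in>{1..m}. mat_rad (A j) powr \<alpha> j)"
proof -
  have S: "bdd_mats {A j}" if "j \<in> {1..m}" for j by (rule bdd_mats_singleton[OF A[OF that]])
  have "had_set (\<lambda>j. {A j}) = {hadamard A}"
  proof -
    have "B = hadamard A" if B: "B \<in> had_set (\<lambda>j. {A j})" for B
    proof -
      obtain F where F: "B = hadamard F" "\<And>j. j \<in> {1..m} \<Longrightarrow> F j \<in> {A j}" by (rule had_setE[OF B]) (rule that)
      then show ?thesis by (simp add: hadamard_def)
    qed
    moreover have "hadamard A \<in> had_set (\<lambda>j. {A j})" by (rule had_setI) simp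
    ultimately show ?thesis by blast
  qed
  then have "mat_rad (hadamard A) = joint_rad (had_set (\<lambda>j. {A j}))" by (simp add: mat_rad_def)
  also have "\<dots> \<le> joint_rad (had_set (\<lambda>j. mat_pow {A j} 1)) powr (1 / real 1)"
    by (rule joint_rad_block[OF S]) simp_all
  also have "\<dots> \<le> (\<Prod>j\<in>{1..m}. joint_rad {A j} powr \<alpha> j)" by (rule joint_rad_prod[OF S]) simp_all
  finally show ?thesis by (simp add: mat_rad_def)
qed

text \<open>The length \<open>p\<close> of a product \<open>A\<close> need not be a multiple of
  \<open>n\<close>. Its \<open>n\<close>-th power has length \<open>n * p\<close>, can be cut into
  blocks, and has radius \<open>mat_rad A ^ n\<close>; comparing \<open>n\<close>-th powers gives
  the claim.\<close>

lemma gen_rad_block: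
  assumes S: "\<And>j. j \<in> {1..m} \<Longrightarrow> bdd_mats (S j)" and n: "n \<ge> 1"
  shows "gen_rad (had_set S) \<le> gen_rad (had_set (\<lambda>j. mat_pow (S j) n)) powr (1 / real n)"
proof (rule gen_rad_le)
  show H: "bdd_mats (had_set S)" by (rule bdd_had_set[OF S])
  have Hn: "bdd_mats (had_set (\<lambda>j. mat_pow (S j) n))" by (rule bdd_had_set[OF bdd_mats_pow[OF S]])
  let ?g = "gen_rad (had_set (\<lambda>j. mat_pow (S j) n))"
  have g0: "?g \<ge> 0" by (rule gen_rad_nonneg[OF Hn])
  fix p A assume p: "(p::nat) \<ge> 1" and A: "A \<in> mat_pow (had_set S) p"
  obtain C where C: "mat_bd C A" using bdd_mats_mat_bd[OF bdd_mats_pow[OF H] A] by blast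
  obtain Z where Z: "Z \<in> mat_pow (had_set S) (n * p)" "op_eq Z (mat_op R A ^^ n)"
    using mat_pow_funpow[OF H A] by blast
  obtain E where E: "mat_bd E Z" using bdd_mats_mat_bd[OF bdd_mats_pow[OF H] Z(1)] by blast
  obtain B where B: "B \<in> mat_pow (had_set (\<lambda>j. mat_pow (S j) n)) p" "mat_le Z B"
    using had_block_le[of S Z n p, OF S Z(1)] by blast
  obtain D where D: "mat_bd D B" using bdd_mats_mat_bd[OF bdd_mats_pow[OF Hn] B(1)] by blast
  have "mat_rad A ^ n = mat_rad Z" by (rule mat_rad_funpow[OF C E Z(2) n, symmetric])
  also have "\<dots> \<le> mat_rad B"
    by (rule mat_rad_mono[OF D set_le_bdd_nonneg[OF bdd_mats_pow[OF H] Z(1)] B(2)])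
  also have "\<dots> \<le> ?g ^ p" by (rule mat_rad_le_gen_rad[OF Hn p B(1)])
  also have "\<dots> = ((?g powr (1 / real n)) ^ p) ^ n"
  proof -
    have "((?g powr (1 / real n)) ^ p) ^ n = ((?g powr (1 / real n)) ^ n) ^ p"
      by (simp add: mult.commute flip: power_mult)
    also have "(?g powr (1 / real n)) ^ n = ?g" using n g0 by (cases "?g = 0") (simp_all add: powr_power)
    finally show ?thesis by simp
  qed
  finally show "mat_rad A \<le> (?g powr (1 / real n)) ^ p"
    by (rule power_le_imp_le_base[of _ "n - 1", unfolded Suc_diff_1[OF less_le_trans[OF zero_less_one n]]]) simp
qed simp

text \<open>A product \<open>B\<close> of \<open>p\<close> members is dominated by a Hadamard
  product of members of the powers \<open>n * p\<close>. Then \<open>mat_rad_hadamard\<close> and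
  the characterisation of \<open>gen_rad\<close> bound its radius by the \<open>n * p\<close>-th
  power of the right side.\<close>

lemma gen_rad_prod:
  assumes S: "\<And>j. j \<in> {1..m} \<Longrightarrow> bdd_mats (S j)" and n: "n \<ge> 1"
  shows "gen_rad (had_set (\<lambda>j. mat_pow (S j) n)) powr (1 / real n) \<le> (\<Prod>j\<in>{1..m}. gen_rad (S j) powr \<alpha> j)"
proof -
  have Hn: "bdd_mats (had_set (\<lambda>j. mat_pow (S j) n))" by (rule bdd_had_set[OF bdd_mats_pow[OF S]])
  define c where "c = (\<Prod>j\<in>{1..m}. gen_rad (S j) powr \<alpha> j)"
  have c0: "c \<ge> 0" by (simp add: c_def prod_nonneg)
  have "gen_rad (had_set (\<lambda>j. mat_pow (S j) n)) \<le> c ^ n"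
  proof (rule gen_rad_le[OF Hn])
    fix p B assume p: "(p::nat) \<ge> 1" and B: "B \<in> mat_pow (had_set (\<lambda>j. mat_pow (S j) n)) p"
    have Snp: "bdd_mats (mat_pow (S j) q)" if "j \<in> {1..m}" for j q by (rule bdd_mats_pow[OF S[OF that]])
    obtain F where F: "mat_le B (hadamard F)" "\<And>j. j \<in> {1..m} \<Longrightarrow> F j \<in> mat_pow (S j) (n * p)"
      by (rule had_pow_pow_le[OF S B]) (assumption, rule that)
    obtain C where C: "\<And>j. j \<in> {1..m} \<Longrightarrow> C j > 0" "\<And>j A. j \<in> {1..m} \<Longrightarrow> A \<in> mat_pow (S j) (n * p) \<Longrightarrow> mat_bd (C j) A"
      by (rule bdd_mats_choice[OF Snp]) (assumption, rule that)
    note Fb = C(2)[OF _ F(2)]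
    have np: "n * p \<ge> 1" using n p by simp
    have "nonneg_mat B" by (rule set_le_bdd_nonneg[OF bdd_mats_pow[OF Hn] B])
    then have "mat_rad B \<le> mat_rad (hadamard F)" using mat_rad_mono[OF mat_bd_hadamard[OF Fb C(1)] _ F(1)] by blast
    also have "\<dots> \<le> (\<Prod>j\<in>{1..m}. mat_rad (F j) powr \<alpha> j)" by (rule mat_rad_hadamard[OF Fb])
    also have "\<dots> \<le> (\<Prod>j\<in>{1..m}. (gen_rad (S j) powr \<alpha> j) ^ (n * p))"
    proof (rule prod_mono, intro conjI)
      fix j assume j: "j \<in> {1..m}"
      have "mat_rad (F j) powr \<alpha> j \<le> (gen_rad (S j) ^ (n * p)) powr \<alpha> j"
      proof (rule powr_mono2)
        show "0 \<le> \<alpha> j" using \<alpha>_pos[OF j] by simp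
        show "0 \<le> mat_rad (F j)" by (rule mat_rad_nonneg[OF Fb[OF j j]])
        show "mat_rad (F j) \<le> gen_rad (S j) ^ (n * p)" by (rule mat_rad_le_gen_rad[OF S[OF j] np F(2)[OF j]])
      qed
      also have "\<dots> = (gen_rad (S j) powr \<alpha> j) ^ (n * p)"
      proof (cases "gen_rad (S j) = 0")
        case True
        have "0 < n * p" using np by linarith
        then show ?thesis by (simp only: True zero_power powr_0)
      next
        case False
        then show ?thesis
          using gen_rad_nonneg[OF S[OF j]] by (simp add: powr_powr mult.commute flip: powr_realpow)
      qed
      finally show "mat_rad (F j) powr \<alpha> j \<le> (gen_rad (S j) powr \<alpha> j) ^ (n * p)" .
    qed simp
    also have "\<dots> = (c ^ n) ^ p" by (simp add: c_def prod_power_distrib power_mult)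
    finally show "mat_rad B \<le> (c ^ n) ^ p" .
  qed (simp add: c0)
  then have "gen_rad (had_set (\<lambda>j. mat_pow (S j) n)) powr (1 / real n) \<le> (c ^ n) powr (1 / real n)"
    by (intro powr_mono2 gen_rad_nonneg[OF Hn]) simp_all
  also have "\<dots> = c" using n c0 by (cases "c = 0") (simp_all add: powr_powr flip: powr_realpow)
  finally show ?thesis by (simp add: c_def)
qed

text \<open>Choosing Hadamard factors for every summand reduces this to \<open>hadamard_sum\<close>;
  for each fixed \<open>j\<close> the chosen factors add up to a member of the \<open>j\<close>-th
  sum of sets.\<close>

lemma set_sum_hadamard_le:
  assumes "\<And>i j A. i \<in> {1..k} \<Longrightarrow> j \<in> {1..m} \<Longrightarrow> A \<in> \<Psi> i j \<Longrightarrow> nonneg_mat A"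
  shows "set_le (set_sum (\<lambda>i. had_set (\<Psi> i)) k) (had_set (\<lambda>j. set_sum (\<lambda>i. \<Psi> i j) k))"
  unfolding set_le_def
proof
  fix A assume "A \<in> set_sum (\<lambda>i. had_set (\<Psi> i)) k"
  then obtain G where G: "A = (\<lambda>a b. \<Sum>i\<in>{1..k}. G i a b)" "\<forall>i\<in>{1..k}. G i \<in> had_set (\<Psi> i)"
    unfolding set_sum_def by blast
  then have "\<forall>i\<in>{1..k}. \<exists>F. G i = hadamard F \<and> (\<forall>j\<in>{1..m}. F j \<in> \<Psi> i j)"
    unfolding had_set_eq by blast
  then obtain F where F: "\<And>i. i \<in> {1..k} \<Longrightarrow> G i = hadamard (F i)"
    "\<And>i j. i \<in> {1..k} \<Longrightarrow> j \<in> {1..m} \<Longrightarrow> F i j \<in> \<Psi> i j" by metis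
  have "A = (\<lambda>a b. \<Sum>i\<in>{1..k}. hadamard (F i) a b)" unfolding G(1) using F(1) by (intro ext sum.cong) auto
  then have "mat_le A (hadamard (\<lambda>j a b. \<Sum>i\<in>{1..k}. F i j a b))"
    using hadamard_sum[of "{1..k}" F] assms F(2) by simp
  moreover have "hadamard (\<lambda>j a b. \<Sum>i\<in>{1..k}. F i j a b) \<in> had_set (\<lambda>j. set_sum (\<lambda>i. \<Psi> i j) k)"
  proof (rule had_setI)
    fix j assume "j \<in> {1..m}"
    then show "(\<lambda>a b. \<Sum>i\<in>{1..k}. F i j a b) \<in> set_sum (\<lambda>i. \<Psi> i j) k"
      unfolding set_sum_def using F(2) by (intro CollectI exI[of _ "\<lambda>i. F i j"]) simp
  qed
  ultimately show "\<exists>B\<in>had_set (\<lambda>j. set_sum (\<lambda>i. \<Psi> i j) k). mat_le A B" by blast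
qed

end

context oc_seq_space
begin

lemma bdd_set_sum:
  assumes "\<And>i. i \<in> {1..k} \<Longrightarrow> bdd_mats (S i)" shows "bdd_mats (set_sum S k)"
proof -
  have "\<forall>i\<in>{1..k}. \<exists>C>0. \<forall>A\<in>S i. mat_bd C A" using assms by (simp add: bdd_mats_def)
  from bchoice[OF this] obtain C where C: "\<forall>i\<in>{1..k}. C i > 0 \<and> (\<forall>A\<in>S i. mat_bd (C i) A)" by blast
  \<comment> \<open>The \<open>+ 1\<close> keeps the common bound positive even for an empty
    sum.\<close>
  have "mat_bd ((\<Sum>i\<in>{1..k}. C i) + 1) A" if "A \<in> set_sum S k" for A
  proof -
    obtain F where F: "A = (\<lambda>a b. \<Sum>i\<in>{1..k}. F i a b)" "\<forall>i\<in>{1..k}. F i \<in> S i"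
      using \<open>A \<in> set_sum S k\<close> unfolding set_sum_def by blast
    have "mat_bd (\<Sum>i\<in>{1..k}. C i) A" unfolding F(1) by (rule mat_bd_sum) (use C F(2) in auto)
    then show ?thesis by (rule mat_bd_weaken) simp
  qed
  moreover have "(\<Sum>i\<in>{1..k}. C i) + 1 > 0" by (intro add_nonneg_pos sum_nonneg) (use C in \<open>auto simp: less_imp_le\<close>)
  ultimately show ?thesis unfolding bdd_mats_def by blast
qed

lemma bdd_matsI:
  assumes "\<forall>A\<in>S. nonneg_mat A \<and> defines_op R L A" "bounded_ops L nrm (mat_op R ` S)" shows "bdd_mats S"
proof -
  obtain C where C: "\<forall>A\<in>S. \<forall>x\<in>L. nrm (mat_op R A x) \<le> C * nrm x" using assms(2) by (auto simp: bounded_ops_def)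
  have "mat_bd (\<bar>C\<bar> + 1) A" if "A \<in> S" for A
  proof (rule mat_bd_weaken)
    show "mat_bd C A" using assms(1) C that by (simp add: mat_bd_def)
  qed simp
  then show ?thesis unfolding bdd_mats_def by (intro exI[of _ "\<bar>C\<bar> + 1"]) auto
qed

end

text \<open>The three inequalities are monotonicity under entrywise domination, the block estimate
  and the product estimate, each available for \<open>gen_rad\<close> and for
  \<open>joint_rad\<close>. All sets involved are bounded, which permits the passage from
  \<open>r\<close> to these two radii.\<close>

theorem theorem4p1:
  fixes R :: "nat set" and L :: "seq set" and nrm :: "seq \<Rightarrow> real"
    and m k n :: nat and \<alpha> :: "nat \<Rightarrow> real" and \<Psi> :: "nat \<Rightarrow> nat \<Rightarrow> mat set"
    and r :: "mat set \<Rightarrow> real"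
  assumes L: "class_L R L nrm"
    and ocL: "oc_norm L nrm" and ocLd: "dual_oc_norm L nrm"
    and m: "m \<ge> 1" and alpha_pos: "\<forall>j\<in>{1..m}. \<alpha> j > 0" and alpha_sum: "(\<Sum>j\<in>{1..m}. \<alpha> j) \<ge> 1"
    and n: "n \<ge> 1" and k: "k \<ge> 1"
    and r: "r = (\<lambda>\<Psi>. gen_ess_rad L nrm (mat_op R ` \<Psi>)) \<or> r = (\<lambda>\<Psi>. joint_ess_rad L nrm (mat_op R ` \<Psi>))"
    and Psi: "\<forall>i\<in>{1..k}. \<forall>j\<in>{1..m}. (\<forall>A\<in>\<Psi> i j. nonneg_mat A \<and> defines_op R L A)
                 \<and> bounded_ops L nrm (mat_op R ` \<Psi> i j)"
  shows "r (set_sum (\<lambda>i. hadamard_set (\<lambda>j. \<Psi> i j) \<alpha> m) k)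
           \<le> r (hadamard_set (\<lambda>j. set_sum (\<lambda>i. \<Psi> i j) k) \<alpha> m) \<and>
         r (hadamard_set (\<lambda>j. set_sum (\<lambda>i. \<Psi> i j) k) \<alpha> m)
           \<le> r (hadamard_set (\<lambda>j. mat_set_pow R (set_sum (\<lambda>i. \<Psi> i j) k) n) \<alpha> m) powr (1 / real n) \<and>
         r (hadamard_set (\<lambda>j. mat_set_pow R (set_sum (\<lambda>i. \<Psi> i j) k) n) \<alpha> m) powr (1 / real n)
           \<le> (\<Prod>j\<in>{1..m}. r (set_sum (\<lambda>i. \<Psi> i j) k) powr (\<alpha> j))"
proof -
  interpret hadamard_weights R L nrm \<alpha> m
    by unfold_locales (use L ocL m alpha_pos alpha_sum in auto)
  let ?S = "\<lambda>j. set_sum (\<lambda>i. \<Psi> i j) k"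
  have P: "bdd_mats (\<Psi> i j)" if "i \<in> {1..k}" "j \<in> {1..m}" for i j
    using Psi that by (intro bdd_matsI) auto
  have S: "bdd_mats (?S j)" if "j \<in> {1..m}" for j by (rule bdd_set_sum[OF P[OF _ that]])
  have H: "bdd_mats (had_set ?S)" by (rule bdd_had_set[OF S])
  have Hn: "bdd_mats (had_set (\<lambda>j. mat_pow (?S j) n))" by (rule bdd_had_set[OF bdd_mats_pow[OF S]])
  have H0: "bdd_mats (set_sum (\<lambda>i. had_set (\<Psi> i)) k)" by (rule bdd_set_sum[OF bdd_had_set[OF P]])
  have le: "set_le (set_sum (\<lambda>i. had_set (\<Psi> i)) k) (had_set ?S)"
    using Psi by (intro set_sum_hadamard_le) blast
  show ?thesis
    using r
  proof
    assume r: "r = (\<lambda>\<Psi>. gen_ess_rad L nrm (mat_op R ` \<Psi>))"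
    have e: "r S = gen_rad S" if "bdd_mats S" for S using gen_ess_rad_eq[OF that] by (simp add: r)
    have p: "(\<Prod>j\<in>{1..m}. r (?S j) powr \<alpha> j) = (\<Prod>j\<in>{1..m}. gen_rad (?S j) powr \<alpha> j)"
      using e[OF S] by (intro prod.cong) simp_all
    show ?thesis
      unfolding e[OF H] e[OF Hn] e[OF H0] p
      using gen_rad_mono[OF H0 H le] gen_rad_block[of ?S n, OF S n] gen_rad_prod[of ?S n, OF S n] by blast
  next
    assume r: "r = (\<lambda>\<Psi>. joint_ess_rad L nrm (mat_op R ` \<Psi>))"
    have e: "r S = joint_rad S" if "bdd_mats S" for S using joint_ess_rad_eq[OF that] by (simp add: r)
    have p: "(\<Prod>j\<in>{1..m}. r (?S j) powr \<alpha> j) = (\<Prod>j\<in>{1..m}. joint_rad (?S j) powr \<alpha> j)"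
      using e[OF S] by (intro prod.cong) simp_all
    show ?thesis
      unfolding e[OF H] e[OF Hn] e[OF H0] p
      using joint_rad_mono[OF H0 H le] joint_rad_block[of ?S n, OF S n] joint_rad_prod[of ?S n, OF S n] by blast
  qed
qed

end
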